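(* Let $n\ge0$, and fix a generating system $\langle x_1,\dots,x_n\rangle$ of the free group $F_n$ of rank $n$. For each $k\ge2$, the Johnson homomorphism $$J_k:\mathrm{Aut}\,F_n^{\mathrm{acy}}[k]\to \mathrm{Hom}(H_1(F_n),(\Gamma^kF_n)/(\Gamma^{k+1}F_n))$$ has a refinement, i.e. there is a homomorphism $$\widetilde J_k:\mathrm{Aut}\,F_n^{\mathrm{acy}}[k]\longrightarrow \mathrm{Hom}(H_1(F_n),(\Gamma^kF_n)/(\Gamma^{2k-1}F_n)),$$ whose target is also a finitely generated free abelian group, such that the composite of $\widetilde J_k$ with the map induced by the natural projection $p_1:(\Gamma^kF_n)/(\Gamma^{2k-1}F_n)\to(\Gamma^kF_n)/(\Gamma^{k+1}F_n)$ is $J_k$. Moreover $\widetilde J_k$ is surjective and its kernel coincides with $\mathrm{Aut}\,F_n^{\mathrm{acy}}[2k-1]$, so that there is an exact sequence $$1\to\mathrm{Aut}\,F_n^{\mathrm{acy}}[2k-1]\to\mathrm{Aut}\,F_n^{\mathrm{acy}}[k]\xrightarrow{\widetilde J_k}\mathrm{Hom}(H_1(F_n),(\Gamma^kF_n)/(\Gamma^{2k-1}F_n))\to1.$$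
   Context: **Lower central series.** $\Gamma^1G=G$, $\Gamma^iG=[\Gamma^{i-1}G,G]$ for $i\ge2$; $N_k=F_n/(\Gamma^kF_n)$. **Acyclic closure.** For a group $G$ and a free group $F_m=\langle x_1,\dots,x_m\rangle$, an element $w\in G*F_m$ is acyclic if it lies in the kernel of $G*F_m\to F_m\to H_1(F_m)$. An acyclic system over $G$ is a system of equations $x_i=w_i(x_1,\dots,x_m)$, $i=1,\dots,m$, with every $w_i\in G*F_m$ acyclic. $G$ is acyclically closed (AC) if every acyclic system over $G$, for every $m\ge0$, has a unique solution in $G$. The acyclic closure of $G$ is the pair $(G^{\mathrm{acy}},\iota_G:G\to G^{\mathrm{acy}})$, unique up to isomorphism, such that $G^{\mathrm{acy}}$ is AC and every homomorphism $f:G\to A$ to an AC-group factors uniquely as $f=f^{\mathrm{acy}}\circ\iota_G$. Known facts: $\iota_{F_n}:F_n\to F_n^{\mathrm{acy}}$ is injective and induces isomorphisms $N_k\cong F_n^{\mathrm{acy}}/\Gamma^kF_n^{\mathrm{acy}}$ for all $k\ge2$. **Johnson homomorphisms.** Via these isomorphisms, each automorphism of $F_n^{\mathrm{acy}}$ induces an automorphism of $N_k$, giving $\Phi_k:\mathrm{Aut}\,F_n^{\mathrm{acy}}\to\mathrm{Aut}\,N_k$. Put $\mathrm{Aut}\,F_n^{\mathrm{acy}}[k]=\mathrm{Ker}\,\Phi_k$ for $k\ge2$. There is an isomorphism $\mathrm{Ker}(\mathrm{Aut}\,N_{k+1}\to\mathrm{Aut}\,N_k)\cong\mathrm{Hom}(H_1(F_n),(\Gamma^kF_n)/(\Gamma^{k+1}F_n))=\mathrm{Hom}(F_n,(\Gamma^kF_n)/(\Gamma^{k+1}F_n))$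 sending $f$ to the homomorphism $x_i\mapsto\widetilde f(x_i)x_i^{-1}$, where $\widetilde f\in\mathrm{End}\,F_n$ is any lift of $f$. $J_k$ is the restriction of $\Phi_{k+1}$ to $\mathrm{Aut}\,F_n^{\mathrm{acy}}[k]$ followed by this isomorphism. *)

theory Defs
  imports "HOL-Algebra.Algebra" "HOL-Algebra.Bij"
begin

section \<open>Free groups and free products\<close>

text \<open>The monoid presented by the generators \<open>A\<close> and the relations \<open>r\<close>: words over \<open>A\<close> modulo the
  least congruence containing \<open>r\<close>.\<close>

inductive_set word_cong :: "'c set \<Rightarrow> ('c list \<times> 'c list) set \<Rightarrow> ('c list \<times> 'c list) set"
  for A r where
    base: "(u, v) \<in> r \<Longrightarrow> u \<in> lists A \<Longrightarrow> v \<in> lists A \<Longrightarrow> (u, v) \<in> word_cong A r"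
  | refl: "u \<in> lists A \<Longrightarrow> (u, u) \<in> word_cong A r"
  | sym: "(u, v) \<in> word_cong A r \<Longrightarrow> (v, u) \<in> word_cong A r"
  | trans: "(u, v) \<in> word_cong A r \<Longrightarrow> (v, w) \<in> word_cong A r \<Longrightarrow> (u, w) \<in> word_cong A r"
  | append: "(u, u') \<in> word_cong A r \<Longrightarrow> (v, v') \<in> word_cong A r
      \<Longrightarrow> (u @ v, u' @ v') \<in> word_cong A r"

definition presented_monoid :: "'c set \<Rightarrow> ('c list \<times> 'c list) set \<Rightarrow> 'c list set monoid" where
  "presented_monoid A r =
    \<lparr>carrier = lists A // word_cong A r,
     monoid.mult = (\<lambda>C D. word_cong A r `` {u @ v | u v. u \<in> C \<and> v \<in> D}),
     one = word_cong A r `` {[]}\<rparr>"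

definition word_val :: "('a, 'm) monoid_scheme \<Rightarrow> ('c \<Rightarrow> 'a) \<Rightarrow> 'c list \<Rightarrow> 'a" where
  "word_val K \<phi> w = foldr (\<lambda>a k. \<phi> a \<otimes>\<^bsub>K\<^esub> k) w \<one>\<^bsub>K\<^esub>"

definition word_lift :: "('a, 'm) monoid_scheme \<Rightarrow> ('c \<Rightarrow> 'a) \<Rightarrow> 'c list set \<Rightarrow> 'a" where
  "word_lift K \<phi> C = the_elem (word_val K \<phi> ` C)"

text \<open>The letters \<open>(s, True)\<close> and \<open>(s, False)\<close> stand for \<open>s\<close> and its inverse.\<close>

definition free_group_rels :: "'s set \<Rightarrow> (('s \<times> bool) list \<times> ('s \<times> bool) list) set" where
  "free_group_rels S = {([(s, b), (s, \<not> b)], []) | s b. s \<in> S}"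

definition free_group :: "'s set \<Rightarrow> ('s \<times> bool) list set monoid" where
  "free_group S = presented_monoid (S \<times> UNIV) (free_group_rels S)"

definition free_gen :: "'s set \<Rightarrow> 's \<Rightarrow> ('s \<times> bool) list set" where
  "free_gen S s = word_cong (S \<times> UNIV) (free_group_rels S) `` {[(s, True)]}"

definition free_group_lift ::
    "('a, 'm) monoid_scheme \<Rightarrow> ('s \<Rightarrow> 'a) \<Rightarrow> ('s \<times> bool) list set \<Rightarrow> 'a" where
  "free_group_lift K x = word_lift K (\<lambda>(s, b). if b then x s else inv\<^bsub>K\<^esub> x s)"

definition free_basis :: "('a, 'm) monoid_scheme \<Rightarrow> 's set \<Rightarrow> ('s \<Rightarrow> 'a) \<Rightarrow> bool" where
  "free_basis F S x \<longleftrightarrow>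
     group F \<and> x \<in> S \<rightarrow> carrier F \<and> free_group_lift F x \<in> iso (free_group S) F"

definition free_product_rels ::
    "('a, 'm) monoid_scheme \<Rightarrow> ('b, 'n) monoid_scheme \<Rightarrow> (('a + 'b) list \<times> ('a + 'b) list) set" where
  "free_product_rels G H =
     {([Inl a, Inl b], [Inl (a \<otimes>\<^bsub>G\<^esub> b)]) | a b. a \<in> carrier G \<and> b \<in> carrier G} \<union>
     {([Inr a, Inr b], [Inr (a \<otimes>\<^bsub>H\<^esub> b)]) | a b. a \<in> carrier H \<and> b \<in> carrier H} \<union>
     {([Inl \<one>\<^bsub>G\<^esub>], []), ([Inr \<one>\<^bsub>H\<^esub>], [])}"

definition free_product ::
    "('a, 'm) monoid_scheme \<Rightarrow> ('b, 'n) monoid_scheme \<Rightarrow> ('a + 'b) list set monoid" where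
  "free_product G H = presented_monoid (carrier G <+> carrier H) (free_product_rels G H)"

definition free_product_lift ::
    "('c, 'k) monoid_scheme \<Rightarrow> ('a \<Rightarrow> 'c) \<Rightarrow> ('b \<Rightarrow> 'c) \<Rightarrow> ('a + 'b) list set \<Rightarrow> 'c" where
  "free_product_lift K f h = word_lift K (case_sum f h)"


section \<open>Acyclically closed groups and the acyclic closure\<close>

definition H1 :: "('a, 'm) monoid_scheme \<Rightarrow> 'a set monoid" where
  "H1 G = G Mod derived G (carrier G)"

definition to_H1 :: "('a, 'm) monoid_scheme \<Rightarrow> 'a \<Rightarrow> 'a set" where
  "to_H1 G g = derived G (carrier G) #>\<^bsub>G\<^esub> g"

abbreviation adjoin_free ::
    "('a, 'm) monoid_scheme \<Rightarrow> nat \<Rightarrow> ('a + (nat \<times> bool) list set) list set monoid" where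
  "adjoin_free G m \<equiv> free_product G (free_group {..<m})"

definition acyclic_elements ::
    "('a, 'm) monoid_scheme \<Rightarrow> nat \<Rightarrow> ('a + (nat \<times> bool) list set) list set set" where
  "acyclic_elements G m = kernel (adjoin_free G m) (H1 (free_group {..<m}))
     (to_H1 (free_group {..<m}) \<circ>
      free_product_lift (free_group {..<m}) (\<lambda>_. \<one>\<^bsub>free_group {..<m}\<^esub>) (\<lambda>u. u))"

text \<open>Substitution of \<open>y i\<close> for the \<open>i\<close>-th variable.\<close>

definition substitute ::
    "('a, 'm) monoid_scheme \<Rightarrow> (nat \<Rightarrow> 'a) \<Rightarrow> ('a + (nat \<times> bool) list set) list set \<Rightarrow> 'a" where
  "substitute G y = free_product_lift G (\<lambda>g. g) (free_group_lift G y)"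

definition acyclically_closed :: "('a, 'm) monoid_scheme \<Rightarrow> bool" where
  "acyclically_closed G \<longleftrightarrow> group G \<and>
     (\<forall>m. \<forall>w \<in> {..<m} \<rightarrow> acyclic_elements G m.
        \<exists>!y. y \<in> {..<m} \<rightarrow>\<^sub>E carrier G \<and> (\<forall>i<m. y i = substitute G y (w i)))"

text \<open>HOL cannot quantify over the type of the test group \<open>B\<close>; here \<open>B\<close> ranges over the groups with
  carrier in \<open>'g + 'a + nat\<close>. This loses nothing. The acyclic closure of a group \<open>G\<close> has at most
  \<open>card G + \<aleph>\<^sub>0\<close> elements, so this type contains copies of it and of \<open>A\<close>; the usual
  uniqueness argument for universal objects then shows that a pair with the property below is
  isomorphic to the acyclic closure, and so has the universal property for test groups of every
  type.\<close>

definition acyclic_closure :: "'g monoid \<Rightarrow> 'a monoid \<Rightarrow> ('g \<Rightarrow> 'a) \<Rightarrow> bool" where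
  "acyclic_closure G A \<iota> \<longleftrightarrow> acyclically_closed A \<and> \<iota> \<in> hom G A \<and>
     (\<forall>B :: ('g + 'a + nat) monoid. acyclically_closed B \<longrightarrow>
        (\<forall>f \<in> hom G B. \<exists>!f'. f' \<in> hom A B \<and> f' \<in> extensional (carrier A) \<and>
           (\<forall>g \<in> carrier G. f' (\<iota> g) = f g)))"


section \<open>Lower central series and nilpotent quotients\<close>

definition commutator_subgroup :: "('a, 'm) monoid_scheme \<Rightarrow> 'a set \<Rightarrow> 'a set \<Rightarrow> 'a set" where
  "commutator_subgroup G H K =
     generate G (\<Union>h\<in>H. \<Union>k\<in>K. {h \<otimes>\<^bsub>G\<^esub> k \<otimes>\<^bsub>G\<^esub> inv\<^bsub>G\<^esub> h \<otimes>\<^bsub>G\<^esub> inv\<^bsub>G\<^esub> k})"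

text \<open>The series starts at index 1; the value at 0 is a dummy.\<close>

fun lower_central :: "('a, 'm) monoid_scheme \<Rightarrow> nat \<Rightarrow> 'a set" where
  "lower_central G 0 = carrier G"
| "lower_central G (Suc 0) = carrier G"
| "lower_central G (Suc (Suc i)) =
     commutator_subgroup G (lower_central G (Suc i)) (carrier G)"

definition nil_quot :: "('a, 'm) monoid_scheme \<Rightarrow> nat \<Rightarrow> 'a set monoid" where
  "nil_quot G k = G Mod lower_central G k"

text \<open>For \<open>l \<ge> k\<close>, the quotient of the \<open>k\<close>-th by the \<open>l\<close>-th term of the lower central series.\<close>

definition central_section :: "('a, 'm) monoid_scheme \<Rightarrow> nat \<Rightarrow> nat \<Rightarrow> 'a set monoid" where
  "central_section G k l = (G\<lparr>carrier := lower_central G k\<rparr>) Mod lower_central G l"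

text \<open>The map between quotients induced by \<open>f\<close>, where \<open>N\<close> is the subgroup factored out of the target
  \<open>H\<close>; the cosets in the union all coincide if \<open>f\<close> is compatible with the quotients.\<close>

definition coset_map ::
    "('b, 'n) monoid_scheme \<Rightarrow> 'b set \<Rightarrow> ('a \<Rightarrow> 'b) \<Rightarrow> 'a set \<Rightarrow> 'b set" where
  "coset_map H N f C = (\<Union>g\<in>C. N #>\<^bsub>H\<^esub> f g)"


section \<open>The Johnson homomorphisms\<close>

definition hom_group ::
    "('a, 'm) monoid_scheme \<Rightarrow> ('b, 'n) monoid_scheme \<Rightarrow> ('a \<Rightarrow> 'b) monoid" where
  "hom_group G M =
    \<lparr>carrier = hom G M \<inter> extensional (carrier G),
     monoid.mult = (\<lambda>f g. \<lambda>x\<in>carrier G. f x \<otimes>\<^bsub>M\<^esub> g x),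
     one = (\<lambda>x\<in>carrier G. \<one>\<^bsub>M\<^esub>)\<rparr>"

text \<open>The action of \<open>\<phi>\<close> on \<open>nil_quot A k\<close>, transported to \<open>nil_quot F k\<close> along the isomorphism
  induced by \<open>\<iota>\<close>.\<close>

definition nil_action ::
    "('f, 'm) monoid_scheme \<Rightarrow> ('a, 'n) monoid_scheme \<Rightarrow> ('f \<Rightarrow> 'a) \<Rightarrow> nat
      \<Rightarrow> ('a \<Rightarrow> 'a) \<Rightarrow> 'f set \<Rightarrow> 'f set" where
  "nil_action F A \<iota> k \<phi> =
     (let \<theta> = coset_map A (lower_central A k) \<iota>
      in (\<lambda>C\<in>carrier (nil_quot F k).
           the_inv_into (carrier (nil_quot F k)) \<theta> (coset_map A (lower_central A k) \<phi> (\<theta> C))))"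

definition aut_filtration ::
    "('f, 'm) monoid_scheme \<Rightarrow> 'a monoid \<Rightarrow> ('f \<Rightarrow> 'a) \<Rightarrow> nat \<Rightarrow> ('a \<Rightarrow> 'a) set" where
  "aut_filtration F A \<iota> k =
     kernel (AutoGroup A) (AutoGroup (nil_quot F k)) (nil_action F A \<iota> k)"

definition aut_filtration_group ::
    "('f, 'm) monoid_scheme \<Rightarrow> 'a monoid \<Rightarrow> ('f \<Rightarrow> 'a) \<Rightarrow> nat \<Rightarrow> ('a \<Rightarrow> 'a) monoid" where
  "aut_filtration_group F A \<iota> k = (AutoGroup A)\<lparr>carrier := aut_filtration F A \<iota> k\<rparr>"

definition is_lift :: "('f, 'm) monoid_scheme \<Rightarrow> nat \<Rightarrow> ('f set \<Rightarrow> 'f set) \<Rightarrow> ('f \<Rightarrow> 'f) \<Rightarrow> bool" where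
  "is_lift F k f \<psi> \<longleftrightarrow> \<psi> \<in> hom F F \<and>
     (\<forall>g \<in> carrier F. lower_central F k #>\<^bsub>F\<^esub> \<psi> g = f (lower_central F k #>\<^bsub>F\<^esub> g))"

text \<open>The isomorphism from the kernel of \<open>Aut N\<^bsub>k+1\<^esub> \<rightarrow> Aut N\<^bsub>k\<^esub>\<close> to
  \<open>Hom (H\<^sub>1 F, \<Gamma>\<^bsup>k\<^esup> F / \<Gamma>\<^bsup>k+1\<^esup> F)\<close>, with respect to a basis \<open>x\<close>
  of \<open>F\<close> indexed by \<open>S\<close>.\<close>

definition kernel_iso ::
    "('f, 'm) monoid_scheme \<Rightarrow> 's set \<Rightarrow> ('s \<Rightarrow> 'f) \<Rightarrow> nat \<Rightarrow> ('f set \<Rightarrow> 'f set) \<Rightarrow> 'f set \<Rightarrow> 'f set" where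
  "kernel_iso F S x k f =
     (THE h. h \<in> carrier (hom_group (H1 F) (central_section F k (k + 1))) \<and>
        (\<forall>\<psi>. is_lift F (k + 1) f \<psi> \<longrightarrow>
           (\<forall>i \<in> S. h (to_H1 F (x i)) =
              lower_central F (k + 1) #>\<^bsub>F\<^esub> (\<psi> (x i) \<otimes>\<^bsub>F\<^esub> inv\<^bsub>F\<^esub> x i))))"

definition johnson ::
    "('f, 'm) monoid_scheme \<Rightarrow> 's set \<Rightarrow> ('s \<Rightarrow> 'f) \<Rightarrow> ('a, 'n) monoid_scheme \<Rightarrow> ('f \<Rightarrow> 'a) \<Rightarrow> nat
      \<Rightarrow> ('a \<Rightarrow> 'a) \<Rightarrow> 'f set \<Rightarrow> 'f set" where
  "johnson F S x A \<iota> k \<phi> = kernel_iso F S x k (nil_action F A \<iota> (k + 1) \<phi>)"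

definition central_projection ::
    "('f, 'm) monoid_scheme \<Rightarrow> nat \<Rightarrow> 'f set \<Rightarrow> 'f set" where
  "central_projection F l = coset_map F (lower_central F l) (\<lambda>g. g)"

definition fg_free_abelian :: "('a, 'm) monoid_scheme \<Rightarrow> bool" where
  "fg_free_abelian M \<longleftrightarrow> group M \<and> (\<exists>r::nat. free_Abelian_group {..<r} \<cong> M)"

end

theory Submission
  imports Defs "HOL-Library.List_Lexorder"
begin

text \<open>A nilpotent group is acyclically closed, because substitution into an acyclic system contracts the
  lower central filtration. Hence the universal property of the acyclic closure \<open>A\<close> of \<open>F\<close>, tested on
  nilpotent quotients, identifies the nilpotent quotients of \<open>F\<close> and \<open>A\<close>.

  An automorphism \<open>\<phi>\<close> that is trivial modulo \<open>\<Gamma>\<^sup>k\<close> moves the elements of \<open>\<Gamma>\<^sup>k\<close> only within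
  \<open>\<Gamma>\<^bsup>2k-1\<^esup>\<close>; since \<open>\<Gamma>\<^sup>k/\<Gamma>\<^bsup>2k-1\<^esup>\<close> is abelian, the map sending \<open>\<phi>\<close> to the classes of
  \<open>\<phi>(x\<^sub>i) x\<^sub>i\<^sup>-\<^sup>1\<close> modulo \<open>\<Gamma>\<^bsup>2k-1\<^esup>\<close> is a homomorphism. It is surjective because any
  assignment \<open>x\<^sub>i \<mapsto> u\<^sub>i x\<^sub>i\<close> with \<open>u\<^sub>i \<in> \<Gamma>\<^sup>2\<close> extends to an automorphism of \<open>A\<close>, whose inverse is
  obtained by solving an acyclic system.

  The quotient \<open>\<Gamma>\<^sup>k/\<Gamma>\<^bsup>2k-1\<^esup>\<close> is free abelian on the commutators shaped like Lyndon trees: they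
  generate by repeated use of the Jacobi identity, and they are independent because the least word in
  the leading term of the Magnus expansion of such a commutator is the Lyndon word of its tree.\<close>

text \<open>Two bounds compete for the exponent. The target is abelian up to \<Gamma>^(2k), but
  additivity also needs \<phi>(v) to agree with v for every displacement v in \<Gamma>^k, and an
  automorphism trivial modulo \<Gamma>^k guarantees this only modulo \<Gamma>^(k+k-1). The
  construction is therefore carried out at every level l with k < l < 2k, and the theorem is the
  extreme case l = 2k - 1. An automorphism of A need not preserve the image of F, so
  \<open>\<phi> (\<iota> (x i))\<close> has no displacement in F itself; it can only be matched with
  an element of F modulo \<Gamma>^l, and this is what the comparison of nilpotent quotients
  provides. Two constraints shape the technical side. The universal property of A speaks about test
  groups on one fixed type, so quotients, whose elements are sets, are copied there through coset
  representatives. The lexicographic order on words is not well-founded, so the rewriting with the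
  Jacobi identity is run inside a finite set of words of bounded length.\<close>

definition commutator :: "('a, 'm) monoid_scheme \<Rightarrow> 'a \<Rightarrow> 'a \<Rightarrow> 'a" where
  "commutator G x y = x \<otimes>\<^bsub>G\<^esub> y \<otimes>\<^bsub>G\<^esub> inv\<^bsub>G\<^esub> x \<otimes>\<^bsub>G\<^esub> inv\<^bsub>G\<^esub> y"

section \<open>Commutator identities in an arbitrary group\<close>

context group
begin

lemma inv_cancel_left [simp]:
  assumes "x \<in> carrier G" "y \<in> carrier G"
  shows "inv x \<otimes> (x \<otimes> y) = y" "x \<otimes> (inv x \<otimes> y) = y"
  using assms by (simp_all flip: m_assoc)

lemma commutator_closed [simp]:
  "x \<in> carrier G \<Longrightarrow> y \<in> carrier G \<Longrightarrow> commutator G x y \<in> carrier G"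
  by (simp add: commutator_def)

lemma inv_commutator:
  assumes "x \<in> carrier G" "y \<in> carrier G"
  shows "inv (commutator G x y) = commutator G y x"
  using assms by (simp add: commutator_def m_assoc inv_mult_group)

lemma commutator_eq_one_iff:
  assumes "x \<in> carrier G" "y \<in> carrier G"
  shows "commutator G x y = \<one> \<longleftrightarrow> x \<otimes> y = y \<otimes> x"
proof -
  have "commutator G x y = (x \<otimes> y) \<otimes> inv (y \<otimes> x)"
    using assms by (simp add: commutator_def m_assoc inv_mult_group)
  then show ?thesis
    using assms by (metis inv_closed inv_equality inv_inv m_closed r_inv)
qed

text \<open>The central factor \<open>a\<close> cancels against its inverse, and \<open>b\<close>
  passes \<open>inv x\<close> to meet \<open>inv b\<close>. With \<open>a\<close> to the left of
  \<open>x\<close> and \<open>b\<close> to the right of \<open>y\<close>, it is enough that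
  \<open>b\<close> commutes with \<open>x\<close>.\<close>

lemma commutator_perturb:
  assumes x: "x \<in> carrier G" and y: "y \<in> carrier G" and a: "a \<in> carrier G" and b: "b \<in> carrier G"
    and ax: "\<And>w. w \<in> carrier G \<Longrightarrow> a \<otimes> w = w \<otimes> a" and bx: "b \<otimes> x = x \<otimes> b"
  shows "commutator G (a \<otimes> x) (y \<otimes> b) = commutator G x y"
proof -
  have "commutator G (a \<otimes> x) (y \<otimes> b) = a \<otimes> (x \<otimes> y \<otimes> (b \<otimes> inv x) \<otimes> inv a \<otimes> inv b \<otimes> inv y)"
    using assms(1-4) by (simp add: commutator_def m_assoc inv_mult_group)
  also have "b \<otimes> inv x = inv x \<otimes> b"
    using bx x b by (metis inv_closed inv_solve_left' inv_solve_right m_assoc m_closed)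
  also have "a \<otimes> (x \<otimes> y \<otimes> (inv x \<otimes> b) \<otimes> inv a \<otimes> inv b \<otimes> inv y)
      = a \<otimes> (x \<otimes> y \<otimes> (inv x \<otimes> b)) \<otimes> inv a \<otimes> inv b \<otimes> inv y"
    using assms(1-4) by (simp add: m_assoc)
  also have "a \<otimes> (x \<otimes> y \<otimes> (inv x \<otimes> b)) = (x \<otimes> y \<otimes> (inv x \<otimes> b)) \<otimes> a"
    by (rule ax) (use assms(1-4) in simp)
  finally show ?thesis
    using assms(1-4) by (simp add: commutator_def m_assoc)
qed

text \<open>Conjugation by \<open>z\<close> maps \<open>x\<close> to \<open>[z, x] x\<close>; expanding the conjugate of \<open>[x, y]\<close> with
  this gives the Jacobi identity in derivation form.\<close>

lemma commutator_jacobi: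
  fixes x y z
  defines "a \<equiv> commutator G z x" and "b \<equiv> commutator G z y" and "c \<equiv> commutator G x y"
  assumes x: "x \<in> carrier G" and y: "y \<in> carrier G" and z: "z \<in> carrier G"
    and ab: "a \<otimes> b = b \<otimes> a" and ac: "a \<otimes> c = c \<otimes> a" and bc: "b \<otimes> c = c \<otimes> b"
    and D: "\<And>w. w \<in> carrier G \<Longrightarrow> commutator G x b \<otimes> w = w \<otimes> commutator G x b"
    and E: "\<And>w. w \<in> carrier G \<Longrightarrow> commutator G a y \<otimes> w = w \<otimes> commutator G a y"
  shows "commutator G z (commutator G x y) = commutator G x b \<otimes> commutator G a y"
proof -
  have [simp]: "a \<in> carrier G" "b \<in> carrier G" "c \<in> carrier G"
    using x y z by (simp_all add: a_def b_def c_def)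
  note [simp] = x y z
  define d where "d = commutator G x b"
  define e where "e = commutator G a y"
  have [simp]: "d \<in> carrier G" "e \<in> carrier G"
    by (simp_all add: d_def e_def)
  have "z \<otimes> c \<otimes> inv z = (a \<otimes> x) \<otimes> (b \<otimes> y) \<otimes> inv (a \<otimes> x) \<otimes> inv (b \<otimes> y)"
    by (simp add: a_def b_def c_def commutator_def m_assoc inv_mult_group)
  also have "\<dots> = a \<otimes> (x \<otimes> b) \<otimes> y \<otimes> inv x \<otimes> inv a \<otimes> inv y \<otimes> inv b"
    by (simp add: m_assoc inv_mult_group)
  also have "x \<otimes> b = d \<otimes> (b \<otimes> x)"
    by (simp add: d_def commutator_def m_assoc)
  also have "a \<otimes> (d \<otimes> (b \<otimes> x)) = d \<otimes> (a \<otimes> (b \<otimes> x))"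
    using D[of a] by (simp add: d_def flip: m_assoc)
  also have "d \<otimes> (a \<otimes> (b \<otimes> x)) \<otimes> y \<otimes> inv x \<otimes> inv a \<otimes> inv y \<otimes> inv b
      = d \<otimes> (a \<otimes> (b \<otimes> (x \<otimes> y \<otimes> inv x))) \<otimes> (inv a \<otimes> inv y) \<otimes> inv b"
    by (simp add: m_assoc)
  also have "x \<otimes> y \<otimes> inv x = c \<otimes> y"
    by (simp add: c_def commutator_def m_assoc)
  also have "inv a \<otimes> inv y = inv y \<otimes> inv a \<otimes> e"
    by (simp add: e_def commutator_def m_assoc)
  also have "d \<otimes> (a \<otimes> (b \<otimes> (c \<otimes> y))) \<otimes> (inv y \<otimes> inv a \<otimes> e) \<otimes> inv b
     = d \<otimes> (a \<otimes> b \<otimes> c) \<otimes> inv a \<otimes> (e \<otimes> inv b)"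
    by (simp add: m_assoc)
  also have "e \<otimes> inv b = inv b \<otimes> e"
    using E[of "inv b"] by (simp add: e_def)
  also have "a \<otimes> b \<otimes> c = c \<otimes> b \<otimes> a"
    using ab ac bc by (metis \<open>a \<in> carrier G\<close> \<open>b \<in> carrier G\<close> \<open>c \<in> carrier G\<close> m_assoc)
  also have "d \<otimes> (c \<otimes> b \<otimes> a) \<otimes> inv a \<otimes> (inv b \<otimes> e) = d \<otimes> (c \<otimes> e)"
    by (simp add: m_assoc)
  also have "c \<otimes> e = e \<otimes> c"
    using E[of c] by (simp add: e_def)
  finally have "z \<otimes> c \<otimes> inv z = d \<otimes> (e \<otimes> c)" .
  then have "commutator G z c = d \<otimes> (e \<otimes> c) \<otimes> inv c"
    by (simp add: commutator_def)
  then show ?thesis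
    by (simp add: c_def d_def e_def m_assoc)
qed

end

section \<open>Cosets and commutation modulo a normal subgroup\<close>

lemma (in group_hom) hom_commutator:
  assumes "x \<in> carrier G" "y \<in> carrier G"
  shows "h (commutator G x y) = commutator H (h x) (h y)"
  using assms by (simp add: commutator_def)

lemma (in group) normal_group_hom_Mod:
  assumes "N \<lhd> G"
  shows "group_hom G (G Mod N) (\<lambda>a. N #> a)"
  using assms by (simp add: group_hom_def group_hom_axioms_def normal.r_coset_hom_Mod
    normal.factorgroup_is_group group_axioms)

lemma (in group) rcos_eq_iff:
  assumes "N \<lhd> G" "a \<in> carrier G" "b \<in> carrier G"
  shows "N #> a = N #> b \<longleftrightarrow> a \<otimes> inv b \<in> N"
proof -
  have N: "subgroup N G" using assms(1) by (rule normal_imp_subgroup)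
  then show ?thesis
    using assms(2,3) subgroup.rcos_module[OF N is_group, of b a] repr_independence[OF _ _ N, of a b] rcos_self[OF assms(2) N]
    by auto
qed

lemma (in group) rcos_eq_iff_left:
  assumes "N \<lhd> G" "a \<in> carrier G" "b \<in> carrier G"
  shows "N #> a = N #> b \<longleftrightarrow> inv a \<otimes> b \<in> N"
  using assms by (metis inv_closed inv_mult_group inv_inv m_closed normal.inv_op_closed1 normal.inv_op_closed2
      normal_imp_subgroup rcos_eq_iff subgroup.m_inv_closed inv_cancel_left m_assoc r_inv r_one)

lemma (in group) rcos_eq_self_iff:
  assumes "N \<lhd> G" "a \<in> carrier G"
  shows "N #> a = N \<longleftrightarrow> a \<in> N"
  using rcos_eq_iff[OF assms(1,2) one_closed] assms
  by (simp add: coset_mult_one normal_imp_subgroup subgroup.subset)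

text \<open>Bridge between two languages: weight estimates yield membership of commutators in
  \<open>N\<close>, while the commutator identities are applied to commuting elements of
  \<open>G Mod N\<close>.\<close>

lemma (in group) commutes_mod_iff:
  assumes N: "N \<lhd> G" and a: "a \<in> carrier G" "b \<in> carrier G"
  shows "(N #> a) \<otimes>\<^bsub>G Mod N\<^esub> (N #> b) = (N #> b) \<otimes>\<^bsub>G Mod N\<^esub> (N #> a) \<longleftrightarrow> commutator G a b \<in> N"
proof -
  interpret p: group_hom G "G Mod N" "\<lambda>a. N #> a"
    by (rule normal_group_hom_Mod[OF N])
  have "N #> commutator G a b = \<one>\<^bsub>G Mod N\<^esub> \<longleftrightarrow> commutator G a b \<in> N"
    using a by (simp only: one_FactGroup) (rule rcos_eq_self_iff[OF N], simp)
  then show ?thesis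
    using a p.hom_commutator[OF a] p.H.commutator_eq_one_iff[OF p.hom_closed[OF a(1)] p.hom_closed[OF a(2)]] by simp
qed

lemma (in group) rcos_mult_cong:
  assumes "N \<lhd> G" "a \<in> carrier G" "b \<in> carrier G" "a' \<in> carrier G" "b' \<in> carrier G"
    and "N #> a = N #> a'" "N #> b = N #> b'"
  shows "N #> (a \<otimes> b) = N #> (a' \<otimes> b')"
  using assms by (metis normal.rcos_sum)

lemma (in group) normal_conj:
  assumes "N \<lhd> G" "x \<in> N" "g \<in> carrier G"
  shows "g \<otimes> x \<otimes> inv g \<in> N" "inv g \<otimes> x \<otimes> g \<in> N"
  using assms normal_inv_iff[of N] by (auto dest: bspec[of _ _ "inv g"])

subsection \<open>The lower central series\<close>

declare lower_central.simps(3) [simp del]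

text \<open>Positivity of \<open>i\<close> matters: the terms 0 and 1 are both the whole group, so
  the recursion starts only at index 1.\<close>

lemma lower_central_Suc:
  assumes "0 < i"
  shows "lower_central G (Suc i) =
    generate G (\<Union>a\<in>lower_central G i. \<Union>b\<in>carrier G. {commutator G a b})"
  using assms by (cases i) (simp_all add: lower_central.simps(3) commutator_subgroup_def commutator_def)

context group
begin

lemma lower_central_normal: "lower_central G i \<lhd> G"
proof (induction i)
  case 0
  then show ?case by (simp add: normal_self)
next
  case (Suc i)
  show ?case
  proof (cases "i = 0")
    case True
    then show ?thesis by (simp add: normal_self)
  next
    case False
    let ?N = "lower_central G i"
    have sub: "?N \<subseteq> carrier G"
      using Suc normal_imp_subgroup subgroup.subset by blast
    have "generate G (\<Union>a\<in>?N. \<Union>b\<in>carrier G. {commutator G a b}) \<lhd> G"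
    proof (rule normal_generateI)
      show "(\<Union>a\<in>?N. \<Union>b\<in>carrier G. {commutator G a b}) \<subseteq> carrier G"
        using sub by auto
    next
      fix h g assume "h \<in> (\<Union>a\<in>?N. \<Union>b\<in>carrier G. {commutator G a b})" and g: "g \<in> carrier G"
      then obtain a b where ab: "a \<in> ?N" "b \<in> carrier G" "h = commutator G a b" by blast
      then have a: "a \<in> carrier G" using sub by blast
      have "g \<otimes> h \<otimes> inv g = commutator G (g \<otimes> a \<otimes> inv g) (g \<otimes> b \<otimes> inv g)"
        using a ab g by (simp add: commutator_def m_assoc inv_mult_group)
      moreover have "g \<otimes> a \<otimes> inv g \<in> ?N"
        using normal_conj[OF Suc ab(1) g] by simp
      ultimately show "g \<otimes> h \<otimes> inv g \<in> (\<Union>a\<in>?N. \<Union>b\<in>carrier G. {commutator G a b})"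
        using ab g by blast
    qed
    with False show ?thesis by (simp add: lower_central_Suc)
  qed
qed

lemma lower_central_subgroup: "subgroup (lower_central G i) G"
  using lower_central_normal normal_imp_subgroup by blast

lemma lower_central_closed: "a \<in> lower_central G i \<Longrightarrow> a \<in> carrier G"
  using lower_central_subgroup subgroup.mem_carrier by metis

lemma commutator_in_Suc:
  assumes "0 < i" "a \<in> lower_central G i" "b \<in> carrier G"
  shows "commutator G a b \<in> lower_central G (Suc i)"
  using assms by (auto simp: lower_central_Suc intro!: generate.incl)

lemma commutator_in_normal:
  assumes "N \<lhd> G" "a \<in> N" "b \<in> carrier G"
  shows "commutator G a b \<in> N"
proof -
  have a: "a \<in> carrier G" and N: "subgroup N G"
    using assms normal_imp_subgroup subgroup.mem_carrier by metis+
  have "commutator G a b = a \<otimes> (b \<otimes> inv a \<otimes> inv b)"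
    using a assms by (simp add: commutator_def m_assoc)
  then show ?thesis
    using normal_conj(1)[OF assms(1) subgroup.m_inv_closed[OF N assms(2)] assms(3)]
      subgroup.m_closed[OF N assms(2)] by simp
qed

lemma lower_central_Suc_subset: "lower_central G (Suc i) \<subseteq> lower_central G i"
proof (cases "i = 0")
  case False
  have "(\<Union>a\<in>lower_central G i. \<Union>b\<in>carrier G. {commutator G a b}) \<subseteq> lower_central G i"
    using commutator_in_normal[OF lower_central_normal] by blast
  then show ?thesis
    using False by (simp add: lower_central_Suc generate_subgroup_incl lower_central_subgroup)
qed simp

lemma lower_central_antimono: "i \<le> j \<Longrightarrow> lower_central G j \<subseteq> lower_central G i"
  using lift_Suc_antimono_le[of "lower_central G"] lower_central_Suc_subset by blast

lemma lower_central_2: "lower_central G 2 = derived G (carrier G)"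
  by (simp add: numeral_2_eq_2 lower_central.simps(3) commutator_subgroup_def derived_def)

end

lemma (in group_hom) lower_central_hom:
  assumes "a \<in> lower_central G i" shows "h a \<in> lower_central H i"
  using assms
proof (induction i arbitrary: a)
  case 0
  then show ?case by simp
next
  case (Suc i)
  show ?case
  proof (cases "i = 0")
    case True
    then show ?thesis using Suc by simp
  next
    case False
    let ?S = "\<Union>a\<in>lower_central G i. \<Union>b\<in>carrier G. {commutator G a b}"
    have S: "?S \<subseteq> carrier G"
      using G.lower_central_closed by auto
    have "h ` ?S \<subseteq> lower_central H (Suc i)"
    proof clarify
      fix x y assume xy: "x \<in> lower_central G i" "y \<in> carrier G"
      then show "h (commutator G x y) \<in> lower_central H (Suc i)"
        using Suc.IH[OF xy(1)] False H.commutator_in_Suc[of i "h x" "h y"]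
        by (simp add: hom_commutator G.lower_central_closed)
    qed
    then have "generate H (h ` ?S) \<subseteq> lower_central H (Suc i)"
      by (simp add: H.generate_subgroup_incl H.lower_central_subgroup)
    then have "h ` generate G ?S \<subseteq> lower_central H (Suc i)"
      by (simp add: generate_img[OF S])
    moreover have "a \<in> generate G ?S"
      using Suc.prems False lower_central_Suc[of i G] by simp
    ultimately show ?thesis by blast
  qed
qed

lemma (in group_hom) lower_central_surj:
  assumes surj: "h ` carrier G = carrier H"
  shows "lower_central H i = h ` lower_central G i"
proof (induction i)
  case 0
  then show ?case using surj by simp
next
  case (Suc i)
  show ?case
  proof (cases "i = 0")
    case True
    then show ?thesis using surj by simp
  next
    case False
    let ?S = "\<Union>a\<in>lower_central G i. \<Union>b\<in>carrier G. {commutator G a b}"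
    have S: "?S \<subseteq> carrier G"
      using G.lower_central_closed by auto
    have "h ` ?S = (\<Union>a\<in>lower_central G i. \<Union>b\<in>carrier G. {commutator H (h a) (h b)})"
      by (auto simp: image_UN hom_commutator G.lower_central_closed)
    also have "\<dots> = (\<Union>a\<in>lower_central H i. \<Union>b\<in>carrier H. {commutator H a b})"
      unfolding Suc surj[symmetric] by blast
    finally show ?thesis
      using False generate_img[OF S] by (simp add: lower_central_Suc)
  qed
qed

section \<open>The shift of the lower central series and the weight of commutators\<close>

context group
begin

lemma conj_hom:
  assumes "z \<in> carrier G"
  shows "(\<lambda>a. z \<otimes> a \<otimes> inv z) \<in> hom G G"
  using assms by (auto simp: hom_def m_assoc)

text \<open>An endomorphism that is trivial modulo \<open>\<Gamma>\<^bsup>l+1\<^esup>\<close> shifts the lower central series by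
  \<open>l\<close>. The induction uses the statement for conjugations to see that \<open>\<Gamma>\<^bsup>l+1\<^esup>\<close> and
  \<open>\<Gamma>\<^bsup>i+1\<^esup>\<close> commute modulo \<open>\<Gamma>\<^bsup>i+l+2\<^esup>\<close>.\<close>

lemma endo_shifts_lower_central_Suc:
  assumes "\<phi> \<in> hom G G" "\<And>a. a \<in> carrier G \<Longrightarrow> \<phi> a \<otimes> inv a \<in> lower_central G (Suc l)"
    and "a \<in> lower_central G (Suc i)"
  shows "\<phi> a \<otimes> inv a \<in> lower_central G (Suc (i + l))"
  using assms
proof (induction i arbitrary: a \<phi> l)
  case 0
  then show ?case by simp
next
  case (Suc i)
  interpret f: group_hom G G \<phi>
    using Suc.prems(1) by unfold_locales
  define N where "N = lower_central G (Suc (Suc i + l))"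
  have N: "N \<lhd> G" unfolding N_def by (rule lower_central_normal)
  interpret p: group_hom G "G Mod N" "\<lambda>a. N #> a"
    by (rule normal_group_hom_Mod[OF N])
  let ?S = "\<Union>a\<in>lower_central G (Suc i). \<Union>b\<in>carrier G. {commutator G a b}"
  have S: "?S \<subseteq> carrier G"
    using lower_central_closed by auto
  have eqS: "N #> \<phi> s = N #> s" if "s \<in> ?S" for s
  proof -
    from that obtain x y where x: "x \<in> lower_central G (Suc i)" and y [simp]: "y \<in> carrier G"
      and s: "s = commutator G x y" by blast
    have xc [simp]: "x \<in> carrier G" using x lower_central_closed by blast
    \<comment> \<open>Displacements are taken on the left for \<open>x\<close> and on the right for
      \<open>y\<close>, as \<open>commutator_perturb\<close> asks: \<alpha> is central modulo
      \<open>N\<close>, and \<beta> only has to commute with \<open>x\<close>.\<close>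
    define \<alpha> where "\<alpha> = \<phi> x \<otimes> inv x"
    define \<beta> where "\<beta> = inv y \<otimes> \<phi> y"
    have [simp]: "\<alpha> \<in> carrier G" "\<beta> \<in> carrier G" by (simp_all add: \<alpha>_def \<beta>_def)
    have \<alpha>: "\<alpha> \<in> lower_central G (Suc (i + l))"
      unfolding \<alpha>_def by (rule Suc.IH[OF Suc.prems(1,2) x])
    have "\<beta> = inv y \<otimes> (\<phi> y \<otimes> inv y) \<otimes> y"
      by (simp add: \<beta>_def m_assoc)
    then have \<beta>: "\<beta> \<in> lower_central G (Suc l)"
      using normal_conj(2)[OF lower_central_normal Suc.prems(2)[OF y] y] by simp
    have \<alpha>c: "commutator G \<alpha> w \<in> N" if "w \<in> carrier G" for w
      using commutator_in_Suc[OF _ \<alpha> that] by (simp add: N_def)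
    \<comment> \<open>The induction hypothesis is used for conjugation by \<beta> and with
      \<open>Suc l\<close> in place of \<open>l\<close>: since \<beta> lies in \<Gamma>^(l+1), this
      conjugation is trivial modulo \<Gamma>^(l+2). Hence \<phi> and \<open>l\<close> are arbitrary
      in the induction.\<close>
    have "\<beta> \<otimes> x \<otimes> inv \<beta> \<otimes> inv x \<in> lower_central G (Suc (i + Suc l))"
    proof (rule Suc.IH[OF conj_hom _ x])
      fix a assume "a \<in> carrier G"
      then show "\<beta> \<otimes> a \<otimes> inv \<beta> \<otimes> inv a \<in> lower_central G (Suc (Suc l))"
        using commutator_in_Suc[OF _ \<beta>, of a] by (simp add: commutator_def)
    qed simp
    then have \<beta>x: "commutator G \<beta> x \<in> N" by (simp add: N_def commutator_def)
    have "commutator (G Mod N) ((N #> \<alpha>) \<otimes>\<^bsub>G Mod N\<^esub> (N #> x)) ((N #> y) \<otimes>\<^bsub>G Mod N\<^esub> (N #> \<beta>))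
        = commutator (G Mod N) (N #> x) (N #> y)"
    proof (rule p.H.commutator_perturb)
      fix w assume "w \<in> carrier (G Mod N)"
      then obtain w' where w': "w' \<in> carrier G" "w = N #> w'"
        by (auto simp: carrier_FactGroup)
      then show "(N #> \<alpha>) \<otimes>\<^bsub>G Mod N\<^esub> w = w \<otimes>\<^bsub>G Mod N\<^esub> (N #> \<alpha>)"
        using \<alpha>c[OF w'(1)] commutes_mod_iff[OF N, of \<alpha> w'] by simp
    next
      show "(N #> \<beta>) \<otimes>\<^bsub>G Mod N\<^esub> (N #> x) = (N #> x) \<otimes>\<^bsub>G Mod N\<^esub> (N #> \<beta>)"
        using \<beta>x commutes_mod_iff[OF N, of \<beta> x] by simp
    qed (rule p.hom_closed; simp)+
    moreover have "\<phi> x = \<alpha> \<otimes> x" "\<phi> y = y \<otimes> \<beta>"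
      by (simp_all add: \<alpha>_def \<beta>_def m_assoc)
    ultimately show ?thesis
      by (simp only: s f.hom_commutator[OF xc y] p.hom_commutator f.hom_closed xc y p.hom_mult
        \<open>\<alpha> \<in> carrier G\<close> \<open>\<beta> \<in> carrier G\<close> m_closed)
  qed
  have "N #> \<phi> g = N #> g" if "g \<in> generate G ?S" for g
    using that
  proof (induction rule: generate.induct)
    case one
    then show ?case by simp
  next
    case (incl h)
    then show ?case by (rule eqS)
  next
    case (inv h)
    then have h: "h \<in> carrier G" using S by blast
    then show ?case using eqS[OF inv] by (simp only: f.hom_inv p.hom_inv f.hom_closed)
  next
    case (eng h1 h2)
    then have "h1 \<in> carrier G" "h2 \<in> carrier G" using generate_in_carrier[OF S] by auto
    then show ?case using eng by (simp only: f.hom_mult p.hom_mult f.hom_closed)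
  qed
  moreover have "a \<in> generate G ?S"
    using Suc.prems(3) lower_central_Suc[of "Suc i" G] by simp
  moreover have "a \<in> carrier G" using Suc.prems(3) lower_central_closed by blast
  ultimately show ?case
    using rcos_eq_iff[OF N, of "\<phi> a" a] by (simp add: N_def)
qed

text \<open>Both indices are counted from 1 here. For \<open>j = k\<close> the bound is 2k - 1,
  which is where the exponent of the refined target comes from.\<close>

lemma endo_shifts_lower_central:
  assumes "\<phi> \<in> hom G G" "\<And>a. a \<in> carrier G \<Longrightarrow> \<phi> a \<otimes> inv a \<in> lower_central G k"
    and "a \<in> lower_central G j" and "0 < j" "0 < k"
  shows "\<phi> a \<otimes> inv a \<in> lower_central G (j + k - 1)"
proof -
  obtain i l where "j = Suc i" "k = Suc l" using assms(4,5) by (metis gr0_implies_Suc)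
  then show ?thesis using endo_shifts_lower_central_Suc[of \<phi> l a i] assms by simp
qed

text \<open>Conjugation by \<open>x\<close> is trivial modulo \<Gamma>^(i+1), so the shift of the
  series by \<open>i\<close> applies to it. This takes the place of the usual argument by the three
  subgroups lemma.\<close>

lemma commutator_in_lower_central:
  assumes "x \<in> lower_central G i" "y \<in> lower_central G j" "0 < i" "0 < j"
  shows "commutator G x y \<in> lower_central G (i + j)"
proof -
  have x: "x \<in> carrier G" using assms lower_central_closed by blast
  have "x \<otimes> y \<otimes> inv x \<otimes> inv y \<in> lower_central G (j + Suc i - 1)"
  proof (rule endo_shifts_lower_central[OF conj_hom[OF x] _ assms(2,4)])
    fix a assume "a \<in> carrier G"
    then show "x \<otimes> a \<otimes> inv x \<otimes> inv a \<in> lower_central G (Suc i)"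
      using commutator_in_Suc[OF assms(3,1), of a] by (simp add: commutator_def)
  qed simp
  then show ?thesis by (simp add: commutator_def add.commute)
qed

text \<open>On \<Gamma>^q the map \<open>z \<mapsto> [a, z]\<close> is additive modulo
  \<Gamma>^(p+q+1), a subgroup of \<open>H\<close>, so membership in \<open>H\<close> need only be
  checked on generators. \<open>H\<close> is not assumed normal: conjugating an element of
  \<Gamma>^(p+q) by one of \<Gamma>^q changes it only by \<Gamma>^(p+2q), which \<open>H\<close>
  contains. The generators from \<Gamma>^(q+1) allow \<open>z\<close> to be known only modulo that
  term.\<close>

lemma commutator_generate_in_subgroup:
  assumes a: "a \<in> lower_central G p" and S: "S \<subseteq> lower_central G q"
    and pq: "0 < p" "0 < q"
    and H: "subgroup H G" and NH: "lower_central G (Suc (p + q)) \<subseteq> H"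
    and SH: "\<And>s. s \<in> S \<Longrightarrow> commutator G a s \<in> H"
    and z: "z \<in> generate G (S \<union> lower_central G (Suc q))"
  shows "commutator G a z \<in> H"
proof -
  have ac [simp]: "a \<in> carrier G" using a lower_central_closed by blast
  have SS: "S \<union> lower_central G (Suc q) \<subseteq> lower_central G q"
    using S lower_central_Suc_subset by blast
  have conj: "y \<otimes> w \<otimes> inv y \<in> H"
    if "y \<in> lower_central G q" "w \<in> H" "w \<in> lower_central G (p + q)" for y w
  proof -
    have c: "y \<in> carrier G" "w \<in> carrier G" using that lower_central_closed by blast+
    have "commutator G y w \<in> lower_central G (q + (p + q))"
      using commutator_in_lower_central that pq by simp
    then have "commutator G y w \<in> H"
      using NH lower_central_antimono[of "Suc (p + q)" "q + (p + q)"] pq by auto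
    then have "commutator G y w \<otimes> w \<in> H" using that subgroup.m_closed[OF H] by blast
    then show ?thesis using c by (simp add: commutator_def m_assoc)
  qed
  have cpq: "commutator G a y \<in> lower_central G (p + q)" if "y \<in> lower_central G q" for y
    using commutator_in_lower_central[OF a that pq] .
  have base: "commutator G a s \<in> H" if "s \<in> S \<union> lower_central G (Suc q)" for s
  proof (cases "s \<in> S")
    case False
    then have "s \<in> lower_central G (Suc q)" using that by blast
    then have "commutator G a s \<in> lower_central G (p + Suc q)"
      using commutator_in_lower_central[OF a _ pq(1)] by blast
    then show ?thesis using NH by auto
  qed (use SH in blast)
  have "z \<in> lower_central G q \<and> commutator G a z \<in> H"
    using z
  proof (induction rule: generate.induct)
    case one
    then show ?case using subgroup.one_closed[OF H] subgroup.one_closed[OF lower_central_subgroup[of q]]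
      by (simp add: commutator_def)
  next
    case (incl h)
    then show ?case using base SS by blast
  next
    case (inv h)
    then have h: "h \<in> lower_central G q" using SS by blast
    then have hc: "h \<in> carrier G" using lower_central_closed by blast
    have ih: "inv h \<in> lower_central G q"
      using h subgroup.m_inv_closed[OF lower_central_subgroup] by blast
    have "commutator G a (inv h) = inv h \<otimes> inv (commutator G a h) \<otimes> inv (inv h)"
      using hc by (simp add: commutator_def m_assoc inv_mult_group)
    moreover have "inv (commutator G a h) \<in> H" using base[OF inv] subgroup.m_inv_closed[OF H] by blast
    moreover have "inv (commutator G a h) \<in> lower_central G (p + q)"
      using cpq[OF h] subgroup.m_inv_closed[OF lower_central_subgroup] by blast
    ultimately show ?case using conj[OF ih] ih by simp
  next
    case (eng h1 h2)
    then have c: "h1 \<in> carrier G" "h2 \<in> carrier G" using lower_central_closed by blast+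
    have "commutator G a (h1 \<otimes> h2) = commutator G a h1 \<otimes> (h1 \<otimes> commutator G a h2 \<otimes> inv h1)"
      using c by (simp add: commutator_def m_assoc inv_mult_group)
    then show ?case
      using eng conj[of h1 "commutator G a h2"] cpq[of h2] subgroup.m_closed[OF H]
        subgroup.m_closed[OF lower_central_subgroup[of q]] by simp
  qed
  then show ?thesis ..
qed

lemma lower_central_central_mod:
  assumes i: "0 < i" and u: "u \<in> lower_central G i" and w: "w \<in> carrier (G Mod lower_central G (Suc i))"
  defines "N \<equiv> lower_central G (Suc i)"
  shows "(N #> u) \<otimes>\<^bsub>G Mod N\<^esub> w = w \<otimes>\<^bsub>G Mod N\<^esub> (N #> u)"
proof -
  obtain w' where w': "w' \<in> carrier G" "w = N #> w'"
    using w by (auto simp: carrier_FactGroup N_def)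
  then have "commutator G u w' \<in> N"
    using commutator_in_Suc[OF i u] by (simp add: N_def)
  then show ?thesis
    using commutes_mod_iff[of N u w'] w' lower_central_closed[OF u] lower_central_normal by (simp add: N_def)
qed

text \<open>The hypotheses of \<open>commutator_jacobi\<close> hold modulo \<Gamma>^(p+q+r+1) by
  weight alone: the commutator of any two of the three double brackets has weight above p+q+r, and
  the triple brackets have weight at least p+q+r, hence are central in the quotient.\<close>

lemma commutator_jacobi_in_subgroup:
  assumes x: "x \<in> lower_central G p" and y: "y \<in> lower_central G q" and z: "z \<in> lower_central G r"
    and pos: "0 < p" "0 < q" "0 < r"
    and H: "subgroup H G" and NH: "lower_central G (Suc (p + q + r)) \<subseteq> H"
    and 1: "commutator G x (commutator G z y) \<in> H" and 2: "commutator G (commutator G z x) y \<in> H"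
  shows "commutator G z (commutator G x y) \<in> H"
proof -
  define N where "N = lower_central G (Suc (p + q + r))"
  have N: "N \<lhd> G" unfolding N_def by (rule lower_central_normal)
  interpret p: group_hom G "G Mod N" "\<lambda>a. N #> a"
    by (rule normal_group_hom_Mod[OF N])
  have c [simp]: "x \<in> carrier G" "y \<in> carrier G" "z \<in> carrier G"
    using x y z lower_central_closed by blast+
  define a where "a = commutator G z x"
  define b where "b = commutator G z y"
  define c where "c = commutator G x y"
  have abc: "a \<in> lower_central G (r + p)" "b \<in> lower_central G (r + q)" "c \<in> lower_central G (p + q)"
    unfolding a_def b_def c_def using commutator_in_lower_central x y z pos by blast+
  have [simp]: "a \<in> carrier G" "b \<in> carrier G" "c \<in> carrier G"
    using abc lower_central_closed by blast+
  have inN: "commutator G u v \<in> N" if "u \<in> lower_central G i" "v \<in> lower_central G j" "0 < i" "0 < j"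
      "p + q + r < i + j" for u v i j
    using commutator_in_lower_central[OF that(1-4)] lower_central_antimono[of "Suc (p + q + r)" "i + j"] that(5)
    by (auto simp: N_def)
  have comm: "commutator G a b \<in> N" "commutator G a c \<in> N" "commutator G b c \<in> N"
    using inN[OF abc(1,2)] inN[OF abc(1,3)] inN[OF abc(2,3)] pos by auto
  have d: "commutator G x b \<in> lower_central G (p + (r + q))" "commutator G a y \<in> lower_central G (r + p + q)"
    using commutator_in_lower_central abc x y pos by simp_all
  have central: "(N #> u) \<otimes>\<^bsub>G Mod N\<^esub> w = w \<otimes>\<^bsub>G Mod N\<^esub> (N #> u)"
    if u: "u \<in> lower_central G (p + q + r)" and w: "w \<in> carrier (G Mod N)" for u w
    using lower_central_central_mod[OF _ u] w pos by (simp add: N_def)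
  have "commutator (G Mod N) (N #> z) (commutator (G Mod N) (N #> x) (N #> y))
     = commutator (G Mod N) (N #> x) (commutator (G Mod N) (N #> z) (N #> y))
        \<otimes>\<^bsub>G Mod N\<^esub> commutator (G Mod N) (commutator (G Mod N) (N #> z) (N #> x)) (N #> y)"
  proof (rule p.H.commutator_jacobi)
    have *: "commutator (G Mod N) (N #> z) (N #> x) = N #> a"
      "commutator (G Mod N) (N #> z) (N #> y) = N #> b"
      "commutator (G Mod N) (N #> x) (N #> y) = N #> c"
      by (simp_all add: a_def b_def c_def p.hom_commutator)
    show "N #> x \<in> carrier (G Mod N)" "N #> y \<in> carrier (G Mod N)" "N #> z \<in> carrier (G Mod N)"
      by (rule p.hom_closed; simp)+
    show "commutator (G Mod N) (N #> z) (N #> x) \<otimes>\<^bsub>G Mod N\<^esub> commutator (G Mod N) (N #> z) (N #> y)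
       = commutator (G Mod N) (N #> z) (N #> y) \<otimes>\<^bsub>G Mod N\<^esub> commutator (G Mod N) (N #> z) (N #> x)"
      "commutator (G Mod N) (N #> z) (N #> x) \<otimes>\<^bsub>G Mod N\<^esub> commutator (G Mod N) (N #> x) (N #> y)
       = commutator (G Mod N) (N #> x) (N #> y) \<otimes>\<^bsub>G Mod N\<^esub> commutator (G Mod N) (N #> z) (N #> x)"
      "commutator (G Mod N) (N #> z) (N #> y) \<otimes>\<^bsub>G Mod N\<^esub> commutator (G Mod N) (N #> x) (N #> y)
       = commutator (G Mod N) (N #> x) (N #> y) \<otimes>\<^bsub>G Mod N\<^esub> commutator (G Mod N) (N #> z) (N #> y)"
      unfolding * using comm commutes_mod_iff[OF N] by simp_all
    fix w assume w: "w \<in> carrier (G Mod N)"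
    have **: "commutator (G Mod N) (N #> x) (N #> b) = N #> commutator G x b"
      "commutator (G Mod N) (N #> a) (N #> y) = N #> commutator G a y"
      by (simp_all add: p.hom_commutator)
    show "commutator (G Mod N) (N #> x) (commutator (G Mod N) (N #> z) (N #> y)) \<otimes>\<^bsub>G Mod N\<^esub> w
       = w \<otimes>\<^bsub>G Mod N\<^esub> commutator (G Mod N) (N #> x) (commutator (G Mod N) (N #> z) (N #> y))"
      unfolding * ** by (rule central[OF _ w]) (use d in \<open>simp add: ac_simps\<close>)
    show "commutator (G Mod N) (commutator (G Mod N) (N #> z) (N #> x)) (N #> y) \<otimes>\<^bsub>G Mod N\<^esub> w
       = w \<otimes>\<^bsub>G Mod N\<^esub> commutator (G Mod N) (commutator (G Mod N) (N #> z) (N #> x)) (N #> y)"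
      unfolding * ** by (rule central[OF _ w]) (use d in \<open>simp add: ac_simps\<close>)
  qed
  then have "N #> commutator G z (commutator G x y) =
      N #> (commutator G x (commutator G z y) \<otimes> commutator G (commutator G z x) y)"
    by (simp only: p.hom_commutator p.hom_mult commutator_closed c)
  then have "commutator G z (commutator G x y) \<otimes>
      inv (commutator G x (commutator G z y) \<otimes> commutator G (commutator G z x) y) \<in> N"
    by (subst (asm) rcos_eq_iff[OF N]) simp_all
  then have "commutator G z (commutator G x y) \<otimes>
      inv (commutator G x (commutator G z y) \<otimes> commutator G (commutator G z x) y) \<in> H"
    using NH N_def by blast
  then have "commutator G z (commutator G x y) \<otimes>
      inv (commutator G x (commutator G z y) \<otimes> commutator G (commutator G z x) y) \<otimes>
      (commutator G x (commutator G z y) \<otimes> commutator G (commutator G z x) y) \<in> H"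
    using subgroup.m_closed[OF H] 1 2 by blast
  then show ?thesis by (simp add: m_assoc)
qed

end

subsection \<open>Presented monoids and free groups\<close>

declare in_lists_conv_set [simp del]

lemma word_cong_lists: "(u, v) \<in> word_cong A r \<Longrightarrow> u \<in> lists A \<and> v \<in> lists A"
  by (induction rule: word_cong.induct) auto

lemma equiv_word_cong: "equiv (lists A) (word_cong A r)"
proof (rule equivI)
  show "refl_on (lists A) (word_cong A r)"
    by (auto simp: refl_on_def intro: word_cong.refl)
  show "sym (word_cong A r)" by (auto simp: sym_def intro: word_cong.sym)
  show "trans (word_cong A r)" by (auto simp: trans_def intro: word_cong.trans)
qed (use word_cong_lists in fast)

abbreviation word_class :: "'c set \<Rightarrow> ('c list \<times> 'c list) set \<Rightarrow> 'c list \<Rightarrow> 'c list set" where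
  "word_class A r u \<equiv> word_cong A r `` {u}"

lemma word_class_eq_iff:
  assumes "u \<in> lists A" "v \<in> lists A"
  shows "word_class A r u = word_class A r v \<longleftrightarrow> (u, v) \<in> word_cong A r"
  using eq_equiv_class_iff[OF equiv_word_cong assms] .

lemma carrier_presented_monoid: "carrier (presented_monoid A r) = word_class A r ` lists A"
  by (auto simp: presented_monoid_def quotient_def)

lemma one_presented_monoid: "\<one>\<^bsub>presented_monoid A r\<^esub> = word_class A r []"
  by (simp add: presented_monoid_def)

lemma mult_presented_monoid:
  assumes "u \<in> lists A" "v \<in> lists A"
  shows "word_class A r u \<otimes>\<^bsub>presented_monoid A r\<^esub> word_class A r v = word_class A r (u @ v)"
proof -
  have "(u @ v, w) \<in> word_cong A r"
    if "(u, u') \<in> word_cong A r" "(v, v') \<in> word_cong A r" "(u' @ v', w) \<in> word_cong A r" for u' v' w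
    using that by (blast intro: word_cong.append word_cong.trans)
  moreover have "(u, u) \<in> word_cong A r" "(v, v) \<in> word_cong A r"
    using assms by (auto intro: word_cong.refl)
  ultimately show ?thesis
    unfolding presented_monoid_def by fastforce
qed

lemma monoid_presented_monoid: "monoid (presented_monoid A r)"
proof
  fix a b c assume "a \<in> carrier (presented_monoid A r)" "b \<in> carrier (presented_monoid A r)"
    "c \<in> carrier (presented_monoid A r)"
  then show "a \<otimes>\<^bsub>presented_monoid A r\<^esub> b \<otimes>\<^bsub>presented_monoid A r\<^esub> c
      = a \<otimes>\<^bsub>presented_monoid A r\<^esub> (b \<otimes>\<^bsub>presented_monoid A r\<^esub> c)"
    unfolding carrier_presented_monoid by (elim imageE) (simp add: mult_presented_monoid)
next
  fix a b assume "a \<in> carrier (presented_monoid A r)" "b \<in> carrier (presented_monoid A r)"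
  then show "a \<otimes>\<^bsub>presented_monoid A r\<^esub> b \<in> carrier (presented_monoid A r)"
    unfolding carrier_presented_monoid by (elim imageE) (simp add: mult_presented_monoid)
next
  fix a assume "a \<in> carrier (presented_monoid A r)"
  then obtain u where "u \<in> lists A" "a = word_class A r u" by (auto simp: carrier_presented_monoid)
  then show "\<one>\<^bsub>presented_monoid A r\<^esub> \<otimes>\<^bsub>presented_monoid A r\<^esub> a = a"
    "a \<otimes>\<^bsub>presented_monoid A r\<^esub> \<one>\<^bsub>presented_monoid A r\<^esub> = a"
    using mult_presented_monoid[of "[]" A u r] mult_presented_monoid[of u A "[]" r]
    by (simp_all add: one_presented_monoid)
qed (simp add: carrier_presented_monoid one_presented_monoid)

lemma word_val_Nil [simp]: "word_val K \<phi> [] = \<one>\<^bsub>K\<^esub>"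
  and word_val_Cons [simp]: "word_val K \<phi> (a # w) = \<phi> a \<otimes>\<^bsub>K\<^esub> word_val K \<phi> w"
  by (simp_all add: word_val_def)

lemma word_val_map: "word_val K \<phi> (map e w) = word_val K (\<phi> \<circ> e) w"
  by (induction w) simp_all

lemma word_val_cong:
  "w \<in> lists A \<Longrightarrow> (\<And>a. a \<in> A \<Longrightarrow> \<phi> a = \<psi> a) \<Longrightarrow> word_val K \<phi> w = word_val K \<psi> w"
  by (induction w) simp_all

context monoid
begin

lemma word_val_closed:
  "\<phi> \<in> A \<rightarrow> carrier G \<Longrightarrow> w \<in> lists A \<Longrightarrow> word_val G \<phi> w \<in> carrier G"
  by (induction w) (auto simp: Pi_iff)

lemma word_val_append:
  "\<phi> \<in> A \<rightarrow> carrier G \<Longrightarrow> u \<in> lists A \<Longrightarrow> v \<in> lists A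
    \<Longrightarrow> word_val G \<phi> (u @ v) = word_val G \<phi> u \<otimes> word_val G \<phi> v"
  by (induction u) (auto simp: Pi_iff m_assoc word_val_closed)

lemma word_val_respects:
  assumes \<phi>: "\<phi> \<in> A \<rightarrow> carrier G"
    and r: "\<forall>(u, v)\<in>r. u \<in> lists A \<longrightarrow> v \<in> lists A \<longrightarrow> word_val G \<phi> u = word_val G \<phi> v"
    and "(u, v) \<in> word_cong A r"
  shows "word_val G \<phi> u = word_val G \<phi> v"
  using assms(3)
proof (induction rule: word_cong.induct)
  case (append u u' v v')
  then show ?case using word_cong_lists[OF append.hyps(1)] word_cong_lists[OF append.hyps(2)]
    by (simp add: word_val_append[OF \<phi>])
qed (use r in auto)

lemma word_lift_class:
  assumes "\<phi> \<in> A \<rightarrow> carrier G"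
    and "\<forall>(u, v)\<in>r. u \<in> lists A \<longrightarrow> v \<in> lists A \<longrightarrow> word_val G \<phi> u = word_val G \<phi> v"
    and "u \<in> lists A"
  shows "word_lift G \<phi> (word_class A r u) = word_val G \<phi> u"
proof -
  have "word_val G \<phi> ` word_class A r u = {word_val G \<phi> u}"
  proof (intro equalityI subsetI)
    fix a assume "a \<in> word_val G \<phi> ` word_class A r u"
    then obtain v where "(u, v) \<in> word_cong A r" "a = word_val G \<phi> v" by auto
    then show "a \<in> {word_val G \<phi> u}"
      using word_val_respects[OF assms(1,2), of u v] by simp
  qed (use word_cong.refl[OF assms(3), of r] in auto)
  then show ?thesis by (simp add: word_lift_def)
qed

lemma word_lift_hom:
  assumes "\<phi> \<in> A \<rightarrow> carrier G"
    and "\<forall>(u, v)\<in>r. u \<in> lists A \<longrightarrow> v \<in> lists A \<longrightarrow> word_val G \<phi> u = word_val G \<phi> v"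
  shows "word_lift G \<phi> \<in> hom (presented_monoid A r) G"
proof (rule homI)
  fix C assume "C \<in> carrier (presented_monoid A r)"
  then obtain u where "u \<in> lists A" "C = word_class A r u"
    by (auto simp: carrier_presented_monoid)
  then show "word_lift G \<phi> C \<in> carrier G"
    using word_lift_class[OF assms] word_val_closed[OF assms(1)] by metis
next
  fix C D assume "C \<in> carrier (presented_monoid A r)" "D \<in> carrier (presented_monoid A r)"
  then obtain u v where uv: "u \<in> lists A" "C = word_class A r u" "v \<in> lists A" "D = word_class A r v"
    by (auto simp: carrier_presented_monoid)
  then show "word_lift G \<phi> (C \<otimes>\<^bsub>presented_monoid A r\<^esub> D) = word_lift G \<phi> C \<otimes> word_lift G \<phi> D"
    using word_lift_class[OF assms] word_val_append[OF assms(1)] by (simp add: mult_presented_monoid)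
qed

end

lemma hom_word_val:
  assumes "f \<in> hom K L" "monoid K" "f \<one>\<^bsub>K\<^esub> = \<one>\<^bsub>L\<^esub>" "\<phi> \<in> A \<rightarrow> carrier K" "w \<in> lists A"
  shows "f (word_val K \<phi> w) = word_val L (f \<circ> \<phi>) w"
  using assms(5)
proof (induction w)
  case (Cons a w)
  then show ?case using assms monoid.word_val_closed[OF assms(2,4)] by (simp add: hom_mult Pi_iff)
qed (simp add: assms)

lemma group_free_group: "group (free_group S)"
proof -
  let ?A = "S \<times> (UNIV :: bool set)" and ?r = "free_group_rels S"
  let ?v = "\<lambda>u. rev (map (\<lambda>(s, b). (s, \<not> b)) u)"
  interpret monoid "free_group S"
    unfolding free_group_def by (rule monoid_presented_monoid)
  have inv: "(u @ ?v u, []) \<in> word_cong ?A ?r" if "u \<in> lists ?A" for u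
    using that
  proof (induction u)
    case (Cons a u)
    obtain s b where a: "a = (s, b)" by (cases a)
    have u: "?v u \<in> lists ?A" using Cons by (auto simp: in_lists_conv_set)
    have 1: "([(s, b)], [(s, b)]) \<in> word_cong ?A ?r" "([(s, \<not> b)], [(s, \<not> b)]) \<in> word_cong ?A ?r"
      using Cons.hyps a by (auto intro: word_cong.refl)
    have "([(s, b)] @ (u @ ?v u) @ [(s, \<not> b)], [(s, b)] @ [] @ [(s, \<not> b)]) \<in> word_cong ?A ?r"
      by (intro word_cong.append 1 Cons.IH)
    moreover have "([(s, b), (s, \<not> b)], []) \<in> word_cong ?A ?r"
      using Cons.hyps a by (intro word_cong.base) (auto simp: free_group_rels_def)
    ultimately show ?case using a by (auto intro: word_cong.trans)
  qed (simp add: word_cong.refl)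
  have v: "?v u \<in> lists ?A" if "u \<in> lists ?A" for u
    using that by (auto simp: in_lists_conv_set)
  \<comment> \<open>The formal inverse is an involution, so the right inverse law just proved,
    applied to the inverse word, gives the left inverse law.\<close>
  have vv: "?v (?v u) = u" for u :: "('a \<times> bool) list"
    by (simp add: rev_map[symmetric] o_def case_prod_beta)
  show ?thesis
  proof (rule group_l_invI)
    fix C assume "C \<in> carrier (free_group S)"
    then obtain u where u: "u \<in> lists ?A" "C = word_class ?A ?r u"
      unfolding free_group_def carrier_presented_monoid by blast
    have "(?v u @ ?v (?v u), []) \<in> word_cong ?A ?r" by (rule inv[OF v[OF u(1)]])
    then have "word_class ?A ?r (?v u) \<otimes>\<^bsub>free_group S\<^esub> C = \<one>\<^bsub>free_group S\<^esub>"
      unfolding u(2) free_group_def one_presented_monoid vv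
      using mult_presented_monoid[OF v[OF u(1)] u(1), of ?r] word_cong_lists u(1) v[OF u(1)]
      by (simp add: word_class_eq_iff)
    moreover have "word_class ?A ?r (?v u) \<in> carrier (free_group S)"
      unfolding free_group_def carrier_presented_monoid using v[OF u(1)] by blast
    ultimately show "\<exists>D\<in>carrier (free_group S). D \<otimes>\<^bsub>free_group S\<^esub> C = \<one>\<^bsub>free_group S\<^esub>" by blast
  qed
qed

lemma free_gen_closed: "s \<in> S \<Longrightarrow> free_gen S s \<in> carrier (free_group S)"
  by (auto simp: free_gen_def free_group_def carrier_presented_monoid)

context group
begin

lemma free_group_lift_rels:
  assumes "x \<in> S \<rightarrow> carrier G"
  shows "\<forall>(u, v)\<in>free_group_rels S. u \<in> lists (S \<times> UNIV) \<longrightarrow> v \<in> lists (S \<times> UNIV) \<longrightarrow>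
    word_val G (\<lambda>(s, b). if b then x s else inv x s) u = word_val G (\<lambda>(s, b). if b then x s else inv x s) v"
  using assms by (auto simp: free_group_rels_def Pi_iff)

lemma free_group_lift_letters:
  "x \<in> S \<rightarrow> carrier G \<Longrightarrow> (\<lambda>(s, b). if b then x s else inv x s) \<in> S \<times> UNIV \<rightarrow> carrier G"
  by (auto simp: Pi_iff)

lemma free_group_lift_hom:
  assumes "x \<in> S \<rightarrow> carrier G"
  shows "free_group_lift G x \<in> hom (free_group S) G"
  unfolding free_group_lift_def free_group_def
  by (rule word_lift_hom[OF free_group_lift_letters[OF assms] free_group_lift_rels[OF assms]])

lemma free_group_lift_gen:
  assumes "x \<in> S \<rightarrow> carrier G" "s \<in> S"
  shows "free_group_lift G x (free_gen S s) = x s"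
  unfolding free_group_lift_def free_gen_def
  using word_lift_class[OF free_group_lift_letters[OF assms(1)] free_group_lift_rels[OF assms(1)], of "[(s, True)]"] assms
  by (auto simp: Pi_iff)

lemma hom_eq_on_generate:
  assumes "group H" "f \<in> hom G H" "g \<in> hom G H" "S \<subseteq> carrier G" "\<And>s. s \<in> S \<Longrightarrow> f s = g s"
    and "a \<in> generate G S"
  shows "f a = g a"
proof -
  interpret f: group_hom G H f using assms(1,2) group_axioms by (simp add: group_hom_def group_hom_axioms_def)
  interpret g: group_hom G H g using assms(1,3) group_axioms by (simp add: group_hom_def group_hom_axioms_def)
  show ?thesis using assms(6)
  proof (induction rule: generate.induct)
    case (inv h)
    then have "h \<in> carrier G" using assms(4) by blast
    then show ?case using assms(5)[OF inv] by simp
  next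
    case (eng h1 h2)
    then have "h1 \<in> carrier G" "h2 \<in> carrier G" using generate_in_carrier[OF assms(4)] by auto
    then show ?case using eng by simp
  qed (simp_all add: assms(5))
qed

end

lemma free_group_generated: "carrier (free_group S) = generate (free_group S) (free_gen S ` S)"
proof -
  let ?A = "S \<times> (UNIV :: bool set)" and ?r = "free_group_rels S"
  interpret F: group "free_group S" by (rule group_free_group)
  have S: "free_gen S ` S \<subseteq> carrier (free_group S)" by (simp add: image_subset_iff free_gen_closed)
  have letter: "word_class ?A ?r [(s, b)] \<in> generate (free_group S) (free_gen S ` S)" if "s \<in> S" for s b
  proof (cases b)
    case True
    then show ?thesis using that by (auto simp: free_gen_def intro: generate.incl)
  next
    case False
    have "word_class ?A ?r [(s, False)] \<otimes>\<^bsub>free_group S\<^esub> free_gen S s = \<one>\<^bsub>free_group S\<^esub>"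
      unfolding free_gen_def free_group_def one_presented_monoid
      using that mult_presented_monoid[of "[(s, False)]" ?A "[(s, True)]" ?r]
      by (simp add: word_class_eq_iff) (rule word_cong.base; force simp: free_group_rels_def)
    then have "word_class ?A ?r [(s, False)] = inv\<^bsub>free_group S\<^esub> free_gen S s"
      using that free_gen_closed[OF that]
      by (intro F.inv_equality[symmetric]) (auto simp: free_group_def carrier_presented_monoid)
    then show ?thesis using that False by (auto intro: generate.inv)
  qed
  have "word_class ?A ?r u \<in> generate (free_group S) (free_gen S ` S)" if "u \<in> lists ?A" for u
    using that
  proof (induction u)
    case Nil
    then show ?case using generate.one[of "free_group S"] by (simp add: free_group_def one_presented_monoid)
  next
    case (Cons a u)
    then show ?case
      using mult_presented_monoid[of "[a]" ?A u ?r] generate.eng[OF letter Cons.IH, of "fst a" "snd a"]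
      by (auto simp: free_group_def)
  qed
  then show ?thesis
    using F.generate_incl[OF S] by (auto simp: free_group_def carrier_presented_monoid)
qed

section \<open>The universal property of a free basis\<close>

lemma free_basisD:
  assumes "free_basis F S x"
  shows "group F" "x \<in> S \<rightarrow> carrier F" "free_group_lift F x \<in> iso (free_group S) F"
  using assms by (auto simp: free_basis_def)

lemma free_basis_generated:
  assumes "free_basis F S x"
  shows "carrier F = generate F (x ` S)"
proof -
  note F = free_basisD[OF assms]
  interpret f: group_hom "free_group S" F "free_group_lift F x"
    using F group_free_group by (simp add: group_hom_def group_hom_axioms_def iso_def)
  have S: "free_gen S ` S \<subseteq> carrier (free_group S)" by (simp add: image_subset_iff free_gen_closed)
  have "carrier F = free_group_lift F x ` carrier (free_group S)"
    using F(3) by (auto simp: iso_def bij_betw_def)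
  also have "\<dots> = generate F (free_group_lift F x ` free_gen S ` S)"
    by (subst free_group_generated) (rule f.generate_img[OF S, symmetric])
  also have "free_group_lift F x ` free_gen S ` S = x ` S"
    using group.free_group_lift_gen[OF F(1,2)] by (auto simp: image_iff)
  finally show ?thesis .
qed

text \<open>The third clause ties \<open>f\<close> to the evaluation of formal words at
  \<open>y\<close>, the form in which solutions of an acyclic system arrive.\<close>

lemma free_basis_hom:
  assumes "free_basis F S x" "group K" "y \<in> S \<rightarrow> carrier K"
  obtains f where "f \<in> hom F K" "\<And>s. s \<in> S \<Longrightarrow> f (x s) = y s"
    "\<And>u. u \<in> carrier (free_group S) \<Longrightarrow> f (free_group_lift F x u) = free_group_lift K y u"
proof
  note F = free_basisD[OF assms(1)]
  let ?t = "free_group_lift F x"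
  let ?f = "\<lambda>a. free_group_lift K y (inv_into (carrier (free_group S)) ?t a)"
  have "inv_into (carrier (free_group S)) ?t \<in> hom F (free_group S)"
    using group.iso_set_sym[OF group_free_group F(3)] by (simp add: iso_def)
  then show "?f \<in> hom F K"
    using hom_compose[OF _ group.free_group_lift_hom[OF assms(2,3)]] by (simp add: o_def)
  show f: "?f (?t u) = free_group_lift K y u" if "u \<in> carrier (free_group S)" for u
    using that F(3) by (simp add: iso_def bij_betw_def)
  show "?f (x s) = y s" if "s \<in> S" for s
    using f[OF free_gen_closed[OF that]] group.free_group_lift_gen[OF F(1,2) that]
      group.free_group_lift_gen[OF assms(2,3) that] by simp
qed

lemma free_basis_hom_ex:
  assumes "free_basis F S x" "group K" "y \<in> S \<rightarrow> carrier K"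
  shows "\<exists>f\<in>hom F K. \<forall>s\<in>S. f (x s) = y s"
  by (rule free_basis_hom[OF assms]) (intro bexI ballI; assumption)

lemma free_basis_hom_eq:
  assumes "free_basis F S x" "group K" "f \<in> hom F K" "g \<in> hom F K" "\<And>s. s \<in> S \<Longrightarrow> f (x s) = g (x s)"
    and "a \<in> carrier F"
  shows "f a = g a"
proof -
  note F = free_basisD[OF assms(1)]
  show ?thesis
    using group.hom_eq_on_generate[OF F(1) assms(2-4), of "x ` S" a] assms(5,6) F(2)
    by (auto simp: free_basis_generated[OF assms(1)])
qed

subsection \<open>Acyclic systems in terms of words\<close>

text \<open>Words represent elements of the free product, so that substitution can be handled by
  induction on lists. The kernel of the map to the abelianization becomes membership of the free
  part in the derived subgroup.\<close>

definition acyclic_word :: "('a, 'm) monoid_scheme \<Rightarrow> nat \<Rightarrow> ('a + (nat \<times> bool) list set) list \<Rightarrow> bool" where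
  "acyclic_word G m w \<longleftrightarrow> w \<in> lists (carrier G <+> carrier (free_group {..<m})) \<and>
     word_val (free_group {..<m}) (case_sum (\<lambda>_. \<one>\<^bsub>free_group {..<m}\<^esub>) (\<lambda>u. u)) w
       \<in> derived (free_group {..<m}) (carrier (free_group {..<m}))"

definition word_subst :: "('a, 'm) monoid_scheme \<Rightarrow> (nat \<Rightarrow> 'a) \<Rightarrow> ('a + (nat \<times> bool) list set) list \<Rightarrow> 'a" where
  "word_subst G y w = word_val G (case_sum (\<lambda>g. g) (free_group_lift G y)) w"

lemma free_product_lift_class:
  assumes "group G" "group H" "group K" "f \<in> hom G K" "h \<in> hom H K" "w \<in> lists (carrier G <+> carrier H)"
  shows "free_product_lift K f h (word_class (carrier G <+> carrier H) (free_product_rels G H) w)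
    = word_val K (case_sum f h) w"
proof -
  interpret f: group_hom G K f using assms by (simp add: group_hom_def group_hom_axioms_def)
  interpret h: group_hom H K h using assms by (simp add: group_hom_def group_hom_axioms_def)
  show ?thesis
    unfolding free_product_lift_def
    by (rule f.H.word_lift_class[OF _ _ assms(6)]) (auto simp: free_product_rels_def)
qed

lemma substitute_class:
  assumes "group G" "y \<in> {..<m} \<rightarrow> carrier G" "w \<in> lists (carrier G <+> carrier (free_group {..<m}))"
  shows "substitute G y (word_class (carrier G <+> carrier (free_group {..<m})) (free_product_rels G (free_group {..<m})) w)
    = word_subst G y w"
proof -
  have "(\<lambda>g. g) \<in> hom G G" by (simp add: hom_def)
  then show ?thesis
    unfolding substitute_def word_subst_def
    by (intro free_product_lift_class assms group_free_group group.free_group_lift_hom[OF assms(1,2)])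
qed

lemma acyclic_elements_eq:
  assumes "group G"
  shows "acyclic_elements G m =
    word_class (carrier G <+> carrier (free_group {..<m})) (free_product_rels G (free_group {..<m})) ` {w. acyclic_word G m w}"
proof -
  let ?F = "free_group {..<m}"
  interpret F: group ?F by (rule group_free_group)
  have hom: "(\<lambda>_. \<one>\<^bsub>?F\<^esub>) \<in> hom G ?F" "(\<lambda>u. u) \<in> hom ?F ?F" by (simp_all add: hom_def)
  have "to_H1 ?F z = \<one>\<^bsub>H1 ?F\<^esub> \<longleftrightarrow> z \<in> derived ?F (carrier ?F)" if "z \<in> carrier ?F" for z
    using F.rcos_eq_self_iff[OF F.derived_self_is_normal that] by (simp add: to_H1_def H1_def)
  moreover have "word_val ?F (case_sum (\<lambda>_. \<one>\<^bsub>?F\<^esub>) (\<lambda>u. u)) w \<in> carrier ?F"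
    if "w \<in> lists (carrier G <+> carrier ?F)" for w
    by (rule F.word_val_closed[OF _ that]) auto
  moreover have "free_product_lift ?F (\<lambda>_. \<one>\<^bsub>?F\<^esub>) (\<lambda>u. u) (word_class (carrier G <+> carrier ?F) (free_product_rels G ?F) w)
      = word_val ?F (case_sum (\<lambda>_. \<one>\<^bsub>?F\<^esub>) (\<lambda>u. u)) w"
    if "w \<in> lists (carrier G <+> carrier ?F)" for w
    by (rule free_product_lift_class[OF assms F.is_group F.is_group hom that])
  ultimately have "to_H1 ?F (free_product_lift ?F (\<lambda>_. \<one>\<^bsub>?F\<^esub>) (\<lambda>u. u)
        (word_class (carrier G <+> carrier ?F) (free_product_rels G ?F) w)) = \<one>\<^bsub>H1 ?F\<^esub>
      \<longleftrightarrow> word_val ?F (case_sum (\<lambda>_. \<one>\<^bsub>?F\<^esub>) (\<lambda>u. u)) w \<in> derived ?F (carrier ?F)"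
    if "w \<in> lists (carrier G <+> carrier ?F)" for w
    using that by presburger
  then show ?thesis
    unfolding acyclic_elements_def kernel_def acyclic_word_def free_product_def carrier_presented_monoid
    by (auto simp: image_iff)
qed

text \<open>Every class has a representative and substitution does not depend on its choice, so
  systems of classes and systems of words have the same solutions. Normal forms in the free product
  play no part.\<close>

lemma acyclically_closed_iff_words:
  "acyclically_closed G \<longleftrightarrow> group G \<and>
     (\<forall>m w. (\<forall>i<m. acyclic_word G m (w i)) \<longrightarrow>
        (\<exists>!y. y \<in> {..<m} \<rightarrow>\<^sub>E carrier G \<and> (\<forall>i<m. y i = word_subst G y (w i))))"
proof (cases "group G")
  case True
  let ?c = "\<lambda>m. word_class (carrier G <+> carrier (free_group {..<m})) (free_product_rels G (free_group {..<m}))"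
  have eq: "(y \<in> {..<m} \<rightarrow>\<^sub>E carrier G \<and> (\<forall>i<m. y i = substitute G y (v i))) \<longleftrightarrow>
      (y \<in> {..<m} \<rightarrow>\<^sub>E carrier G \<and> (\<forall>i<m. y i = word_subst G y (w i)))"
    if "\<forall>i<m. acyclic_word G m (w i)" "\<forall>i<m. v i = ?c m (w i)" for m v w y
    using substitute_class[OF True, of y m] that by (auto simp: acyclic_word_def PiE_def)
  show ?thesis
  proof (intro iffI conjI allI impI)
    fix m w assume AC: "acyclically_closed G" and w: "\<forall>i<m. acyclic_word G m (w i)"
    have "(\<lambda>i. ?c m (w i)) \<in> {..<m} \<rightarrow> acyclic_elements G m"
      using w by (auto simp: acyclic_elements_eq[OF True])
    then have "\<exists>!y. y \<in> {..<m} \<rightarrow>\<^sub>E carrier G \<and> (\<forall>i<m. y i = substitute G y (?c m (w i)))"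
      using AC by (simp add: acyclically_closed_def)
    then show "\<exists>!y. y \<in> {..<m} \<rightarrow>\<^sub>E carrier G \<and> (\<forall>i<m. y i = word_subst G y (w i))"
      using eq[OF w, of "\<lambda>i. ?c m (w i)"] by simp
  next
    assume R: "group G \<and> (\<forall>m w. (\<forall>i<m. acyclic_word G m (w i)) \<longrightarrow>
        (\<exists>!y. y \<in> {..<m} \<rightarrow>\<^sub>E carrier G \<and> (\<forall>i<m. y i = word_subst G y (w i))))"
    show "acyclically_closed G"
      unfolding acyclically_closed_def
    proof (intro conjI allI ballI True)
      fix m v assume v: "v \<in> {..<m} \<rightarrow> acyclic_elements G m"
      then have "\<forall>i<m. \<exists>w. acyclic_word G m w \<and> v i = ?c m w"
        by (auto simp: acyclic_elements_eq[OF True] Pi_iff)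
      then obtain w where w: "\<forall>i<m. acyclic_word G m (w i)" "\<forall>i<m. v i = ?c m (w i)" by metis
      then show "\<exists>!y. y \<in> {..<m} \<rightarrow>\<^sub>E carrier G \<and> (\<forall>i<m. y i = substitute G y (v i))"
        using R eq[OF w] by simp
    qed
  qed (rule True)
qed (simp add: acyclically_closed_def)

lemma (in group) free_group_lift_closed:
  "x \<in> S \<rightarrow> carrier G \<Longrightarrow> u \<in> carrier (free_group S) \<Longrightarrow> free_group_lift G x u \<in> carrier G"
  using free_group_lift_hom hom_in_carrier by metis

lemma (in group) word_subst_closed:
  assumes "y \<in> {..<m} \<rightarrow> carrier G" "w \<in> lists (carrier G <+> carrier (free_group {..<m}))"
  shows "word_subst G y w \<in> carrier G"
  unfolding word_subst_def
  by (rule word_val_closed[OF _ assms(2)]) (auto simp: free_group_lift_closed[OF assms(1)])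

lemma (in group_hom) hom_free_group_lift:
  assumes "x \<in> S \<rightarrow> carrier G" "x' \<in> S \<rightarrow> carrier H" "\<And>s. s \<in> S \<Longrightarrow> h (x s) = x' s" "u \<in> carrier (free_group S)"
  shows "h (free_group_lift G x u) = free_group_lift H x' u"
proof -
  interpret F: group "free_group S" by (rule group_free_group)
  have "(h \<circ> free_group_lift G x) u = free_group_lift H x' u"
  proof (rule F.hom_eq_on_generate[of H])
    show "group H" by (rule H.is_group)
    show "h \<circ> free_group_lift G x \<in> hom (free_group S) H"
      by (rule Group.hom_compose[OF G.free_group_lift_hom[OF assms(1)] homh])
    show "free_group_lift H x' \<in> hom (free_group S) H"
      by (rule H.free_group_lift_hom[OF assms(2)])
    show "u \<in> generate (free_group S) (free_gen S ` S)" using assms(4) free_group_generated by blast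
    show "free_gen S ` S \<subseteq> carrier (free_group S)" by (simp add: image_subset_iff free_gen_closed)
  qed (use assms in \<open>auto simp: G.free_group_lift_gen H.free_group_lift_gen\<close>)
  then show ?thesis by simp
qed

lemma (in group_hom) hom_word_subst:
  assumes "y \<in> {..<m} \<rightarrow> carrier G" "y' \<in> {..<m} \<rightarrow> carrier H" "\<And>i. i < m \<Longrightarrow> h (y i) = y' i"
    and w: "w \<in> lists (carrier G <+> carrier (free_group {..<m}))"
  shows "h (word_subst G y w) = word_subst H y' (map (map_sum h (\<lambda>u. u)) w)"
proof -
  have "h (word_subst G y w) = word_val H (h \<circ> case_sum (\<lambda>g. g) (free_group_lift G y)) w"
    unfolding word_subst_def
    by (rule hom_word_val[OF homh _ _ _ w]) (auto simp: G.free_group_lift_closed[OF assms(1)])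
  also have "\<dots> = word_val H (case_sum (\<lambda>g. g) (free_group_lift H y') \<circ> map_sum h (\<lambda>u. u)) w"
  proof (rule word_val_cong[OF w])
    have "h (free_group_lift G y u) = free_group_lift H y' u" if "u \<in> carrier (free_group {..<m})" for u
      by (rule hom_free_group_lift[OF assms(1,2) _ that]) (use assms(3) in simp)
    then show "(h \<circ> case_sum (\<lambda>g. g) (free_group_lift G y)) a
        = (case_sum (\<lambda>g. g) (free_group_lift H y') \<circ> map_sum h (\<lambda>u. u)) a"
      if "a \<in> carrier G <+> carrier (free_group {..<m})" for a
      using that by auto
  qed
  finally show ?thesis by (simp add: word_val_map word_subst_def)
qed

text \<open>Applying \<open>e\<close> to the constants turns a system over \<open>G\<close> into one
  over \<open>H\<close>, and \<open>e\<close> matches the solutions of the two. This is what allows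
  a test group to be replaced by a copy on another type.\<close>

lemma acyclically_closed_iso:
  assumes e: "e \<in> iso G H" and G: "group G" and H: "acyclically_closed H"
  shows "acyclically_closed G"
proof -
  have gH: "group H" using H by (simp add: acyclically_closed_def)
  interpret e: group_hom G H e using e G gH by (simp add: group_hom_def group_hom_axioms_def iso_def)
  have bij: "bij_betw e (carrier G) (carrier H)" using e by (simp add: iso_def)
  show ?thesis
    unfolding acyclically_closed_iff_words
  proof (intro conjI allI impI G)
    fix m w assume w: "\<forall>i<m. acyclic_word G m (w i)"
    define w' where "w' i = map (map_sum e (\<lambda>u. u)) (w i)" for i
    have wl: "w i \<in> lists (carrier G <+> carrier (free_group {..<m}))" if "i < m" for i
      using w that by (simp add: acyclic_word_def)
    have "acyclic_word H m (w' i)" if "i < m" for i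
    proof -
      have "w' i \<in> lists (carrier H <+> carrier (free_group {..<m}))"
        using wl[OF that] by (fastforce simp: w'_def in_lists_conv_set)
      moreover have "case_sum (\<lambda>_. \<one>\<^bsub>free_group {..<m}\<^esub>) (\<lambda>u. u) \<circ> map_sum e (\<lambda>u. u) =
          case_sum (\<lambda>_. \<one>\<^bsub>free_group {..<m}\<^esub>) (\<lambda>u. u)"
        by (auto simp: fun_eq_iff split: sum.split)
      ultimately show ?thesis
        using w that by (simp add: acyclic_word_def w'_def word_val_map)
    qed
    then have "\<exists>!z. z \<in> {..<m} \<rightarrow>\<^sub>E carrier H \<and> (\<forall>i<m. z i = word_subst H z (w' i))"
      by (intro H[unfolded acyclically_closed_iff_words, THEN conjunct2, THEN spec, THEN spec, THEN mp]) simp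
    then obtain z where zz: "z \<in> {..<m} \<rightarrow>\<^sub>E carrier H \<and> (\<forall>i<m. z i = word_subst H z (w' i))"
      and all: "\<forall>z'. z' \<in> {..<m} \<rightarrow>\<^sub>E carrier H \<and> (\<forall>i<m. z' i = word_subst H z' (w' i)) \<longrightarrow> z' = z"
      by (elim ex1E)
    note z = conjunct1[OF zz] conjunct2[OF zz]
    have uniq: "z' = z" if "z' \<in> {..<m} \<rightarrow>\<^sub>E carrier H" "\<forall>i<m. z' i = word_subst H z' (w' i)" for z'
      by (rule all[THEN spec, THEN mp, OF conjI[OF that]])
    have trans: "(\<forall>i<m. y i = word_subst G y (w i)) \<longleftrightarrow> (\<forall>i<m. y' i = word_subst H y' (w' i))"
      if y: "y \<in> {..<m} \<rightarrow> carrier G" "y' \<in> {..<m} \<rightarrow> carrier H" and ey: "\<And>i. i < m \<Longrightarrow> e (y i) = y' i" for y y'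
    proof -
      have "y i = word_subst G y (w i) \<longleftrightarrow> y' i = word_subst H y' (w' i)" if i: "i < m" for i
      proof -
        have "e (word_subst G y (w i)) = word_subst H y' (w' i)"
          unfolding w'_def by (rule e.hom_word_subst[OF y _ wl[OF i]]) (rule ey)
        moreover have "y i \<in> carrier G" using y(1) i by auto
        moreover have "word_subst G y (w i) \<in> carrier G"
          by (rule e.G.word_subst_closed[OF y(1) wl[OF i]])
        ultimately show ?thesis
          using ey[OF i] bij by (metis bij_betw_def inj_on_eq_iff)
      qed
      then show ?thesis by blast
    qed
    show "\<exists>!y. y \<in> {..<m} \<rightarrow>\<^sub>E carrier G \<and> (\<forall>i<m. y i = word_subst G y (w i))"
    proof
      define y where "y = restrict (\<lambda>i. inv_into (carrier G) e (z i)) {..<m}"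
      have ye: "e (y i) = z i" "y i \<in> carrier G" if "i < m" for i
        using bij z(1) that
        by (auto simp: y_def bij_betw_def PiE_iff f_inv_into_f inv_into_into)
      then show "y \<in> {..<m} \<rightarrow>\<^sub>E carrier G \<and> (\<forall>i<m. y i = word_subst G y (w i))"
      proof -
        have "y \<in> {..<m} \<rightarrow> carrier G" "z \<in> {..<m} \<rightarrow> carrier H" using ye z(1) by (auto simp: PiE_def)
        note sol = iffD2[OF trans[OF this ye(1)] z(2)]
        have "y \<in> {..<m} \<rightarrow>\<^sub>E carrier G" using ye(2) by (auto simp: y_def)
        with sol show ?thesis by blast
      qed
      fix y' assume y': "y' \<in> {..<m} \<rightarrow>\<^sub>E carrier G \<and> (\<forall>i<m. y' i = word_subst G y' (w i))"
      define z' where "z' = restrict (e \<circ> y') {..<m}"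
      have "z' \<in> {..<m} \<rightarrow>\<^sub>E carrier H" using conjunct1[OF y'] by (auto simp: z'_def PiE_iff)
      moreover have "\<forall>i<m. z' i = word_subst H z' (w' i)"
      proof (rule iffD1[OF trans _])
        show "\<forall>i<m. y' i = word_subst G y' (w i)" by (rule conjunct2[OF y'])
        show "y' \<in> {..<m} \<rightarrow> carrier G" using conjunct1[OF y'] by (simp add: PiE_def)
        then show "z' \<in> {..<m} \<rightarrow> carrier H" by (auto simp: z'_def Pi_iff)
      qed (simp add: z'_def)
      ultimately have "z' = z" by (rule uniq)
      then have "e (y' i) = e (y i)" if "i < m" for i using ye[OF that] that by (auto simp: z'_def)
      then have "y' i = y i" if "i < m" for i
        using that ye(2)[OF that] conjunct1[OF y'] bij by (auto simp: bij_betw_def inj_on_def PiE_iff)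
      then show "y' = y" using conjunct1[OF y'] by (auto simp: y_def fun_eq_iff PiE_iff extensional_def)
    qed
  qed
qed

subsection \<open>Nilpotent groups are acyclically closed\<close>

context group
begin

text \<open>Replacing \<open>y\<close> by \<open>y z\<close> with \<open>z\<close> central modulo \<open>\<Gamma>\<^bsup>j+1\<^esup>\<close> multiplies the value of a word
  by the value of its free part at \<open>z\<close>; for an acyclic word that is a product of commutators of
  elements of \<open>\<Gamma>\<^sup>j\<close>.\<close>

lemma word_subst_contracts:
  assumes y: "y \<in> {..<m} \<rightarrow> carrier G" and y': "y' \<in> {..<m} \<rightarrow> carrier G" and j: "0 < j"
    and eq: "\<And>i. i < m \<Longrightarrow> lower_central G j #> y i = lower_central G j #> y' i"
    and w: "acyclic_word G m w"
  shows "lower_central G (Suc j) #> word_subst G y w = lower_central G (Suc j) #> word_subst G y' w"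
proof -
  define N where "N = lower_central G (Suc j)"
  have N: "N \<lhd> G" unfolding N_def by (rule lower_central_normal)
  interpret p: group_hom G "G Mod N" "\<lambda>a. N #> a"
    by (rule normal_group_hom_Mod[OF N])
  define z where "z i = inv (y i) \<otimes> y' i" for i
  let ?F = "free_group {..<m}"
  interpret F: group ?F by (rule group_free_group)
  have gens: "free_gen {..<m} ` {..<m} \<subseteq> carrier ?F"
    by (simp add: image_subset_iff free_gen_closed)
  have zj: "z i \<in> lower_central G j" if "i < m" for i
    using rcos_eq_iff_left[OF lower_central_normal, of "y i" "y' i" j] eq[OF that] y y' that
    by (simp add: z_def Pi_iff)
  have z: "z \<in> {..<m} \<rightarrow> carrier G" using zj lower_central_closed by blast
  define L where "L = free_group_lift G y"
  define L' where "L' = free_group_lift G y'"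
  define Z where "Z = free_group_lift G z"
  interpret L: group_hom ?F G L
    using free_group_lift_hom[OF y] by unfold_locales (simp add: L_def)
  interpret L': group_hom ?F G L'
    using free_group_lift_hom[OF y'] by unfold_locales (simp add: L'_def)
  interpret Z: group_hom ?F G Z
    using free_group_lift_hom[OF z] by unfold_locales (simp add: Z_def)
  have Zj: "Z u \<in> lower_central G j" if "u \<in> carrier ?F" for u
  proof -
    have "Z ` carrier ?F = generate G (Z ` free_gen {..<m} ` {..<m})"
      by (subst free_group_generated) (rule Z.generate_img[OF gens, symmetric])
    also have "\<dots> \<subseteq> lower_central G j"
      using zj by (intro generate_subgroup_incl lower_central_subgroup)
        (auto simp: Z_def free_group_lift_gen[OF z])
    finally show ?thesis using that by blast
  qed
  have central: "(N #> Z u) \<otimes>\<^bsub>G Mod N\<^esub> c = c \<otimes>\<^bsub>G Mod N\<^esub> (N #> Z u)"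
    if "u \<in> carrier ?F" "c \<in> carrier (G Mod N)" for u c
    using lower_central_central_mod[OF j Zj[OF that(1)]] that(2) by (simp add: N_def)
  have Zder: "Z u \<in> N" if "u \<in> derived ?F (carrier ?F)" for u
  proof -
    have "Z ` derived ?F (carrier ?F) = generate G (Z ` derived_set ?F (carrier ?F))"
      unfolding derived_def by (rule Z.generate_img[symmetric]) auto
    also have "\<dots> \<subseteq> N"
    proof (rule generate_subgroup_incl[OF _ normal_imp_subgroup[OF N]])
      show "Z ` derived_set ?F (carrier ?F) \<subseteq> N"
        using commutator_in_Suc[OF j Zj Z.hom_closed] by (auto simp: N_def commutator_def)
    qed
    finally show ?thesis using that by blast
  qed
  have swap: "a \<otimes>\<^bsub>G Mod N\<^esub> (N #> Z u) \<otimes>\<^bsub>G Mod N\<^esub> (b \<otimes>\<^bsub>G Mod N\<^esub> (N #> Z v))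
      = a \<otimes>\<^bsub>G Mod N\<^esub> b \<otimes>\<^bsub>G Mod N\<^esub> (N #> Z (u \<otimes>\<^bsub>?F\<^esub> v))"
    if "a \<in> carrier (G Mod N)" "b \<in> carrier (G Mod N)" "u \<in> carrier ?F" "v \<in> carrier ?F" for a b u v
  proof -
    have c: "N #> Z u \<in> carrier (G Mod N)" "N #> Z v \<in> carrier (G Mod N)"
      using p.hom_closed[OF Z.hom_closed[OF that(3)]] p.hom_closed[OF Z.hom_closed[OF that(4)]] by blast+
    have "a \<otimes>\<^bsub>G Mod N\<^esub> (N #> Z u) \<otimes>\<^bsub>G Mod N\<^esub> (b \<otimes>\<^bsub>G Mod N\<^esub> (N #> Z v))
        = a \<otimes>\<^bsub>G Mod N\<^esub> ((N #> Z u) \<otimes>\<^bsub>G Mod N\<^esub> b) \<otimes>\<^bsub>G Mod N\<^esub> (N #> Z v)"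
      using that c p.H.m_assoc p.H.m_closed by presburger
    also have "\<dots> = a \<otimes>\<^bsub>G Mod N\<^esub> (b \<otimes>\<^bsub>G Mod N\<^esub> (N #> Z u)) \<otimes>\<^bsub>G Mod N\<^esub> (N #> Z v)"
      using central[OF that(3,2)] by simp
    also have "\<dots> = a \<otimes>\<^bsub>G Mod N\<^esub> b \<otimes>\<^bsub>G Mod N\<^esub> ((N #> Z u) \<otimes>\<^bsub>G Mod N\<^esub> (N #> Z v))"
      using that c p.H.m_assoc p.H.m_closed by presburger
    finally show ?thesis
      using p.hom_mult[OF Z.hom_closed[OF that(3)] Z.hom_closed[OF that(4)]] Z.hom_mult[OF that(3,4)] by simp
  qed
  have L': "N #> L' u = (N #> L u) \<otimes>\<^bsub>G Mod N\<^esub> (N #> Z u)" if "u \<in> carrier ?F" for u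
  proof (rule F.hom_eq_on_generate[OF p.H.is_group _ _ gens])
    show "(\<lambda>u. N #> L' u) \<in> hom ?F (G Mod N)"
      using Group.hom_compose[OF L'.homh p.homh] by (simp add: o_def)
    \<comment> \<open>A product of two homomorphisms is multiplicative here because the values of
      \<open>Z\<close> are central modulo \<open>N\<close>.\<close>
    show "(\<lambda>u. (N #> L u) \<otimes>\<^bsub>G Mod N\<^esub> (N #> Z u)) \<in> hom ?F (G Mod N)"
    proof (rule homI)
      fix u v assume uv: "u \<in> carrier ?F" "v \<in> carrier ?F"
      show "(N #> L u) \<otimes>\<^bsub>G Mod N\<^esub> (N #> Z u) \<in> carrier (G Mod N)"
        using uv p.hom_closed L.hom_closed Z.hom_closed p.H.m_closed by presburger
      show "(N #> L (u \<otimes>\<^bsub>?F\<^esub> v)) \<otimes>\<^bsub>G Mod N\<^esub> (N #> Z (u \<otimes>\<^bsub>?F\<^esub> v))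
          = (N #> L u) \<otimes>\<^bsub>G Mod N\<^esub> (N #> Z u) \<otimes>\<^bsub>G Mod N\<^esub> ((N #> L v) \<otimes>\<^bsub>G Mod N\<^esub> (N #> Z v))"
        using swap[OF _ _ uv] uv p.hom_closed L.hom_closed L.hom_mult p.hom_mult by presburger
    qed
    show "u \<in> generate ?F (free_gen {..<m} ` {..<m})" using that free_group_generated by blast
    fix s assume "s \<in> free_gen {..<m} ` {..<m}"
    then obtain i where i: "i < m" "s = free_gen {..<m} i" by auto
    then have "L' s = L s \<otimes> Z s"
      using y y' z by (simp add: L'_def L_def Z_def free_group_lift_gen z_def Pi_iff)
    then show "N #> L' s = (N #> L s) \<otimes>\<^bsub>G Mod N\<^esub> (N #> Z s)"
      using i by (simp only: p.hom_mult L.hom_closed Z.hom_closed free_gen_closed lessThan_iff)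
  qed
  let ?pr = "word_val ?F (case_sum (\<lambda>_. \<one>\<^bsub>?F\<^esub>) (\<lambda>u. u))"
  have wl: "w \<in> lists (carrier G <+> carrier ?F)" and wd: "?pr w \<in> derived ?F (carrier ?F)"
    using w by (simp_all add: acyclic_word_def)
  have pr: "?pr v \<in> carrier ?F" if "v \<in> lists (carrier G <+> carrier ?F)" for v
    by (rule F.word_val_closed[OF _ that]) auto
  have "N #> word_subst G y' v = (N #> word_subst G y v) \<otimes>\<^bsub>G Mod N\<^esub> (N #> Z (?pr v))"
    if "v \<in> lists (carrier G <+> carrier ?F)" for v
    using that
  proof (induction v)
    case Nil
    show ?case using p.H.l_one[OF p.H.one_closed] by (simp add: word_subst_def)
  next
    case (Cons a v)
    have v: "word_subst G y v \<in> carrier G" "word_subst G y' v \<in> carrier G"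
      using word_subst_closed[OF y Cons.hyps(2)] word_subst_closed[OF y' Cons.hyps(2)] .
    show ?case
    proof (cases a)
      case (Inl g)
      then have g: "g \<in> carrier G" using Cons.hyps by auto
      have 1: "word_subst G t (a # v) = g \<otimes> word_subst G t v" for t
        by (simp add: word_subst_def Inl)
      have 2: "?pr (a # v) = ?pr v" using pr[OF Cons.hyps(2)] by (simp add: Inl)
      have "N #> (g \<otimes> word_subst G y' v) = (N #> g) \<otimes>\<^bsub>G Mod N\<^esub> (N #> word_subst G y' v)"
        by (rule p.hom_mult[OF g v(2)])
      also have "\<dots> = (N #> g) \<otimes>\<^bsub>G Mod N\<^esub> (N #> word_subst G y v) \<otimes>\<^bsub>G Mod N\<^esub> (N #> Z (?pr v))"
        by (simp only: Cons.IH p.H.m_assoc[OF p.hom_closed[OF g] p.hom_closed[OF v(1)]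
          p.hom_closed[OF Z.hom_closed[OF pr[OF Cons.hyps(2)]]]])
      also have "\<dots> = (N #> (g \<otimes> word_subst G y v)) \<otimes>\<^bsub>G Mod N\<^esub> (N #> Z (?pr v))"
        by (simp only: p.hom_mult[OF g v(1)])
      finally show ?thesis unfolding 1 2 .
    next
      case (Inr u)
      then have u: "u \<in> carrier ?F" using Cons.hyps by auto
      have 1: "word_subst G y (a # v) = L u \<otimes> word_subst G y v"
        "word_subst G y' (a # v) = L' u \<otimes> word_subst G y' v"
        by (simp_all add: word_subst_def Inr L_def L'_def)
      have 2: "?pr (a # v) = u \<otimes>\<^bsub>?F\<^esub> ?pr v" by (simp add: Inr)
      have "N #> (L' u \<otimes> word_subst G y' v) = (N #> L' u) \<otimes>\<^bsub>G Mod N\<^esub> (N #> word_subst G y' v)"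
        by (rule p.hom_mult[OF L'.hom_closed[OF u] v(2)])
      also have "\<dots> = (N #> L u) \<otimes>\<^bsub>G Mod N\<^esub> (N #> Z u) \<otimes>\<^bsub>G Mod N\<^esub>
          ((N #> word_subst G y v) \<otimes>\<^bsub>G Mod N\<^esub> (N #> Z (?pr v)))"
        by (simp only: L'[OF u] Cons.IH)
      also have "\<dots> = (N #> L u) \<otimes>\<^bsub>G Mod N\<^esub> (N #> word_subst G y v) \<otimes>\<^bsub>G Mod N\<^esub> (N #> Z (u \<otimes>\<^bsub>?F\<^esub> ?pr v))"
        by (rule swap[OF p.hom_closed[OF L.hom_closed[OF u]] p.hom_closed[OF v(1)] u pr[OF Cons.hyps(2)]])
      also have "\<dots> = (N #> (L u \<otimes> word_subst G y v)) \<otimes>\<^bsub>G Mod N\<^esub> (N #> Z (u \<otimes>\<^bsub>?F\<^esub> ?pr v))"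
        by (simp only: p.hom_mult[OF L.hom_closed[OF u] v(1)])
      finally show ?thesis unfolding 1 2 .
    qed
  qed
  note 1 = this[OF wl]
  have 2: "N #> Z (?pr w) = \<one>\<^bsub>G Mod N\<^esub>"
    using Zder[OF wd] rcos_eq_self_iff[OF N Z.hom_closed[OF pr[OF wl]]] by (simp only: one_FactGroup)
  have "N #> word_subst G y' w = (N #> word_subst G y w) \<otimes>\<^bsub>G Mod N\<^esub> \<one>\<^bsub>G Mod N\<^esub>"
    using 1 unfolding 2 .
  then show ?thesis
    using p.H.r_one[OF p.hom_closed[OF word_subst_closed[OF y wl]]] by (simp add: N_def)
qed

text \<open>Let \<open>T\<close> be substitution into the right-hand sides. Any two tuples agree
  modulo \<Gamma>^1, which is no condition, and each application of \<open>T\<close> gains one step;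
  as \<Gamma>^c is trivial, \<open>T ^^ (c - 1)\<close> is constant. A map with a constant iterate
  has exactly one fixed point.\<close>

theorem nilpotent_acyclically_closed:
  assumes c: "0 < c" and nil: "lower_central G c = {\<one>}"
  shows "acyclically_closed G"
  unfolding acyclically_closed_iff_words
proof (intro conjI allI impI is_group)
  fix m w assume w: "\<forall>i<m. acyclic_word G m (w i)"
  define T where "T y = restrict (\<lambda>i. word_subst G y (w i)) {..<m}" for y
  have wl: "w i \<in> lists (carrier G <+> carrier (free_group {..<m}))" if "i < m" for i
    using w that by (simp add: acyclic_word_def)
  have T: "T y \<in> {..<m} \<rightarrow>\<^sub>E carrier G" if "y \<in> {..<m} \<rightarrow>\<^sub>E carrier G" for y
    using word_subst_closed[OF _ wl] that by (auto simp: T_def PiE_def)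
  have Tn: "(T ^^ k) y \<in> {..<m} \<rightarrow>\<^sub>E carrier G" if "y \<in> {..<m} \<rightarrow>\<^sub>E carrier G" for k y
    using that T by (induction k) auto
  have contr: "lower_central G (Suc k) #> (T ^^ k) y i = lower_central G (Suc k) #> (T ^^ k) y' i"
    if "y \<in> {..<m} \<rightarrow>\<^sub>E carrier G" "y' \<in> {..<m} \<rightarrow>\<^sub>E carrier G" "i < m" for k y y' i
    using that(3)
  proof (induction k arbitrary: i)
    case 0
    then show ?case
      using rcos_eq_iff[OF lower_central_normal, of "y i" "y' i" "Suc 0"] that(1,2) by (simp add: PiE_iff)
  next
    case (Suc k)
    have "lower_central G (Suc (Suc k)) #> word_subst G ((T ^^ k) y) (w i)
        = lower_central G (Suc (Suc k)) #> word_subst G ((T ^^ k) y') (w i)"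
      using Tn[OF that(1), of k] Tn[OF that(2), of k] Suc.IH Suc.prems w
      by (intro word_subst_contracts[of _ m]) (auto simp: PiE_def)
    moreover have "T v i = word_subst G v (w i)" for v using Suc.prems by (simp add: T_def)
    ultimately show ?case by simp
  qed
  have const: "(T ^^ (c - 1)) y = (T ^^ (c - 1)) y'"
    if y: "y \<in> {..<m} \<rightarrow>\<^sub>E carrier G" "y' \<in> {..<m} \<rightarrow>\<^sub>E carrier G" for y y'
  proof (rule PiE_ext[OF Tn[OF y(1)] Tn[OF y(2)]])
    fix i assume i: "i \<in> {..<m}"
    let ?a = "(T ^^ (c - 1)) y i" and ?b = "(T ^^ (c - 1)) y' i"
    have cl: "?a \<in> carrier G" "?b \<in> carrier G"
      using Tn[OF y(1)] Tn[OF y(2)] i by (auto simp: PiE_iff)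
    have "{\<one>} #> ?a = {\<one>} #> ?b"
      using contr[OF y, of i "c - 1"] i c nil by simp
    then show "?a = ?b" using cl by (simp add: r_coset_def)
  qed
  have iff: "y \<in> {..<m} \<rightarrow>\<^sub>E carrier G \<and> (\<forall>i<m. y i = word_subst G y (w i)) \<longleftrightarrow>
      y \<in> {..<m} \<rightarrow>\<^sub>E carrier G \<and> T y = y" for y
    by (auto simp: T_def fun_eq_iff PiE_iff extensional_def)
  let ?e = "restrict (\<lambda>_. \<one>) {..<m}"
  have e: "?e \<in> {..<m} \<rightarrow>\<^sub>E carrier G" by simp
  show "\<exists>!y. y \<in> {..<m} \<rightarrow>\<^sub>E carrier G \<and> (\<forall>i<m. y i = word_subst G y (w i))"
    unfolding iff
  proof
    have "T ((T ^^ (c - 1)) ?e) = (T ^^ (c - 1)) (T ?e)" by (simp add: funpow_swap1)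
    also have "\<dots> = (T ^^ (c - 1)) ?e" by (rule const[OF T[OF e] e])
    finally show "(T ^^ (c - 1)) ?e \<in> {..<m} \<rightarrow>\<^sub>E carrier G \<and> T ((T ^^ (c - 1)) ?e) = (T ^^ (c - 1)) ?e"
      using Tn[OF e] by blast
    fix y assume y: "y \<in> {..<m} \<rightarrow>\<^sub>E carrier G \<and> T y = y"
    have "(T ^^ k) y = y" for k using y by (induction k) auto
    then show "y = (T ^^ (c - 1)) ?e" using const[of y ?e] y e by simp
  qed
qed

lemma lower_central_quotient_trivial:
  "lower_central (G Mod lower_central G k) k = {\<one>\<^bsub>G Mod lower_central G k\<^esub>}"
proof -
  let ?N = "lower_central G k"
  interpret p: group_hom G "G Mod ?N" "\<lambda>a. ?N #> a"
    by (rule normal_group_hom_Mod[OF lower_central_normal])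
  have "lower_central (G Mod ?N) k = (\<lambda>a. ?N #> a) ` ?N"
    by (rule p.lower_central_surj) (simp add: carrier_FactGroup)
  also have "\<dots> = {?N}"
    using rcos_eq_self_iff[OF lower_central_normal] lower_central_closed
      subgroup.one_closed[OF lower_central_subgroup[of k]] by (auto simp: image_iff)
  finally show ?thesis by simp
qed

lemma acyclically_closed_lower_central_quotient:
  "0 < k \<Longrightarrow> acyclically_closed (G Mod lower_central G k)"
  using group.nilpotent_acyclically_closed[OF normal.factorgroup_is_group[OF lower_central_normal] _
    lower_central_quotient_trivial] .

end

subsection \<open>The acyclic closure of a free group\<close>

lemma acyclically_closed_copy:
  fixes B :: "('b, 'm) monoid_scheme" and e :: "'b \<Rightarrow> 'c"
  assumes B: "acyclically_closed B" and e: "inj_on e (carrier B)"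
  obtains B' :: "'c monoid" where "acyclically_closed B'" "e \<in> iso B B'"
proof -
  interpret B: group B using B by (simp add: acyclically_closed_def)
  let ?i = "inv_into (carrier B) e"
  define B' where "B' = \<lparr>carrier = e ` carrier B, monoid.mult = (\<lambda>a b. e (?i a \<otimes>\<^bsub>B\<^esub> ?i b)), one = e \<one>\<^bsub>B\<^esub>\<rparr>"
  have iso: "e \<in> iso B B'"
    using e by (auto simp: iso_def hom_def B'_def bij_betw_def)
  have g: "group B'"
    using B.iso_imp_img_group[OF iso] by (simp add: B'_def)
  have "acyclically_closed B'"
    by (rule acyclically_closed_iso[OF B.iso_set_sym[OF iso] g B])
  with iso show thesis using that by blast
qed

text \<open>The injection \<open>e\<close> copies \<open>B\<close> into the type over which the
  universal property quantifies; the extension found there is pulled back along the inverse of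
  \<open>e\<close>.\<close>

lemma acyclic_closure_extend:
  fixes G :: "'g monoid" and A :: "'a monoid" and B :: "('b, 'm) monoid_scheme" and e :: "'b \<Rightarrow> 'g + 'a + nat"
  assumes A: "acyclic_closure G A \<iota>" and B: "acyclically_closed B" and e: "inj_on e (carrier B)"
    and f: "f \<in> hom G B"
  obtains f' where "f' \<in> hom A B" "\<And>g. g \<in> carrier G \<Longrightarrow> f' (\<iota> g) = f g"
proof -
  interpret B: group B using B by (simp add: acyclically_closed_def)
  obtain B' :: "('g + 'a + nat) monoid" where B': "acyclically_closed B'" and iso: "e \<in> iso B B'"
    by (rule acyclically_closed_copy[OF B e])
  have "e \<circ> f \<in> hom G B'" using f iso by (auto simp: iso_def intro: Group.hom_compose)
  then obtain f0 where f0: "f0 \<in> hom A B'" "\<forall>g\<in>carrier G. f0 (\<iota> g) = (e \<circ> f) g"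
    using A B' unfolding acyclic_closure_def by blast
  let ?i = "inv_into (carrier B) e"
  have "?i \<in> hom B' B" using B.iso_set_sym[OF iso] by (simp add: iso_def)
  then have "?i \<circ> f0 \<in> hom A B" using f0(1) by (rule Group.hom_compose[rotated])
  moreover have "(?i \<circ> f0) (\<iota> g) = f g" if "g \<in> carrier G" for g
    using f0(2) that e f by (simp add: hom_in_carrier)
  ultimately show thesis using that by blast
qed

lemma acyclic_closure_hom_eq:
  fixes G :: "'g monoid" and A :: "'a monoid" and B :: "('b, 'm) monoid_scheme" and e :: "'b \<Rightarrow> 'g + 'a + nat"
  assumes A: "acyclic_closure G A \<iota>" and B: "acyclically_closed B" and e: "inj_on e (carrier B)"
    and f: "f1 \<in> hom A B" "f2 \<in> hom A B" and eq: "\<And>g. g \<in> carrier G \<Longrightarrow> f1 (\<iota> g) = f2 (\<iota> g)"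
    and a: "a \<in> carrier A"
  shows "f1 a = f2 a"
proof -
  obtain B' :: "('g + 'a + nat) monoid" where B': "acyclically_closed B'" and iso: "e \<in> iso B B'"
    by (rule acyclically_closed_copy[OF B e])
  have eh: "e \<in> hom B B'" using iso by (simp add: iso_def)
  have gA: "group A" and \<iota>: "\<iota> \<in> hom G A"
    using A by (simp_all add: acyclic_closure_def acyclically_closed_def)
  then have mA: "x \<otimes>\<^bsub>A\<^esub> y \<in> carrier A" if "x \<in> carrier A" "y \<in> carrier A" for x y
    using that group.is_monoid monoid.m_closed by metis
  \<comment> \<open>Uniqueness in \<open>acyclic_closure\<close> is among extensional functions, so
    the two maps are compared after restriction to the carrier.\<close>
  define r where "r f = restrict (e \<circ> f) (carrier A)" for f
  have r: "r f \<in> hom A B' \<and> r f \<in> extensional (carrier A)" if "f \<in> hom A B" for f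
    using Group.hom_compose[OF that eh] mA by (auto simp: r_def hom_def Pi_iff)
  have "\<forall>f\<in>hom G B'. \<exists>!f'. f' \<in> hom A B' \<and> f' \<in> extensional (carrier A) \<and> (\<forall>g\<in>carrier G. f' (\<iota> g) = f g)"
    using A B' unfolding acyclic_closure_def by blast
  then have "\<exists>!f'. f' \<in> hom A B' \<and> f' \<in> extensional (carrier A) \<and> (\<forall>g\<in>carrier G. f' (\<iota> g) = (e \<circ> f1 \<circ> \<iota>) g)"
    by (rule bspec) (rule Group.hom_compose[OF \<iota> Group.hom_compose[OF f(1) eh]])
  moreover have "\<forall>g\<in>carrier G. r f1 (\<iota> g) = (e \<circ> f1 \<circ> \<iota>) g" "\<forall>g\<in>carrier G. r f2 (\<iota> g) = (e \<circ> f1 \<circ> \<iota>) g"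
    using hom_in_carrier[OF \<iota>] eq by (simp_all add: r_def)
  ultimately have "r f1 = r f2" using r f by blast
  then have "e (f1 a) = e (f2 a)" using a by (metis r_def comp_apply restrict_apply')
  then show ?thesis using e f a by (meson hom_in_carrier inj_onD)
qed

text \<open>A quotient has sets as elements and does not live on the test type. Choosing an element
  of each coset embeds it into the type of \<open>G\<close>, and from there into the sum
  type.\<close>

lemma (in group) inj_on_coset_representative:
  assumes "subgroup N G"
  shows "inj_on (\<lambda>C. SOME g. g \<in> C) (carrier (G Mod N))"
proof (rule inj_onI)
  fix C D assume CD: "C \<in> carrier (G Mod N)" "D \<in> carrier (G Mod N)" "(SOME g. g \<in> C) = (SOME g. g \<in> D)"
  have ex: "(SOME g. g \<in> E) \<in> E" if E: "E \<in> carrier (G Mod N)" for E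
  proof -
    obtain c where "c \<in> carrier G" "E = N #> c" using E by (auto simp: carrier_FactGroup)
    then have "c \<in> E" using rcos_self[OF _ assms] by simp
    then show ?thesis by (rule someI)
  qed
  obtain c d where "c \<in> carrier G" "C = N #> c" "d \<in> carrier G" "D = N #> d"
    using CD by (auto simp: carrier_FactGroup)
  then show "C = D" using ex[OF CD(1)] ex[OF CD(2)] CD(3) repr_independence[OF _ _ assms] by metis
qed

section \<open>A free group with a fixed basis and its acyclic closure\<close>

locale free_acyclic_closure =
  fixes n :: nat and F :: "'f monoid" and x :: "nat \<Rightarrow> 'f" and A :: "'a monoid" and \<iota> :: "'f \<Rightarrow> 'a"
  assumes basis: "free_basis F {..<n} x" and closure: "acyclic_closure F A \<iota>"
begin

lemma AC: "acyclically_closed A"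
  using closure by (simp add: acyclic_closure_def)

sublocale F: group F
  using basis by (simp add: free_basis_def)

sublocale A: group A
  using AC by (simp add: acyclically_closed_def)

sublocale \<iota>: group_hom F A \<iota>
  using closure by unfold_locales (simp add: acyclic_closure_def)

lemma x_closed [simp]: "i < n \<Longrightarrow> x i \<in> carrier F"
  using basis by (auto simp: free_basis_def)

text \<open>The projection of \<open>F\<close> onto its nilpotent quotient extends to \<open>A\<close>, since that quotient is
  acyclically closed. This gives a left inverse of the map induced by \<open>\<iota>\<close>; it is also a right
  inverse, because two homomorphisms from \<open>A\<close> to the nilpotent quotient of \<open>A\<close> that agree on
  \<open>F\<close> are equal.\<close>

lemma closure_nil_quot:
  assumes k: "0 < k"
  obtains q where "q \<in> hom A (F Mod lower_central F k)"
    "\<And>g. g \<in> carrier F \<Longrightarrow> q (\<iota> g) = lower_central F k #>\<^bsub>F\<^esub> g"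
proof (rule acyclic_closure_extend[OF closure F.acyclically_closed_lower_central_quotient[OF k], of "\<lambda>C. Inl (SOME g. g \<in> C)"])
  show "inj_on (\<lambda>C. Inl (SOME g. g \<in> C) :: 'f + 'a + nat) (carrier (F Mod lower_central F k))"
    using F.inj_on_coset_representative[OF F.lower_central_subgroup] by (auto simp: inj_on_def)
  show "(\<lambda>g. lower_central F k #>\<^bsub>F\<^esub> g) \<in> hom F (F Mod lower_central F k)"
    by (rule normal.r_coset_hom_Mod[OF F.lower_central_normal])
qed (rule that)

lemma \<iota>_lower_central_iff:
  assumes k: "0 < k" and g: "g \<in> carrier F"
  shows "\<iota> g \<in> lower_central A k \<longleftrightarrow> g \<in> lower_central F k"
proof
  assume l: "\<iota> g \<in> lower_central A k"
  obtain q where q: "q \<in> hom A (F Mod lower_central F k)"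
    "\<And>g. g \<in> carrier F \<Longrightarrow> q (\<iota> g) = lower_central F k #>\<^bsub>F\<^esub> g"
    using closure_nil_quot[OF k] by blast
  interpret q: group_hom A "F Mod lower_central F k" q
    using q(1) normal.factorgroup_is_group[OF F.lower_central_normal]
    by (simp add: group_hom_def group_hom_axioms_def)
  \<comment> \<open>Homomorphisms respect the series, and the k-th term of the quotient
    \<open>F Mod lower_central F k\<close> is trivial.\<close>
  have "lower_central F k #>\<^bsub>F\<^esub> g = lower_central F k"
    using q.lower_central_hom[OF l] q(2)[OF g] F.lower_central_quotient_trivial by simp
  then show "g \<in> lower_central F k"
    using F.rcos_eq_self_iff[OF F.lower_central_normal g] by simp
qed (rule \<iota>.lower_central_hom)

lemma \<iota>_surj_mod:
  assumes k: "0 < k" and a: "a \<in> carrier A"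
  obtains g where "g \<in> carrier F" "lower_central A k #>\<^bsub>A\<^esub> a = lower_central A k #>\<^bsub>A\<^esub> \<iota> g"
proof -
  let ?N = "lower_central A k" and ?M = "lower_central F k"
  obtain q where q: "q \<in> hom A (F Mod ?M)" "\<And>g. g \<in> carrier F \<Longrightarrow> q (\<iota> g) = ?M #>\<^bsub>F\<^esub> g"
    using closure_nil_quot[OF k] by blast
  have pA: "(\<lambda>a. ?N #>\<^bsub>A\<^esub> a) \<in> hom A (A Mod ?N)"
    by (rule normal.r_coset_hom_Mod[OF A.lower_central_normal])
  have "(\<lambda>g. ?N #>\<^bsub>A\<^esub> \<iota> g) \<in> hom F (A Mod ?N)"
    using Group.hom_compose[OF \<iota>.homh pA] by (simp add: o_def)
  then have "\<exists>s. s \<in> hom (F Mod ?M) (A Mod ?N) \<and> (\<forall>g\<in>carrier F. s (?M #>\<^bsub>F\<^esub> g) = ?N #>\<^bsub>A\<^esub> \<iota> g)"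
  proof (rule FactGroup_universal[OF _ F.lower_central_normal[of k]])
    fix g h assume gh: "g \<in> carrier F" "h \<in> carrier F" "?M #>\<^bsub>F\<^esub> g = ?M #>\<^bsub>F\<^esub> h"
    then have "\<iota> (g \<otimes>\<^bsub>F\<^esub> inv\<^bsub>F\<^esub> h) \<in> ?N"
      using F.rcos_eq_iff[OF F.lower_central_normal] \<iota>.lower_central_hom by blast
    then show "?N #>\<^bsub>A\<^esub> \<iota> g = ?N #>\<^bsub>A\<^esub> \<iota> h"
      using A.rcos_eq_iff[OF A.lower_central_normal] gh by simp
  qed blast
  then obtain s where s: "s \<in> hom (F Mod ?M) (A Mod ?N)" "\<And>g. g \<in> carrier F \<Longrightarrow> s (?M #>\<^bsub>F\<^esub> g) = ?N #>\<^bsub>A\<^esub> \<iota> g"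
    by blast
  have "(s \<circ> q) a = ?N #>\<^bsub>A\<^esub> a"
  proof (rule acyclic_closure_hom_eq[OF closure A.acyclically_closed_lower_central_quotient[OF k], of "\<lambda>C. Inr (Inl (SOME g. g \<in> C))"])
    show "inj_on (\<lambda>C. Inr (Inl (SOME g. g \<in> C)) :: 'f + 'a + nat) (carrier (A Mod ?N))"
      using A.inj_on_coset_representative[OF A.lower_central_subgroup] by (auto simp: inj_on_def)
    show "s \<circ> q \<in> hom A (A Mod ?N)" by (rule Group.hom_compose[OF q(1) s(1)])
  qed (use pA a q(2) s(2) in auto)
  moreover have "q a \<in> carrier (F Mod ?M)" using hom_in_carrier[OF q(1) a] .
  then obtain g where "g \<in> carrier F" "q a = ?M #>\<^bsub>F\<^esub> g" by (auto simp: carrier_FactGroup)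
  ultimately show thesis using that s(2) by auto
qed

lemma endo_extend:
  assumes "f \<in> hom F A"
  obtains f' where "f' \<in> hom A A" "\<And>g. g \<in> carrier F \<Longrightarrow> f' (\<iota> g) = f g"
  by (rule acyclic_closure_extend[OF closure AC _ assms, of "\<lambda>a. Inr (Inl a)"]) (auto simp: that inj_on_def)

lemma endo_eq:
  assumes "f1 \<in> hom A A" "f2 \<in> hom A A" "\<And>i. i < n \<Longrightarrow> f1 (\<iota> (x i)) = f2 (\<iota> (x i))" "a \<in> carrier A"
  shows "f1 a = f2 a"
proof (rule acyclic_closure_hom_eq[OF closure AC _ assms(1,2) _ assms(4), of "\<lambda>a. Inr (Inl a)"])
  fix g assume g: "g \<in> carrier F"
  have "(f1 \<circ> \<iota>) g = (f2 \<circ> \<iota>) g"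
    by (rule free_basis_hom_eq[OF basis A.is_group Group.hom_compose[OF \<iota>.homh assms(1)]
        Group.hom_compose[OF \<iota>.homh assms(2)] _ g]) (simp add: assms(3))
  then show "f1 (\<iota> g) = f2 (\<iota> g)" by simp
qed (simp add: inj_on_def)

text \<open>If \<open>f\<close> sends the basis to a tuple y, then \<open>f (u i)\<close> is the
  word \<open>u i\<close> evaluated at y. Such homomorphisms are therefore the solutions of the
  system y_i = u_i(y) c_i, which is acyclic because the free part of its right-hand side lies in the
  derived subgroup.\<close>

lemma acyclic_system:
  assumes u: "\<And>i. i < n \<Longrightarrow> u i \<in> lower_central F 2" and c: "\<And>i. i < n \<Longrightarrow> c i \<in> carrier A"
  shows acyclic_system_ex: "\<exists>f\<in>hom F A. \<forall>i<n. f (x i) = f (u i) \<otimes>\<^bsub>A\<^esub> c i"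
    and acyclic_system_unique: "f \<in> hom F A \<Longrightarrow> g \<in> hom F A \<Longrightarrow> (\<And>i. i < n \<Longrightarrow> f (x i) = f (u i) \<otimes>\<^bsub>A\<^esub> c i) \<Longrightarrow>
      (\<And>i. i < n \<Longrightarrow> g (x i) = g (u i) \<otimes>\<^bsub>A\<^esub> c i) \<Longrightarrow> i < n \<Longrightarrow> f (x i) = g (x i)"
proof -
  let ?FG = "free_group {..<n}" and ?t = "free_group_lift F x"
  let ?i = "inv_into (carrier ?FG) ?t"
  note b = free_basisD[OF basis]
  interpret FG: group ?FG by (rule group_free_group)
  interpret t: group_hom F ?FG ?i
    using FG.iso_set_sym[OF b(3)] by unfold_locales (simp add: iso_def)
  define v where "v i = ?i (u i)" for i
  have uF: "u i \<in> carrier F" if "i < n" for i using u[OF that] F.lower_central_closed by blast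
  have v: "v i \<in> carrier ?FG" "?t (v i) = u i" "v i \<in> derived ?FG (carrier ?FG)" if "i < n" for i
    using t.hom_closed[OF uF[OF that]] t.lower_central_hom[OF u[OF that]] uF[OF that] b(3) FG.lower_central_2
    by (auto simp: v_def iso_def bij_betw_def f_inv_into_f)
  define w where "w i = [Inr (v i), Inl (c i)]" for i
  have w: "\<forall>i<n. acyclic_word A n (w i)"
    using v c by (auto simp: acyclic_word_def w_def)
  have ws: "word_subst A y (w i) = free_group_lift A y (v i) \<otimes>\<^bsub>A\<^esub> c i" if "i < n" for y i
    using c[OF that] by (simp add: word_subst_def w_def)
  have ex1: "\<exists>!y. y \<in> {..<n} \<rightarrow>\<^sub>E carrier A \<and> (\<forall>i<n. y i = word_subst A y (w i))"
    by (rule AC[unfolded acyclically_closed_iff_words, THEN conjunct2, THEN spec, THEN spec, THEN mp, OF w])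
  show "\<exists>f\<in>hom F A. \<forall>i<n. f (x i) = f (u i) \<otimes>\<^bsub>A\<^esub> c i"
  proof -
    obtain y where y: "y \<in> {..<n} \<rightarrow>\<^sub>E carrier A" "\<forall>i<n. y i = word_subst A y (w i)"
      using ex1_implies_ex[OF ex1] by (elim exE conjE)
    obtain f where f: "f \<in> hom F A" "\<And>s. s \<in> {..<n} \<Longrightarrow> f (x s) = y s"
      "\<And>u. u \<in> carrier ?FG \<Longrightarrow> f (?t u) = free_group_lift A y u"
      using free_basis_hom[OF basis A.is_group, of y] y(1) by (auto simp: PiE_def)
    have "f (x i) = f (u i) \<otimes>\<^bsub>A\<^esub> c i" if "i < n" for i
      using y(2)[rule_format, OF that] ws[OF that, of y] f(2)[of i] f(3)[OF v(1)[OF that]] v(2)[OF that] that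
      by (metis lessThan_iff)
    with f(1) show ?thesis by blast
  qed
  have sol: "restrict (f \<circ> x) {..<n} \<in> {..<n} \<rightarrow>\<^sub>E carrier A \<and>
      (\<forall>i<n. restrict (f \<circ> x) {..<n} i = word_subst A (restrict (f \<circ> x) {..<n}) (w i))"
    if f: "f \<in> hom F A" and sys: "\<And>i. i < n \<Longrightarrow> f (x i) = f (u i) \<otimes>\<^bsub>A\<^esub> c i" for f
  proof -
    interpret f: group_hom F A f using f by unfold_locales
    let ?y = "restrict (f \<circ> x) {..<n}"
    have y: "?y \<in> {..<n} \<rightarrow> carrier A" using b(2) f.hom_closed by auto
    have "f (?t (v i)) = free_group_lift A ?y (v i)" if "i < n" for i
      by (rule f.hom_free_group_lift[OF b(2) y _ v(1)[OF that]]) simp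
    then have "?y i = word_subst A ?y (w i)" if "i < n" for i
      using sys[OF that] ws[OF that, of ?y] v(2)[OF that] that by (metis comp_apply lessThan_iff restrict_apply')
    moreover have "?y \<in> {..<n} \<rightarrow>\<^sub>E carrier A" using y by simp
    ultimately show ?thesis by blast
  qed
  show "f (x i) = g (x i)" if "f \<in> hom F A" "g \<in> hom F A" "\<And>i. i < n \<Longrightarrow> f (x i) = f (u i) \<otimes>\<^bsub>A\<^esub> c i"
    "\<And>i. i < n \<Longrightarrow> g (x i) = g (u i) \<otimes>\<^bsub>A\<^esub> c i" "i < n"
  proof -
    have "restrict (f \<circ> x) {..<n} = restrict (g \<circ> x) {..<n}"
      by (rule ex1E[OF ex1]) (metis sol[OF that(1,3)] sol[OF that(2,4)])
    then show ?thesis using \<open>i < n\<close> by (metis comp_apply lessThan_iff restrict_apply')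
  qed
qed

text \<open>The inverse of the extension of \<open>x\<^sub>i \<mapsto> u\<^sub>i x\<^sub>i\<close> is found by solving the acyclic system
  \<open>y\<^sub>i = u\<^sub>i(y)\<^sup>-\<^sup>1 x\<^sub>i\<close>.\<close>

lemma automorphism_ex:
  assumes u: "\<And>i. i < n \<Longrightarrow> u i \<in> lower_central F 2"
  obtains \<phi> where "\<phi> \<in> auto A" "\<And>i. i < n \<Longrightarrow> \<phi> (\<iota> (x i)) = \<iota> (u i \<otimes>\<^bsub>F\<^esub> x i)"
proof -
  have uF [simp]: "u i \<in> carrier F" if "i < n" for i using u[OF that] F.lower_central_closed by blast
  have "(\<lambda>i. u i \<otimes>\<^bsub>F\<^esub> x i) \<in> {..<n} \<rightarrow> carrier F" by auto
  then obtain \<psi> where \<psi>: "\<psi> \<in> hom F F" "\<And>i. i < n \<Longrightarrow> \<psi> (x i) = u i \<otimes>\<^bsub>F\<^esub> x i"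
    using free_basis_hom[OF basis F.is_group, of "\<lambda>i. u i \<otimes>\<^bsub>F\<^esub> x i"] by (metis lessThan_iff)
  obtain \<phi> where \<phi>: "\<phi> \<in> hom A A" "\<And>g. g \<in> carrier F \<Longrightarrow> \<phi> (\<iota> g) = (\<iota> \<circ> \<psi>) g"
    using endo_extend[OF Group.hom_compose[OF \<psi>(1) \<iota>.homh]] by blast
  have iu: "inv\<^bsub>F\<^esub> u i \<in> lower_central F 2" if "i < n" for i
    using subgroup.m_inv_closed[OF F.lower_central_subgroup u[OF that]] .
  obtain g where g: "g \<in> hom F A" "\<forall>i<n. g (x i) = g (inv\<^bsub>F\<^esub> u i) \<otimes>\<^bsub>A\<^esub> \<iota> (x i)"
    using acyclic_system_ex[of "\<lambda>i. inv\<^bsub>F\<^esub> u i" "\<lambda>i. \<iota> (x i)"] iu by auto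
  interpret g: group_hom F A g using g(1) by unfold_locales
  interpret \<phi>: group_hom A A \<phi> using \<phi>(1) by unfold_locales
  obtain \<gamma> where \<gamma>: "\<gamma> \<in> hom A A" "\<And>f. f \<in> carrier F \<Longrightarrow> \<gamma> (\<iota> f) = g f"
    using endo_extend[OF g(1)] by blast
  have id: "(\<lambda>a. a) \<in> hom A A" by (simp add: hom_def)
  have \<gamma>\<phi>: "\<gamma> (\<phi> a) = a" if "a \<in> carrier A" for a
  proof -
    have "(\<gamma> \<circ> \<phi>) a = a"
    proof (rule endo_eq[OF Group.hom_compose[OF \<phi>(1) \<gamma>(1)] id _ that])
      fix i assume i: "i < n"
      have "g (u i \<otimes>\<^bsub>F\<^esub> x i) = g (u i) \<otimes>\<^bsub>A\<^esub> (inv\<^bsub>A\<^esub> g (u i) \<otimes>\<^bsub>A\<^esub> \<iota> (x i))"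
        using i g(2) by simp
      also have "\<dots> = \<iota> (x i)"
        using i by (intro A.inv_cancel_left) simp_all
      finally show "(\<gamma> \<circ> \<phi>) (\<iota> (x i)) = \<iota> (x i)"
        using i \<gamma>(2)[of "u i \<otimes>\<^bsub>F\<^esub> x i"] by (simp add: \<phi>(2) \<psi>(2))
    qed
    then show ?thesis by simp
  qed
  have \<phi>\<gamma>: "\<phi> (\<gamma> a) = a" if "a \<in> carrier A" for a
  proof -
    have "(\<phi> \<circ> \<gamma>) a = a"
    proof (rule endo_eq[OF Group.hom_compose[OF \<gamma>(1) \<phi>(1)] id _ that])
      fix i assume i: "i < n"
      \<comment> \<open>Both \<open>\<phi> \<circ> g\<close> and \<iota> solve the system with free
        parts \<open>u i\<close> inverted and constants \<open>\<iota> (u i \<otimes> x i)\<close>,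
        so the uniqueness half of acyclic closedness identifies them.\<close>
      have "(\<phi> \<circ> g) (x i) = \<iota> (x i)"
      proof (rule acyclic_system_unique[of "\<lambda>i. inv\<^bsub>F\<^esub> u i" "\<lambda>i. \<iota> (u i \<otimes>\<^bsub>F\<^esub> x i)", OF _ _ _ \<iota>.homh _ _ i])
        show "\<phi> \<circ> g \<in> hom F A" by (rule Group.hom_compose[OF g(1) \<phi>(1)])
        show "(\<phi> \<circ> g) (x i) = (\<phi> \<circ> g) (inv\<^bsub>F\<^esub> u i) \<otimes>\<^bsub>A\<^esub> \<iota> (u i \<otimes>\<^bsub>F\<^esub> x i)" if "i < n" for i
          using that g(2)[rule_format, OF that] \<phi>.hom_mult[of "g (inv\<^bsub>F\<^esub> u i)" "\<iota> (x i)"]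
          by (simp add: \<phi>(2) \<psi>(2))
        show "\<iota> (x i) = \<iota> (inv\<^bsub>F\<^esub> u i) \<otimes>\<^bsub>A\<^esub> \<iota> (u i \<otimes>\<^bsub>F\<^esub> x i)" if "i < n" for i
          using that by simp
      qed (use iu in auto)
      then show "(\<phi> \<circ> \<gamma>) (\<iota> (x i)) = \<iota> (x i)"
        using i by (simp add: \<gamma>(2))
    qed
    then show ?thesis by simp
  qed
  have "bij_betw \<phi> (carrier A) (carrier A)"
    by (rule bij_betw_byWitness[of _ \<gamma>]) (use \<gamma>\<phi> \<phi>\<gamma> hom_in_carrier[OF \<gamma>(1)] in auto)
  \<comment> \<open>\<open>auto A\<close> consists of extensional maps, hence the
    restriction.\<close>
  then have "restrict \<phi> (carrier A) \<in> auto A"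
    using \<phi>(1) by (auto simp: auto_def Bij_def hom_def bij_betw_restrict_eq Pi_iff)
  moreover have "restrict \<phi> (carrier A) (\<iota> (x i)) = \<iota> (u i \<otimes>\<^bsub>F\<^esub> x i)" if "i < n" for i
    using that \<phi>(2) \<psi>(2) by simp
  ultimately show thesis using that by blast
qed

end

subsection \<open>Noncommutative power series\<close>

text \<open>A type of its own lets the ring laws come from a class instance. Words range over all
  natural numbers, so that the type does not depend on the rank.\<close>

typedef series = "UNIV :: (nat list \<Rightarrow> int) set"
  morphisms coeff Series by simp

lemmas coeff_Series [simp] = Series_inverse[OF UNIV_I]

lemma series_eqI: "(\<And>w. coeff f w = coeff g w) \<Longrightarrow> f = g"
  using coeff_inject by blast

instantiation series :: ring_1
begin

definition "0 = Series (\<lambda>_. 0)"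
definition "1 = Series (\<lambda>w. if w = [] then 1 else 0)"
definition "f + g = Series (\<lambda>w. coeff f w + coeff g w)"
definition "f - g = Series (\<lambda>w. coeff f w - coeff g w)"
definition "- f = Series (\<lambda>w. - coeff f w)"
definition "f * g = Series (\<lambda>w. \<Sum>i\<le>length w. coeff f (take i w) * coeff g (drop i w))"

lemma coeff_simps [simp]:
  "coeff 0 w = 0" "coeff 1 w = (if w = [] then 1 else 0)"
  "coeff (f + g) w = coeff f w + coeff g w" "coeff (f - g) w = coeff f w - coeff g w" "coeff (- f) w = - coeff f w"
  by (simp_all add: zero_series_def one_series_def plus_series_def minus_series_def uminus_series_def)

lemma coeff_mult: "coeff (f * g) w = (\<Sum>i\<le>length w. coeff f (take i w) * coeff g (drop i w))"
  by (simp add: times_series_def)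

instance
proof
  fix a b c :: series
  show "a * b * c = a * (b * c)"
  proof (rule series_eqI)
    fix w :: "nat list"
    let ?n = "length w"
    have "coeff (a * b) (take i w) = (\<Sum>j\<le>i. coeff a (take j w) * coeff b (take (i - j) (drop j w)))"
      if "i \<le> ?n" for i
      unfolding coeff_mult using that by (intro sum.cong) (auto simp: drop_take min_absorb1 min_absorb2)
    then have "coeff (a * b * c) w
      = (\<Sum>i\<le>?n. \<Sum>j\<le>i. coeff a (take j w) * coeff b (take (i - j) (drop j w)) * coeff c (drop i w))"
      by (auto simp: coeff_mult[of "a * b"] sum_distrib_right intro!: sum.cong)
    also have "\<dots> = (\<Sum>(i, j)\<in>(SIGMA i:{..?n}. {..i}).
        coeff a (take j w) * coeff b (take (i - j) (drop j w)) * coeff c (drop i w))"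
      by (subst sum.Sigma) auto
    \<comment> \<open>Both sums run over the ways of cutting \<open>w\<close> into three pieces; the
      position \<open>i\<close> of the second cut is replaced by the length \<open>k = i - j\<close>
      of the middle piece.\<close>
    also have "\<dots> = (\<Sum>(j, k)\<in>(SIGMA j:{..?n}. {..?n - j}).
        coeff a (take j w) * coeff b (take k (drop j w)) * coeff c (drop (j + k) w))"
      by (rule sum.reindex_bij_witness[where i = "\<lambda>(j, k). (j + k, j)" and j = "\<lambda>(i, j). (j, i - j)"]) auto
    also have "\<dots> = (\<Sum>j\<le>?n. \<Sum>k\<le>?n - j. coeff a (take j w) * coeff b (take k (drop j w)) * coeff c (drop (j + k) w))"
      by (subst sum.Sigma) auto
    also have "\<dots> = coeff (a * (b * c)) w"
      by (simp add: coeff_mult sum_distrib_left mult.assoc add.commute cong: sum.cong)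
    finally show "coeff (a * b * c) w = coeff (a * (b * c)) w" .
  qed
  show "1 * a = a"
  proof (rule series_eqI)
    fix w
    have "coeff (1 * a) w = (\<Sum>i\<le>length w. if i = 0 then coeff a w else 0)"
      unfolding coeff_mult by (rule sum.cong) auto
    then show "coeff (1 * a) w = coeff a w" by simp
  qed
  show "a * 1 = a"
  proof (rule series_eqI)
    fix w
    have "coeff (a * 1) w = (\<Sum>i\<le>length w. if i = length w then coeff a w else 0)"
      unfolding coeff_mult by (rule sum.cong) auto
    then show "coeff (a * 1) w = coeff a w" by simp
  qed
  show "(0::series) \<noteq> 1"
    by (metis coeff_simps(1,2) zero_neq_one)
  show "(a + b) * c = a * c + b * c"
    by (rule series_eqI) (simp add: coeff_mult algebra_simps sum.distrib)
  show "a * (b + c) = a * b + a * c"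
    by (rule series_eqI) (simp add: coeff_mult algebra_simps sum.distrib)
qed (rule series_eqI; simp)+

end

section \<open>The order of a series and the group of invertible series\<close>

definition vanishes_below :: "nat \<Rightarrow> series \<Rightarrow> bool" where
  "vanishes_below d f \<longleftrightarrow> (\<forall>w. length w < d \<longrightarrow> coeff f w = 0)"

lemma vanishes_below_0 [simp]: "vanishes_below 0 f"
  by (simp add: vanishes_below_def)

lemma vanishes_below_mono: "vanishes_below d f \<Longrightarrow> e \<le> d \<Longrightarrow> vanishes_below e f"
  by (simp add: vanishes_below_def)

lemma vanishes_below_add: "vanishes_below d f \<Longrightarrow> vanishes_below d g \<Longrightarrow> vanishes_below d (f + g)"
  by (simp add: vanishes_below_def)

lemma vanishes_below_diff: "vanishes_below d f \<Longrightarrow> vanishes_below d g \<Longrightarrow> vanishes_below d (f - g)"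
  by (simp add: vanishes_below_def)

text \<open>A cut before position \<open>p\<close> is killed by the left factor; a cut after it
  leaves fewer than \<open>q\<close> letters and is killed by the right factor. One summand
  survives.\<close>

lemma coeff_mult_leading:
  assumes "vanishes_below p f" "vanishes_below q g" "length w = p + q"
  shows "coeff (f * g) w = coeff f (take p w) * coeff g (drop p w)"
proof -
  have "coeff (f * g) w = (\<Sum>i\<le>length w. if i = p then coeff f (take p w) * coeff g (drop p w) else 0)"
    unfolding coeff_mult
  proof (rule sum.cong)
    fix i assume "i \<in> {..length w}"
    then show "coeff f (take i w) * coeff g (drop i w) = (if i = p then coeff f (take p w) * coeff g (drop p w) else 0)"
      using assms by (cases i p rule: linorder_cases) (simp_all add: vanishes_below_def)
  qed simp
  then show ?thesis using assms(3) by simp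
qed

lemma vanishes_below_mult:
  assumes "vanishes_below p f" "vanishes_below q g"
  shows "vanishes_below (p + q) (f * g)"
  unfolding vanishes_below_def
proof (intro allI impI)
  fix w :: "nat list" assume w: "length w < p + q"
  have "coeff f (take i w) * coeff g (drop i w) = 0" if "i \<le> length w" for i
    using assms w that by (cases "i < p") (simp_all add: vanishes_below_def)
  then show "coeff (f * g) w = 0" unfolding coeff_mult by (intro sum.neutral) simp
qed

definition series_units :: "series monoid" where
  "series_units = \<lparr>carrier = {f. \<exists>g. f * g = 1 \<and> g * f = 1}, monoid.mult = (*), one = 1\<rparr>"

lemma group_series_units: "group series_units"
proof (rule groupI)
  fix f g assume "f \<in> carrier series_units" "g \<in> carrier series_units"
  then obtain f' g' where "f * f' = 1" "f' * f = 1" "g * g' = 1" "g' * g = 1"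
    by (auto simp: series_units_def)
  then have "(f * g) * (g' * f') = 1" "(g' * f') * (f * g) = 1"
    by (metis mult.assoc mult_1_right)+
  then show "f \<otimes>\<^bsub>series_units\<^esub> g \<in> carrier series_units"
    by (auto simp: series_units_def)
qed (auto simp: series_units_def mult.assoc)

lemma series_units_simps [simp]:
  "f \<otimes>\<^bsub>series_units\<^esub> g = f * g" "\<one>\<^bsub>series_units\<^esub> = 1"
  by (simp_all add: series_units_def)

lemma series_units_inv:
  assumes "f \<in> carrier series_units"
  shows "f * inv\<^bsub>series_units\<^esub> f = 1" "inv\<^bsub>series_units\<^esub> f * f = 1"
  using group.r_inv[OF group_series_units assms] group.l_inv[OF group_series_units assms] by simp_all

definition series_var :: "nat \<Rightarrow> series" where
  "series_var a = Series (\<lambda>w. if w = [a] then 1 else 0)"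

lemma one_plus_var_unit: "1 + series_var a \<in> carrier series_units"
proof -
  \<comment> \<open>The alternating geometric series, the inverse of 1 + X_a.\<close>
  define Y where "Y = Series (\<lambda>w. if set w \<subseteq> {a} then (- 1) ^ length w else 0)"
  have X: "coeff (series_var a) w = (if w = [a] then 1 else 0)" for w
    by (simp add: series_var_def)
  have Y: "coeff Y w = (if set w \<subseteq> {a} then (- 1) ^ length w else 0)" for w
    by (simp add: Y_def)
  have "vanishes_below 1 (series_var a)"
    by (auto simp: vanishes_below_def X)
  have XY: "coeff (series_var a * Y) w = (case w of [] \<Rightarrow> 0 | b # v \<Rightarrow> if b = a then coeff Y v else 0)" for w
  proof (cases w)
    case Nil
    then show ?thesis by (simp add: coeff_mult X)
  next
    case (Cons b v)
    have "coeff (series_var a * Y) w = (\<Sum>i\<le>length w. if i = 1 then (if b = a then coeff Y v else 0) else 0)"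
      unfolding coeff_mult by (rule sum.cong) (auto simp: X Cons take_Cons' split: if_splits)
    moreover have "1 \<in> {..length w}" using Cons by simp
    ultimately have "coeff (series_var a * Y) w = (if b = a then coeff Y v else 0)"
      by (simp only: sum.delta finite_atMost if_True)
    then show ?thesis using Cons by simp
  qed
  have YX: "coeff (Y * series_var a) w = (if w = [] then 0 else if last w = a then coeff Y (butlast w) else 0)" for w
  proof (cases w rule: rev_cases)
    case Nil
    then show ?thesis by (simp add: coeff_mult X)
  next
    case (snoc v b)
    have "coeff (Y * series_var a) w = (\<Sum>i\<le>length w. if i = length v then (if b = a then coeff Y v else 0) else 0)"
      unfolding coeff_mult
    proof (rule sum.cong)
      fix i assume i: "i \<in> {..length w}"
      show "coeff Y (take i w) * coeff (series_var a) (drop i w) =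
        (if i = length v then (if b = a then coeff Y v else 0) else 0)"
      proof (cases "i = length v")
        case False
        then have "length (drop i w) \<noteq> 1" using i snoc by auto
        then have "drop i w \<noteq> [a]" by (metis length_Cons list.size(3) One_nat_def)
        then show ?thesis using False by (simp add: X)
      qed (simp add: snoc X)
    qed simp
    then show ?thesis using snoc by simp
  qed
  have "(1 + series_var a) * Y = 1"
    by (rule series_eqI) (auto simp: distrib_right XY Y split: list.splits)
  moreover have "Y * (1 + series_var a) = 1"
  proof (rule series_eqI)
    fix w show "coeff (Y * (1 + series_var a)) w = coeff 1 w"
      by (cases w rule: rev_cases) (auto simp: distrib_left YX Y)
  qed
  ultimately show ?thesis by (auto simp: series_units_def)
qed

subsection \<open>Leading terms of the Magnus expansion\<close>

text \<open>From a' - 1 = -(a - 1) a': the factor a' has constant term 1 and leaves the leading term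
  of a - 1 unchanged up to sign.\<close>

lemma unit_inv_leading:
  assumes "a \<in> carrier series_units" "vanishes_below d (a - 1)" "0 < d"
  defines "a' \<equiv> inv\<^bsub>series_units\<^esub> a"
  shows "vanishes_below d (a' - 1)" "length w = d \<Longrightarrow> coeff (a' - 1) w = - coeff (a - 1) w"
proof -
  have eq: "a' - 1 = - ((a - 1) * a')"
    using series_units_inv[OF assms(1)] by (simp add: a'_def algebra_simps)
  have "vanishes_below (d + 0) ((a - 1) * a')"
    by (rule vanishes_below_mult[OF assms(2)]) simp
  then show v: "vanishes_below d (a' - 1)"
    unfolding eq by (simp add: vanishes_below_def)
  assume w: "length w = d"
  have "coeff ((a - 1) * a') w = coeff (a - 1) (take d w) * coeff a' (drop d w)"
    by (rule coeff_mult_leading[OF assms(2)]) (simp_all add: w)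
  moreover have "coeff a' [] = 1" using v assms(3) by (simp add: vanishes_below_def)
  ultimately show "coeff (a' - 1) w = - coeff (a - 1) w" unfolding eq using w by simp
qed

text \<open>In ab - 1 = (a - 1) + (b - 1) + (a - 1)(b - 1) the last summand has order at least 2d,
  which exceeds d.\<close>

lemma unit_mult_leading:
  assumes "vanishes_below d (a - 1)" "vanishes_below d (b - 1)" "0 < d"
  shows "vanishes_below d (a * b - 1)" "length w = d \<Longrightarrow> coeff (a * b - 1) w = coeff (a - 1) w + coeff (b - 1) w"
proof -
  have eq: "a * b - 1 = (a - 1) + (b - 1) + (a - 1) * (b - 1)" by (simp add: algebra_simps)
  have "vanishes_below (d + d) ((a - 1) * (b - 1))"
    by (rule vanishes_below_mult[OF assms(1,2)])
  then have v: "vanishes_below (Suc d) ((a - 1) * (b - 1))"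
    using assms(3) by (auto elim: vanishes_below_mono)
  then show "vanishes_below d (a * b - 1)"
    unfolding eq using assms by (intro vanishes_below_add) (auto elim: vanishes_below_mono)
  assume "length w = d"
  then show "coeff (a * b - 1) w = coeff (a - 1) w + coeff (b - 1) w"
    unfolding eq using v by (simp add: vanishes_below_def)
qed

text \<open>With A = a - 1 and B = b - 1 one has ab - ba = AB - BA, so the commutator minus 1 is (AB
  - BA) times the product of the inverses of a and b, a series with constant term 1. The group
  commutator thus has the Lie bracket as its term of degree p + q.\<close>

lemma unit_commutator_leading:
  assumes a: "a \<in> carrier series_units" and b: "b \<in> carrier series_units"
    and p: "vanishes_below p (a - 1)" "0 < p" and q: "vanishes_below q (b - 1)" "0 < q"
  defines "c \<equiv> commutator series_units a b"
  shows "vanishes_below (p + q) (c - 1)"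
    "length w = p + q \<Longrightarrow> coeff (c - 1) w = coeff (a - 1) (take p w) * coeff (b - 1) (drop p w)
      - coeff (b - 1) (take q w) * coeff (a - 1) (drop q w)"
proof -
  let ?a' = "inv\<^bsub>series_units\<^esub> a" and ?b' = "inv\<^bsub>series_units\<^esub> b"
  define e where "e = (a - 1) * (b - 1) - (b - 1) * (a - 1)"
  have "e = a * b - b * a" by (simp add: e_def algebra_simps)
  then have "e * (?a' * ?b') = a * b * ?a' * ?b' - b * (a * ?a') * ?b'"
    by (simp only: left_diff_distrib mult.assoc)
  then have eq: "c - 1 = e * (?a' * ?b')"
    using series_units_inv[OF a] series_units_inv[OF b] by (simp add: c_def commutator_def)
  have e1: "vanishes_below (p + q) ((a - 1) * (b - 1))" "vanishes_below (p + q) ((b - 1) * (a - 1))"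
    using vanishes_below_mult[OF p(1) q(1)] vanishes_below_mult[OF q(1) p(1)] by (simp_all add: add.commute)
  then have e: "vanishes_below (p + q) e"
    unfolding e_def by (rule vanishes_below_diff)
  have "vanishes_below (p + q + 0) (c - 1)"
    unfolding eq by (rule vanishes_below_mult[OF e]) simp
  then show "vanishes_below (p + q) (c - 1)" by simp
  assume w: "length w = p + q"
  have "vanishes_below 1 (?a' - 1)" "vanishes_below 1 (?b' - 1)"
    using unit_inv_leading(1)[OF a p] unit_inv_leading(1)[OF b q] p(2) q(2)
    by (auto elim: vanishes_below_mono)
  then have "coeff (?a' * ?b' - 1) [] = 0"
    using unit_mult_leading(1)[of 1 ?a' ?b'] by (simp add: vanishes_below_def)
  then have 1: "coeff (?a' * ?b') [] = 1" by simp
  have "coeff (c - 1) w = coeff e (take (p + q) w) * coeff (?a' * ?b') (drop (p + q) w)"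
    unfolding eq by (rule coeff_mult_leading[OF e]) (simp_all add: w)
  also have "\<dots> = coeff e w" using 1 w by simp
  also have "\<dots> = coeff ((a - 1) * (b - 1)) w - coeff ((b - 1) * (a - 1)) w" by (simp add: e_def)
  finally show "coeff (c - 1) w = coeff (a - 1) (take p w) * coeff (b - 1) (drop p w)
      - coeff (b - 1) (take q w) * coeff (a - 1) (drop q w)"
    using coeff_mult_leading[OF p(1) q(1), of w] coeff_mult_leading[OF q(1) p(1), of w] w by simp
qed

text \<open>The commutator estimate with \<open>q = 1\<close> raises the order by one for each
  commutator with an arbitrary \<open>b\<close>; the hypothesis on constant terms gives
  \<open>\<mu> b - 1\<close> its order 1. Products and inverses keep the order.\<close>

lemma (in group) series_hom_lower_central:
  assumes \<mu>: "\<mu> \<in> hom G series_units" and \<mu>1: "\<And>g. g \<in> carrier G \<Longrightarrow> coeff (\<mu> g) [] = 1"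
    and g: "g \<in> lower_central G d" and d: "0 < d"
  shows "vanishes_below d (\<mu> g - 1)"
  using g d
proof (induction d arbitrary: g)
  case (Suc d)
  interpret \<mu>: group_hom G series_units \<mu>
    using \<mu> group_series_units by (simp add: group_hom_def group_hom_axioms_def)
  show ?case
  proof (cases "d = 0")
    case True
    then show ?thesis using \<mu>1 Suc.prems(1) by (simp add: vanishes_below_def)
  next
    case False
    let ?S = "\<Union>a\<in>lower_central G d. \<Union>b\<in>carrier G. {commutator G a b}"
    have S: "?S \<subseteq> carrier G" using lower_central_closed by auto
    have base: "vanishes_below (Suc d) (\<mu> s - 1)" if s: "s \<in> ?S" for s
    proof -
      obtain a b where ab: "a \<in> lower_central G d" "b \<in> carrier G" "s = commutator G a b" using s by blast
      have "vanishes_below 1 (\<mu> b - 1)" using \<mu>1 ab(2) by (simp add: vanishes_below_def)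
      then have "vanishes_below (d + 1) (commutator series_units (\<mu> a) (\<mu> b) - 1)"
        using Suc.IH[OF ab(1)] False ab lower_central_closed
        by (intro unit_commutator_leading) auto
      then show ?thesis using ab lower_central_closed by (simp add: \<mu>.hom_commutator)
    qed
    have "g \<in> generate G ?S" using Suc.prems False by (simp add: lower_central_Suc)
    then show ?thesis
    proof (induction rule: generate.induct)
      case one
      then show ?case using \<mu>.hom_one by (simp add: vanishes_below_def)
    next
      case (incl h)
      then show ?case by (rule base)
    next
      case (inv h)
      then have "h \<in> carrier G" using S by blast
      then show ?case using unit_inv_leading(1)[OF _ base[OF inv]] by simp
    next
      case (eng h1 h2)
      then have "h1 \<in> carrier G" "h2 \<in> carrier G" using generate_in_carrier[OF S] by auto
      then show ?case using unit_mult_leading(1)[OF eng.IH] \<mu>.hom_mult by simp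
    qed
  qed
qed simp

text \<open>Leading terms add under multiplication and change sign under inversion, so an exponent
  becomes a factor. This makes the exponents of a relation visible as coefficients.\<close>

lemma series_units_pow_leading:
  fixes k :: int
  assumes a: "a \<in> carrier series_units" and d: "vanishes_below d (a - 1)" "0 < d"
  shows "vanishes_below d (a [^]\<^bsub>series_units\<^esub> k - 1)"
    "length w = d \<Longrightarrow> coeff (a [^]\<^bsub>series_units\<^esub> k - 1) w = k * coeff (a - 1) w"
proof -
  interpret K: group series_units by (rule group_series_units)
  have nat: "vanishes_below d (a [^]\<^bsub>series_units\<^esub> m - 1) \<and>
      (length w = d \<longrightarrow> coeff (a [^]\<^bsub>series_units\<^esub> m - 1) w = int m * coeff (a - 1) w)" for m :: nat
  proof (induction m)
    case (Suc m)
    let ?p = "a [^]\<^bsub>series_units\<^esub> m"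
    have p: "vanishes_below d (?p - 1)" using Suc by blast
    have eq: "a [^]\<^bsub>series_units\<^esub> Suc m = ?p * a" by simp
    have "coeff (?p * a - 1) w = int (Suc m) * coeff (a - 1) w" if w: "length w = d"
    proof -
      have "coeff (?p * a - 1) w = coeff (?p - 1) w + coeff (a - 1) w"
        by (rule unit_mult_leading(2)[OF p d w])
      also have "coeff (?p - 1) w = int m * coeff (a - 1) w" using Suc w by blast
      finally show ?thesis by (simp only: of_nat_Suc distrib_right mult_1_left)
    qed
    then show ?case
      unfolding eq using unit_mult_leading(1)[OF p d] by blast
  qed (auto simp: vanishes_below_def)
  have "vanishes_below d (a [^]\<^bsub>series_units\<^esub> k - 1) \<and>
      (length w = d \<longrightarrow> coeff (a [^]\<^bsub>series_units\<^esub> k - 1) w = k * coeff (a - 1) w)"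
  proof (cases k rule: int_cases2)
    case (nonneg m)
    show ?thesis unfolding nonneg int_pow_int by (rule nat)
  next
    case (nonpos m)
    let ?p = "a [^]\<^bsub>series_units\<^esub> m"
    have eq: "a [^]\<^bsub>series_units\<^esub> k = inv\<^bsub>series_units\<^esub> ?p"
      unfolding nonpos by (rule K.int_pow_neg_int[OF a])
    have p: "?p \<in> carrier series_units" by (rule K.nat_pow_closed[OF a])
    have v: "vanishes_below d (?p - 1)" using nat by blast
    have "coeff (inv\<^bsub>series_units\<^esub> ?p - 1) w = k * coeff (a - 1) w" if w: "length w = d"
    proof -
      have "coeff (inv\<^bsub>series_units\<^esub> ?p - 1) w = - coeff (?p - 1) w"
        by (rule unit_inv_leading(2)[OF p v d(2) w])
      also have "coeff (?p - 1) w = int m * coeff (a - 1) w" using nat w by blast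
      finally show ?thesis by (simp only: nonpos mult_minus_left)
    qed
    then show ?thesis
      unfolding eq using unit_inv_leading(1)[OF p v d(2)] by blast
  qed
  then show "vanishes_below d (a [^]\<^bsub>series_units\<^esub> k - 1)"
    "length w = d \<Longrightarrow> coeff (a [^]\<^bsub>series_units\<^esub> k - 1) w = k * coeff (a - 1) w" by blast+
qed

subsection \<open>Lyndon trees\<close>

datatype lie_tree = Leaf nat | Node lie_tree lie_tree

primrec foliage :: "lie_tree \<Rightarrow> nat list" where
  "foliage (Leaf a) = [a]"
| "foliage (Node s t) = foliage s @ foliage t"

text \<open>The trees of the iterated standard factorizations of Lyndon words.\<close>

fun lyndon :: "lie_tree \<Rightarrow> bool" where
  "lyndon (Leaf a) = True"
| "lyndon (Node s t) = (lyndon s \<and> lyndon t \<and> foliage s < foliage t \<and>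
     (case s of Leaf _ \<Rightarrow> True | Node _ s'' \<Rightarrow> foliage t \<le> foliage s''))"

lemma foliage_nonempty [simp]: "foliage t \<noteq> []"
  by (induction t) auto

lemma append_less_append_same [simp]:
  fixes w :: "nat list" shows "w @ a < w @ b \<longleftrightarrow> a < b"
  by (induction w) auto

lemma le_append: "u \<le> u @ (z :: nat list)"
  by (induction u) auto

text \<open>If \<open>u\<close> is not a prefix of \<open>v\<close>, the two words differ at some
  position of both, and the comparison there survives whatever is appended.\<close>

lemma less_list_cases:
  fixes u v :: "nat list"
  assumes "u < v"
  shows "(\<exists>z. z \<noteq> [] \<and> v = u @ z) \<or> (\<forall>a b. u @ a < v @ b)"
  using assms
proof (induction u arbitrary: v)
  case (Cons x u)
  then show ?case by (cases v) auto
qed auto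

lemma append_less_append_iff:
  fixes u v :: "nat list"
  shows "length u = length v \<Longrightarrow> u @ a < v @ b \<longleftrightarrow> u < v \<or> u = v \<and> a < b"
  by (induction u v rule: list_induct2) auto

text \<open>In classical terms, the foliage is a Lyndon word and its right factor is its least
  proper suffix. The two claims need each other: the second follows for a cut inside the left factor
  from the second claim for \<open>s\<close>, and the first then follows from \<open>uv < v\<close>,
  where u and v are the foliages of \<open>s\<close> and \<open>r\<close>.\<close>

lemma lyndon_foliage:
  assumes "lyndon t"
  shows "\<forall>p q. foliage t = p @ q \<longrightarrow> p \<noteq> [] \<longrightarrow> q \<noteq> [] \<longrightarrow>
    foliage t < q \<and> (\<forall>s r. t = Node s r \<longrightarrow> foliage r \<le> q)"
  using assms
proof (induction t)
  case (Leaf a)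
  then show ?case by (auto simp: Cons_eq_append_conv)
next
  case (Node s r)
  let ?u = "foliage s" and ?v = "foliage r"
  have uv: "?u < ?v" and IHs: "\<And>p q. ?u = p @ q \<Longrightarrow> p \<noteq> [] \<Longrightarrow> q \<noteq> [] \<Longrightarrow>
      ?u < q \<and> (\<forall>s' r'. s = Node s' r' \<longrightarrow> foliage r' \<le> q)"
    and IHr: "\<And>p q. ?v = p @ q \<Longrightarrow> p \<noteq> [] \<Longrightarrow> q \<noteq> [] \<Longrightarrow> ?v < q"
    using Node by auto
  \<comment> \<open>If u is a prefix of v, say v = uz, then v < z because v is a Lyndon word, and
    prefixing u gives the claim; otherwise the first difference between u and v decides.\<close>
  have less: "?u @ ?v < ?v"
    using less_list_cases[OF uv]
  proof
    assume "\<exists>z. z \<noteq> [] \<and> ?v = ?u @ z"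
    then obtain z where z: "z \<noteq> []" "?v = ?u @ z" by blast
    then have "?v < z" using IHr by simp
    then have "?u @ ?v < ?u @ z" by simp
    then show ?thesis using z(2) by simp
  next
    assume "\<forall>a b. ?u @ a < ?v @ b"
    then show ?thesis by (metis append_Nil2)
  qed
  have min: "?v \<le> q" if pq: "?u @ ?v = p @ q" "p \<noteq> []" "q \<noteq> []" for p q
  proof -
    \<comment> \<open>The cut falls either inside the left factor or inside the right one.\<close>
    obtain z where "?u = p @ z \<and> z @ ?v = q \<or> ?u @ z = p \<and> ?v = z @ q"
      using pq(1) by (auto simp: append_eq_append_conv2)
    then show ?thesis
    proof
      assume z: "?u = p @ z \<and> z @ ?v = q"
      show ?thesis
      proof (cases "z = []")
        case False
        obtain s' s'' where s: "s = Node s' s''"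
          using z False pq(2) by (cases s) (auto simp: Cons_eq_append_conv)
        then have "?v \<le> foliage s''" using Node.prems by simp
        also have "\<dots> \<le> z" using IHs[of p z] z False pq(2) s by simp
        also have "\<dots> \<le> z @ ?v" by (rule le_append)
        finally show ?thesis using z by simp
      qed (use z in simp)
    next
      assume "?u @ z = p \<and> ?v = z @ q"
      then show ?thesis using IHr[of z q] pq(3) by (cases "z = []") auto
    qed
  qed
  show ?case
    using less min by fastforce
qed

lemma lyndon_less_right: "lyndon (Node s r) \<Longrightarrow> foliage s @ foliage r < foliage r"
  using lyndon_foliage[of "Node s r"] by (auto dest: spec[of _ "foliage s"])

text \<open>The right factor is recovered from the word as its least proper suffix, so the root
  splits of the two trees coincide.\<close>

lemma lyndon_foliage_inj:
  "lyndon t \<Longrightarrow> lyndon t' \<Longrightarrow> foliage t = foliage t' \<Longrightarrow> t = t'"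
proof (induction t arbitrary: t')
  case (Leaf a)
  then show ?case by (cases t') (auto simp: Cons_eq_append_conv)
next
  case (Node s r)
  obtain s' r' where t': "t' = Node s' r'"
    using Node.prems by (cases t') (auto simp: append_eq_Cons_conv)
  have "foliage r \<le> foliage r'"
    using lyndon_foliage[OF Node.prems(1)] Node.prems(3) t' by (metis foliage.simps(2) foliage_nonempty)
  moreover have "foliage r' \<le> foliage r"
    using lyndon_foliage[OF Node.prems(2)] Node.prems(3) t' by (metis foliage.simps(2) foliage_nonempty)
  ultimately have "foliage r = foliage r'" by simp
  then show ?case using Node t' by auto
qed

section \<open>Lyndon commutators as generators modulo the next term of the series\<close>

definition lyndon_trees :: "nat \<Rightarrow> nat \<Rightarrow> lie_tree set" where
  "lyndon_trees n d = {t. lyndon t \<and> set (foliage t) \<subseteq> {..<n} \<and> length (foliage t) = d}"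

lemma finite_lyndon_trees: "finite (lyndon_trees n d)"
proof (rule inj_on_finite)
  show "inj_on foliage (lyndon_trees n d)"
    by (auto simp: inj_on_def lyndon_trees_def intro: lyndon_foliage_inj)
  show "foliage ` lyndon_trees n d \<subseteq> {w. set w \<subseteq> {..<n} \<and> length w = d}"
    by (auto simp: lyndon_trees_def)
  show "finite {w. set w \<subseteq> {..<n} \<and> length w = d}"
    by (rule finite_lists_length_eq) simp
qed

primrec tree_commutator :: "('a, 'm) monoid_scheme \<Rightarrow> (nat \<Rightarrow> 'a) \<Rightarrow> lie_tree \<Rightarrow> 'a" where
  "tree_commutator G x (Leaf a) = x a"
| "tree_commutator G x (Node s t) = commutator G (tree_commutator G x s) (tree_commutator G x t)"

context group
begin

lemma tree_commutator_lower_central: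
  assumes "x \<in> {..<n} \<rightarrow> carrier G" "set (foliage t) \<subseteq> {..<n}"
  shows "tree_commutator G x t \<in> lower_central G (length (foliage t))"
  using assms(2)
proof (induction t)
  case (Leaf a)
  then show ?case using assms(1) by auto
next
  case (Node s t)
  then show ?case by (auto intro!: commutator_in_lower_central)
qed

text \<open>Including \<Gamma>^(d+1) lets commutators of weight \<open>d\<close> be computed as in a
  Lie ring. The strict bound on the foliages records what the rewriting gains and makes its
  induction hypothesis applicable.\<close>

definition tree_span :: "(nat \<Rightarrow> 'a) \<Rightarrow> nat \<Rightarrow> nat \<Rightarrow> nat list \<Rightarrow> 'a set" where
  "tree_span x n d v = generate G (tree_commutator G x ` {t \<in> lyndon_trees n d. foliage t < v} \<union> lower_central G (Suc d))"

lemma tree_span_generators: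
  assumes "x \<in> {..<n} \<rightarrow> carrier G"
  shows "tree_commutator G x ` lyndon_trees n d \<subseteq> lower_central G d"
  using tree_commutator_lower_central[OF assms] by (auto simp: lyndon_trees_def)

lemma tree_span_subgroup:
  assumes "x \<in> {..<n} \<rightarrow> carrier G"
  shows "subgroup (tree_span x n d v) G"
  unfolding tree_span_def
  by (rule generate_is_subgroup) (use tree_span_generators[OF assms, of d] lower_central_closed in blast)

lemma tree_span_mono: "v \<le> v' \<Longrightarrow> tree_span x n d v \<subseteq> tree_span x n d v'"
  unfolding tree_span_def by (rule mono_generate) auto

lemma lower_central_subset_tree_span: "lower_central G (Suc d) \<subseteq> tree_span x n d v"
  unfolding tree_span_def by (auto intro: generate.incl)

text \<open>Rewriting with the Jacobi identity brings the bracket of two Lyndon trees into the span of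
  Lyndon trees; each step decreases the larger of the two foliages.\<close>

lemma commutator_in_tree_span:
  assumes x: "x \<in> {..<n} \<rightarrow> carrier G"
    and "lyndon s" "lyndon t" "set (foliage s) \<subseteq> {..<n}" "set (foliage t) \<subseteq> {..<n}"
  shows "commutator G (tree_commutator G x s) (tree_commutator G x t)
    \<in> tree_span x n (length (foliage s) + length (foliage t)) (max (foliage s) (foliage t))"
  using assms(2-)
proof (induction "length (foliage s) + length (foliage t)" arbitrary: s t rule: less_induct)
  case outer: less
  note IH_N = outer.hyps
  define N where "N = length (foliage s) + length (foliage t)"
  \<comment> \<open>The lexicographic order has infinite descending chains such as b > ab > aab, so
    the measure counts the finitely many smaller words of length at most \<open>N\<close>. The outer
    induction is on the total length, the inner one on this count for the larger foliage.\<close>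
  define below where "below v = {w. set w \<subseteq> {..<n} \<and> length w \<le> N \<and> w < v}" for v
  have below: "card (below u) < card (below v)"
    if "u < v" "set u \<subseteq> {..<n}" "length u \<le> N" for u v
  proof (rule psubset_card_mono)
    have "finite {w. set w \<subseteq> {..<n} \<and> length w \<le> N}" by (rule finite_lists_length_le) simp
    then show "finite (below v)" by (rule rev_finite_subset) (auto simp: below_def)
    show "below u \<subset> below v" using that by (auto simp: below_def)
  qed
  show ?case
    using outer.prems N_def
  proof (induction "card (below (max (foliage s) (foliage t)))" arbitrary: s t rule: less_induct)
    case inner: less
    let ?b = "tree_commutator G x"
    have bl: "?b r \<in> lower_central G (length (foliage r))" if "set (foliage r) \<subseteq> {..<n}" for r
      using tree_commutator_lower_central[OF x that] .
    have bc: "?b r \<in> carrier G" if "set (foliage r) \<subseteq> {..<n}" for r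
      using bl[OF that] lower_central_closed by blast
    have IH_max: "commutator G (?b s') (?b t') \<in> tree_span x n N (max (foliage s') (foliage t'))"
      if "max (foliage s') (foliage t') < max (foliage s) (foliage t)" "lyndon s'" "lyndon t'"
        "set (foliage s') \<subseteq> {..<n}" "set (foliage t') \<subseteq> {..<n}" "N = length (foliage s') + length (foliage t')" for s' t'
    proof -
      have "card (below (max (foliage s') (foliage t'))) < card (below (max (foliage s) (foliage t)))"
        by (rule below[OF that(1)]) (use that in \<open>auto simp: max_def\<close>)
      then show ?thesis using inner.hyps that by simp
    qed
    \<comment> \<open>The bound in the inner hypothesis is restated with \<open>foliage t\<close>,
      so that this case also serves, with the trees exchanged, when \<open>foliage s\<close> is the
      larger one.\<close>
    have ordered: "commutator G (?b s) (?b t) \<in> tree_span x n N (foliage t)"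
      if st: "foliage s < foliage t" and l: "lyndon s" "lyndon t"
        and set: "set (foliage s) \<subseteq> {..<n}" "set (foliage t) \<subseteq> {..<n}" and N: "N = length (foliage s) + length (foliage t)"
        and IH_max: "\<And>s' t'. max (foliage s') (foliage t') < foliage t \<Longrightarrow> lyndon s' \<Longrightarrow> lyndon t' \<Longrightarrow>
          set (foliage s') \<subseteq> {..<n} \<Longrightarrow> set (foliage t') \<subseteq> {..<n} \<Longrightarrow> N = length (foliage s') + length (foliage t') \<Longrightarrow>
          commutator G (?b s') (?b t') \<in> tree_span x n N (max (foliage s') (foliage t'))" for s t
    proof (cases "lyndon (Node s t)")
      case True
      \<comment> \<open>The bracket is itself a Lyndon commutator, and its foliage uv is below v by
        \<open>lyndon_less_right\<close>.\<close>
      then have "Node s t \<in> {t' \<in> lyndon_trees n N. foliage t' < foliage t}"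
        using set N lyndon_less_right[OF True] by (auto simp: lyndon_trees_def)
      then show ?thesis
        unfolding tree_span_def by (intro generate.incl) (metis (no_types, lifting) UnI1 image_eqI tree_commutator.simps(2))
    next
      case False
      \<comment> \<open>The only way left to fail is that \<open>s\<close> splits with a right
        factor smaller than \<open>t\<close>. The Jacobi identity then trades [t, [s', s'']] for
        [s', [t, s'']] and [[t, s'], s''].\<close>
      then obtain s' s'' where s: "s = Node s' s''" and s'': "foliage s'' < foliage t"
        using st l by (cases s) (auto simp: not_le)
      have s': "foliage s' < foliage t"
        using st s le_append[of "foliage s'" "foliage s''"] by simp
      have ls: "lyndon s'" "lyndon s''" and sets: "set (foliage s') \<subseteq> {..<n}" "set (foliage s'') \<subseteq> {..<n}"
        using l set s by auto
      let ?H = "tree_span x n N (foliage t)"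
      have H: "subgroup ?H G" by (rule tree_span_subgroup[OF x])
      \<comment> \<open>The inner bracket is shorter, so the outer hypothesis expresses it by trees
        with foliage below that of \<open>t\<close>. Bracketing these with \<open>r\<close>, also
        below \<open>t\<close>, lowers the larger foliage, so the inner hypothesis applies.\<close>
      have step: "commutator G (?b r) (commutator G (?b t) (?b r')) \<in> ?H"
        if r: "lyndon r" "set (foliage r) \<subseteq> {..<n}" "foliage r < foliage t"
          and r': "lyndon r'" "set (foliage r') \<subseteq> {..<n}" "foliage r' < foliage t"
          and len: "length (foliage r) + length (foliage r') = length (foliage s)" for r r'
      proof -
        let ?m = "length (foliage r') + length (foliage t)"
        let ?S = "?b ` {t' \<in> lyndon_trees n ?m. foliage t' < foliage t}"
        have "0 < length (foliage r)" by simp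
        then have "?m < N" using N len by linarith
        then have "commutator G (?b r') (?b t) \<in> tree_span x n ?m (max (foliage r') (foliage t))"
          unfolding N_def using r' l set by (intro IH_N) auto
        then have "inv (commutator G (?b r') (?b t)) \<in> tree_span x n ?m (foliage t)"
          unfolding max_absorb2[OF less_imp_le[OF r'(3)]] by (rule subgroup.m_inv_closed[OF tree_span_subgroup[OF x]])
        then have *: "commutator G (?b t) (?b r') \<in> generate G (?S \<union> lower_central G (Suc ?m))"
          using bc r' set by (simp add: inv_commutator tree_span_def)
        show ?thesis
        proof (rule commutator_generate_in_subgroup[OF bl[OF r(2)] _ _ _ H _ _ *])
          show "?S \<subseteq> lower_central G ?m" using tree_span_generators[OF x, of ?m] by blast
          show "lower_central G (Suc (length (foliage r) + ?m)) \<subseteq> ?H"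
          proof -
            have "length (foliage r) + ?m = N" using len N by linarith
            then show ?thesis using lower_central_subset_tree_span[of N x n "foliage t"] by simp
          qed
          fix g assume "g \<in> ?S"
          then obtain t' where t': "t' \<in> lyndon_trees n ?m" "foliage t' < foliage t" "g = ?b t'" by blast
          have "commutator G (?b r) (?b t') \<in> tree_span x n N (max (foliage r) (foliage t'))"
            using t' r len N by (intro IH_max) (auto simp: lyndon_trees_def)
          moreover have "max (foliage r) (foliage t') \<le> foliage t"
            by (rule less_imp_le) (simp add: t'(2) r(3))
          ultimately show "commutator G (?b r) g \<in> ?H"
            unfolding t'(3) by (rule set_mp[OF tree_span_mono, rotated])
        qed auto
      qed
      have "commutator G (?b t) (commutator G (?b s') (?b s'')) \<in> ?H"
      proof (rule commutator_jacobi_in_subgroup[OF bl[OF sets(1)] bl[OF sets(2)] bl[OF set(2)] _ _ _ H])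
        show "lower_central G (Suc (length (foliage s') + length (foliage s'') + length (foliage t))) \<subseteq> ?H"
          using lower_central_subset_tree_span[of N x n "foliage t"] N s by simp
        show "commutator G (?b s') (commutator G (?b t) (?b s'')) \<in> ?H"
          by (rule step) (use ls sets s' s'' s in auto)
        have "commutator G (?b s'') (commutator G (?b t) (?b s')) \<in> ?H"
          by (rule step) (use ls sets s' s'' s in auto)
        then have "inv (commutator G (?b s'') (commutator G (?b t) (?b s'))) \<in> ?H"
          by (rule subgroup.m_inv_closed[OF H])
        then show "commutator G (commutator G (?b t) (?b s')) (?b s'') \<in> ?H"
          using bc sets set by (simp add: inv_commutator)
      qed auto
      then have "inv (commutator G (?b t) (commutator G (?b s') (?b s''))) \<in> ?H"
        by (rule subgroup.m_inv_closed[OF H])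
      then show ?thesis using bc sets set s by (simp add: inv_commutator)
    qed
    show ?case
    proof (cases "foliage s" "foliage t" rule: linorder_cases)
      case less
      then have mx: "max (foliage s) (foliage t) = foliage t" by simp
      have "commutator G (?b s) (?b t) \<in> tree_span x n N (foliage t)"
        by (rule ordered[OF less inner.prems]) (rule IH_max[unfolded mx]; assumption)
      then show ?thesis unfolding mx inner.prems(5) .
    next
      case equal
      then have "s = t" using inner.prems lyndon_foliage_inj by blast
      then have "commutator G (?b s) (?b t) = \<one>"
        using bc inner.prems by (simp add: commutator_eq_one_iff)
      then show ?thesis using subgroup.one_closed[OF tree_span_subgroup[OF x]] by simp
    next
      case greater
      then have mx: "max (foliage s) (foliage t) = foliage s" by simp
      have len: "N = length (foliage t) + length (foliage s)" using inner.prems(5) by simp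
      have "commutator G (?b t) (?b s) \<in> tree_span x n N (foliage s)"
        by (rule ordered[OF greater inner.prems(2,1,4,3) len]) (rule IH_max[unfolded mx]; assumption)
      then have "inv (commutator G (?b t) (?b s)) \<in> tree_span x n N (foliage s)"
        by (rule subgroup.m_inv_closed[OF tree_span_subgroup[OF x]])
      then have "commutator G (?b s) (?b t) \<in> tree_span x n N (foliage s)"
        using inner.prems bc by (simp add: inv_commutator)
      then show ?thesis unfolding mx inner.prems(5) .
    qed
  qed
qed

text \<open>Modulo \<Gamma>^(d+2) the commutator is additive in each argument on \<Gamma>^d and G,
  so \<Gamma>^(d+1) is generated there by brackets of a Lyndon commutator with a basis letter. Each
  of these is a bracket of two Lyndon trees, the letter being a leaf.\<close>

lemma lower_central_tree_generated:
  assumes x: "x \<in> {..<n} \<rightarrow> carrier G" and gen: "carrier G = generate G (x ` {..<n})" and d: "0 < d"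
  shows "lower_central G d \<subseteq> generate G (tree_commutator G x ` lyndon_trees n d \<union> lower_central G (Suc d))"
  using d
proof (induction d)
  case (Suc d)
  let ?b = "tree_commutator G x"
  let ?H = "\<lambda>d. generate G (?b ` lyndon_trees n d \<union> lower_central G (Suc d))"
  have H: "subgroup (?H d) G" for d
    by (rule generate_is_subgroup) (use tree_span_generators[OF x, of d] lower_central_closed in blast)
  have span: "tree_span x n d v \<subseteq> ?H d" for d v
    unfolding tree_span_def by (rule mono_generate) auto
  have leaf: "Leaf i \<in> lyndon_trees n 1" if "i < n" for i
    using that by (simp add: lyndon_trees_def)
  show ?case
  proof (cases "d = 0")
    case True
    have "x ` {..<n} \<subseteq> ?H 1"
      using leaf by (auto intro!: generate.incl image_eqI[of _ ?b "Leaf _"])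
    then show ?thesis using True gen generate_subgroup_incl[OF _ H[of 1]] by simp
  next
    case False
    have 1: "commutator G (?b t) h \<in> ?H (Suc d)" if t: "t \<in> lyndon_trees n d" and h: "h \<in> carrier G" for t h
    proof (rule commutator_generate_in_subgroup[of _ d "x ` {..<n}" 1])
      show "?b t \<in> lower_central G d" using t tree_span_generators[OF x] by blast
      show "x ` {..<n} \<subseteq> lower_central G 1" using x by auto
      show "h \<in> generate G (x ` {..<n} \<union> lower_central G (Suc 1))"
        using h gen mono_generate[of "x ` {..<n}"] by blast
      show "lower_central G (Suc (d + 1)) \<subseteq> ?H (Suc d)" by (auto intro: generate.incl)
      fix s assume "s \<in> x ` {..<n}"
      then obtain i where i: "i < n" "s = ?b (Leaf i)" by auto
      have "commutator G (?b t) (?b (Leaf i)) \<in> tree_span x n (length (foliage t) + length (foliage (Leaf i))) (max (foliage t) (foliage (Leaf i)))"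
        using t i by (intro commutator_in_tree_span[OF x]) (auto simp: lyndon_trees_def)
      then show "commutator G (?b t) s \<in> ?H (Suc d)"
        using span i t by (auto simp: lyndon_trees_def)
    qed (use False H in auto)
    \<comment> \<open>\<open>commutator_generate_in_subgroup\<close> gives additivity in the second
      argument only; the element of \<Gamma>^d is moved there by inverting commutators.\<close>
    have 2: "commutator G h g \<in> ?H (Suc d)" if h: "h \<in> carrier G" and g: "g \<in> lower_central G d" for h g
    proof (rule commutator_generate_in_subgroup[of _ 1 "?b ` lyndon_trees n d" d])
      show "h \<in> lower_central G 1" using h by simp
      show "?b ` lyndon_trees n d \<subseteq> lower_central G d" by (rule tree_span_generators[OF x])
      show "g \<in> ?H d" using g Suc.IH False by auto
      show "lower_central G (Suc (1 + d)) \<subseteq> ?H (Suc d)" by (auto intro: generate.incl)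
      fix s assume "s \<in> ?b ` lyndon_trees n d"
      then obtain t where t: "t \<in> lyndon_trees n d" "s = ?b t" by blast
      then have "?b t \<in> carrier G" using tree_span_generators[OF x] lower_central_closed by blast
      then show "commutator G h s \<in> ?H (Suc d)"
        using subgroup.m_inv_closed[OF H 1[OF t(1) h]] h t by (simp add: inv_commutator)
    qed (use False H in auto)
    have "(\<Union>a\<in>lower_central G d. \<Union>b\<in>carrier G. {commutator G a b}) \<subseteq> ?H (Suc d)"
    proof clarify
      fix a b assume ab: "a \<in> lower_central G d" "b \<in> carrier G"
      then show "commutator G a b \<in> ?H (Suc d)"
        using subgroup.m_inv_closed[OF H 2[OF ab(2,1)]] by (simp add: inv_commutator lower_central_closed)
    qed
    from generate_subgroup_incl[OF this H] show ?thesis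
      using lower_central_Suc[of d G] False by blast
  qed
qed simp

text \<open>Degrees are split off one at a time: the trees of degree \<open>l\<close> account for
  \<Gamma>^l modulo \<Gamma>^(l+1).\<close>

lemma lower_central_generated_between:
  assumes x: "x \<in> {..<n} \<rightarrow> carrier G" and gen: "carrier G = generate G (x ` {..<n})" and k: "0 < k" "k \<le> l"
  shows "lower_central G k \<subseteq> generate G (tree_commutator G x ` (\<Union>d\<in>{k..<l}. lyndon_trees n d) \<union> lower_central G l)"
  using k(2)
proof (induction l rule: dec_induct)
  case base
  then show ?case by (auto intro: generate.incl)
next
  case (step l)
  let ?b = "tree_commutator G x"
  let ?H = "generate G (?b ` (\<Union>d\<in>{k..<Suc l}. lyndon_trees n d) \<union> lower_central G (Suc l))"
  have H: "subgroup ?H G"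
    using tree_span_generators[OF x] lower_central_closed by (intro generate_is_subgroup) blast
  have "lower_central G l \<subseteq> generate G (?b ` lyndon_trees n l \<union> lower_central G (Suc l))"
    using lower_central_tree_generated[OF x gen] k step by simp
  also have "\<dots> \<subseteq> ?H" using step by (intro mono_generate Un_mono image_mono) auto
  finally have "lower_central G l \<subseteq> ?H" .
  moreover have "?b ` (\<Union>d\<in>{k..<l}. lyndon_trees n d) \<subseteq> ?H"
  proof -
    have "?b ` (\<Union>d\<in>{k..<l}. lyndon_trees n d) \<subseteq> ?b ` (\<Union>d\<in>{k..<Suc l}. lyndon_trees n d)"
      by (intro image_mono UN_mono) auto
    also have "\<dots> \<subseteq> ?H" by (intro subsetI generate.incl UnI1)
    finally show ?thesis .
  qed
  ultimately have "?b ` (\<Union>d\<in>{k..<l}. lyndon_trees n d) \<union> lower_central G l \<subseteq> ?H"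
    by simp
  then have "generate G (?b ` (\<Union>d\<in>{k..<l}. lyndon_trees n d) \<union> lower_central G l) \<subseteq> ?H"
    by (rule generate_subgroup_incl[OF _ H])
  then show ?case using step.IH by blast
qed

end

text \<open>Let u and v be the foliages of the two subtrees. In the bracket of their leading terms,
  the product in the order v, u cannot reach a word w \<le> uv: the prefix of w of length |v| would
  have to be at least v, while uv < v. The product in the order u, v reaches among these words only
  uv itself, with coefficient 1.\<close>

lemma (in group) tree_commutator_leading:
  assumes h: "h \<in> hom G series_units" and x: "x \<in> {..<n} \<rightarrow> carrier G"
    and hx: "\<And>i. i < n \<Longrightarrow> h (x i) = 1 + series_var i"
    and t: "lyndon t" "set (foliage t) \<subseteq> {..<n}"
  shows "vanishes_below (length (foliage t)) (h (tree_commutator G x t) - 1) \<and>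
    (\<forall>w. length w = length (foliage t) \<longrightarrow> w \<le> foliage t \<longrightarrow>
      coeff (h (tree_commutator G x t) - 1) w = (if w = foliage t then 1 else 0))"
  using t
proof (induction t)
  case (Leaf a)
  then show ?case using hx by (auto simp: vanishes_below_def series_var_def)
next
  case (Node s t)
  interpret h: group_hom G series_units h
    using h group_series_units by (simp add: group_hom_def group_hom_axioms_def)
  let ?u = "foliage s" and ?v = "foliage t"
  let ?p = "length ?u" and ?q = "length ?v"
  define a where "a = h (tree_commutator G x s)"
  define b where "b = h (tree_commutator G x t)"
  have c: "tree_commutator G x s \<in> carrier G" "tree_commutator G x t \<in> carrier G"
    using Node.prems tree_commutator_lower_central[OF x] lower_central_closed by (auto; blast)+
  then have ab: "a \<in> carrier series_units" "b \<in> carrier series_units"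
    using h.hom_closed by (auto simp: a_def b_def)
  have hc: "h (tree_commutator G x (Node s t)) = commutator series_units a b"
    using c by (simp add: h.hom_commutator a_def b_def)
  have s: "vanishes_below ?p (a - 1)" "\<And>w. length w = ?p \<Longrightarrow> w \<le> ?u \<Longrightarrow> coeff (a - 1) w = (if w = ?u then 1 else 0)"
    and t: "vanishes_below ?q (b - 1)" "\<And>w. length w = ?q \<Longrightarrow> w \<le> ?v \<Longrightarrow> coeff (b - 1) w = (if w = ?v then 1 else 0)"
    using Node unfolding a_def b_def by auto
  note lead = unit_commutator_leading[OF ab s(1) _ t(1)]
  show ?case
  proof (intro conjI allI impI)
    show "vanishes_below (length (foliage (Node s t))) (h (tree_commutator G x (Node s t)) - 1)"
      unfolding hc using lead(1) by simp
    fix w assume len: "length w = length (foliage (Node s t))" and w: "w \<le> foliage (Node s t)"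
    have "coeff (b - 1) (take ?q w) = 0"
    proof -
      have "take ?q w \<le> take ?q w @ drop ?q w" by (rule le_append)
      also have "\<dots> \<le> ?u @ ?v" using w by simp
      also have "\<dots> < ?v" by (rule lyndon_less_right[OF Node.prems(1)])
      finally show ?thesis using t(2)[of "take ?q w"] len by auto
    qed
    moreover have "coeff (a - 1) (take ?p w) * coeff (b - 1) (drop ?p w) = (if w = ?u @ ?v then 1 else 0)"
    proof -
      have "take ?p w @ drop ?p w \<le> ?u @ ?v" using w by simp
      then have "take ?p w < ?u \<or> take ?p w = ?u \<and> drop ?p w \<le> ?v"
        using append_less_append_iff[of "take ?p w" ?u "drop ?p w" ?v] len
        by (auto simp: order.order_iff_strict)
      then show ?thesis
      proof
        assume "take ?p w < ?u"
        then show ?thesis using s(2)[of "take ?p w"] len by auto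
      next
        assume a: "take ?p w = ?u \<and> drop ?p w \<le> ?v"
        then have "w = ?u @ ?v \<longleftrightarrow> drop ?p w = ?v" by (metis append_take_drop_id same_append_eq)
        then show ?thesis using a s(2)[of ?u] t(2)[of "drop ?p w"] len by simp
      qed
    qed
    ultimately show "coeff (h (tree_commutator G x (Node s t)) - 1) w = (if w = foliage (Node s t) then 1 else 0)"
      unfolding hc using lead(2)[of w] len by simp
  qed
qed

subsection \<open>The sections of the lower central series of a free group\<close>

context group
begin

lemma central_section_normal:
  "k \<le> l \<Longrightarrow> lower_central G l \<lhd> G\<lparr>carrier := lower_central G k\<rparr>"
  by (intro normal_restrict_supergroup lower_central_subgroup lower_central_normal lower_central_antimono)

lemma group_central_section: "k \<le> l \<Longrightarrow> group (central_section G k l)"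
  unfolding central_section_def by (rule normal.factorgroup_is_group[OF central_section_normal])

lemma carrier_central_section:
  "carrier (central_section G k l) = (\<lambda>u. lower_central G l #> u) ` lower_central G k"
  by (simp add: central_section_def carrier_FactGroup r_coset_def)

lemma one_central_section: "\<one>\<^bsub>central_section G k l\<^esub> = lower_central G l"
  by (simp add: central_section_def)

lemma mult_central_section:
  assumes "u \<in> lower_central G k" "v \<in> lower_central G k"
  shows "(lower_central G l #> u) \<otimes>\<^bsub>central_section G k l\<^esub> (lower_central G l #> v) = lower_central G l #> (u \<otimes> v)"
proof -
  have "(lower_central G l #> u) \<otimes>\<^bsub>central_section G k l\<^esub> (lower_central G l #> v)
      = (lower_central G l #> u) <#> (lower_central G l #> v)"
    by (simp add: central_section_def set_mult_def)
  then show ?thesis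
    using normal.rcos_sum[OF lower_central_normal] assms lower_central_closed by simp
qed

lemma central_section_hom:
  assumes "k \<le> l"
  shows "group_hom (G\<lparr>carrier := lower_central G k\<rparr>) (central_section G k l) (\<lambda>u. lower_central G l #> u)"
proof -
  have "(\<lambda>u. lower_central G l #> u) \<in> hom (G\<lparr>carrier := lower_central G k\<rparr>) (central_section G k l)"
    by (rule homI) (auto simp: carrier_central_section mult_central_section)
  then show ?thesis
    using group_central_section[OF assms] subgroup.subgroup_is_group[OF lower_central_subgroup is_group]
    by (simp add: group_hom_def group_hom_axioms_def)
qed

text \<open>Commutators of elements of \<Gamma>^k have weight 2k, hence die modulo \<Gamma>^l for l
  \<le> 2k.\<close>

lemma comm_group_central_section:
  assumes "0 < k" "k \<le> l" "l \<le> 2 * k"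
  shows "comm_group (central_section G k l)"
proof (rule group.group_comm_groupI[OF group_central_section[OF assms(2)]])
  fix C D assume "C \<in> carrier (central_section G k l)" "D \<in> carrier (central_section G k l)"
  then obtain u v where u: "u \<in> lower_central G k" "C = lower_central G l #> u"
    and v: "v \<in> lower_central G k" "D = lower_central G l #> v"
    by (auto simp: carrier_central_section)
  have c: "u \<in> carrier G" "v \<in> carrier G" using u v lower_central_closed by blast+
  have "commutator G u v \<in> lower_central G (k + k)"
    by (rule commutator_in_lower_central[OF u(1) v(1) assms(1,1)])
  then have "commutator G u v \<in> lower_central G l"
    using lower_central_antimono[of l "k + k"] assms(3) by auto
  moreover have "commutator G u v = (u \<otimes> v) \<otimes> inv (v \<otimes> u)"
    using c by (simp add: commutator_def inv_mult_group m_assoc)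
  ultimately have "lower_central G l #> (u \<otimes> v) = lower_central G l #> (v \<otimes> u)"
    using rcos_eq_iff[OF lower_central_normal, of "u \<otimes> v" "v \<otimes> u" l] c by simp
  then show "C \<otimes>\<^bsub>central_section G k l\<^esub> D = D \<otimes>\<^bsub>central_section G k l\<^esub> C"
    using u v by (simp add: mult_central_section)
qed

end

text \<open>The universal property supplies the evaluation homomorphism; once its values are
  identified as finite products, independence says that its kernel is trivial and generation that it
  is onto.\<close>

lemma (in comm_group) iso_free_Abelian_groupI:
  fixes e :: "'s \<Rightarrow> 'a"
  assumes S: "finite S" and e: "e \<in> S \<rightarrow> carrier G"
    and gen: "carrier G \<subseteq> generate G (e ` S)"
    and indep: "\<And>c :: 's \<Rightarrow> int. finprod G (\<lambda>s. e s [^] c s) S = \<one> \<Longrightarrow> \<forall>s\<in>S. c s = 0"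
  shows "free_Abelian_group S \<cong> G"
proof -
  have eS: "e ` S \<subseteq> carrier G" using e by auto
  obtain h where h: "h \<in> hom (free_Abelian_group S) G" "\<And>s. s \<in> S \<Longrightarrow> h (frag_of s) = e s"
    using free_Abelian_group_universal[OF eS] by blast
  interpret h: group_hom "free_Abelian_group S" G h
    using h(1) by (simp add: group_hom_def group_hom_axioms_def is_group)
  have val: "h c = finprod G (\<lambda>s. e s [^] poly_mapping.lookup c s) S" if "Poly_Mapping.keys c \<subseteq> S" for c
    using that
  proof (rule free_Abelian_group_induct)
    have "finprod G (\<lambda>s. \<one>) S = \<one>" by simp
    then show "h 0 = finprod G (\<lambda>s. e s [^] poly_mapping.lookup (0 :: 's \<Rightarrow>\<^sub>0 int) s) S"
      using h.hom_one by simp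
  next
    fix a b :: "'s \<Rightarrow>\<^sub>0 int"
    assume 2: "Poly_Mapping.keys a \<subseteq> S" "Poly_Mapping.keys b \<subseteq> S"
      "h a = finprod G (\<lambda>s. e s [^] poly_mapping.lookup a s) S"
      "h b = finprod G (\<lambda>s. e s [^] poly_mapping.lookup b s) S"
    let ?p = "\<lambda>c. finprod G (\<lambda>s. e s [^] poly_mapping.lookup c s) S"
    have keys: "Poly_Mapping.keys (a - b) \<subseteq> S" using keys_diff[of a b] 2(1,2) by blast
    have p: "?p (a - b) \<in> carrier G" by (rule finprod_closed) (use e in auto)
    have ha: "h b \<in> carrier G" "h (a - b) \<in> carrier G"
      using h.hom_closed[of b] h.hom_closed[of "a - b"] 2(2) keys by simp_all
    \<comment> \<open>The induction on the free abelian group proceeds through differences, and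
      adding \<open>b\<close> back avoids inverses in the product.\<close>
    have "h (a - b) \<otimes> h b = h a"
      using h.hom_mult[of "a - b" b] 2(1,2) keys by simp
    also have "\<dots> = finprod G (\<lambda>s. e s [^] poly_mapping.lookup (a - b) s \<otimes> e s [^] poly_mapping.lookup b s) S"
      unfolding 2(3)
      by (rule finprod_cong') (use e in \<open>auto simp: Pi_iff lookup_minus simp flip: int_pow_mult\<close>)
    also have "\<dots> = ?p (a - b) \<otimes> h b"
      unfolding 2(4) by (rule finprod_multf) (use e in \<open>auto simp: Pi_iff\<close>)
    finally show "h (a - b) = ?p (a - b)" using ha p by (simp only: right_cancel)
  next
    fix a assume 3: "a \<in> S"
    have "finprod G (\<lambda>s. e s [^] poly_mapping.lookup (frag_of a) s) S = finprod G (\<lambda>s. if a = s then e s else \<one>) S"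
      by (rule finprod_cong') (use e in \<open>auto simp: Pi_iff lookup_single when_def\<close>)
    also have "\<dots> = e a" by (rule finprod_singleton[OF 3 S e])
    finally show "h (frag_of a) = finprod G (\<lambda>s. e s [^] poly_mapping.lookup (frag_of a) s) S"
      using h(2)[OF 3] by simp
  qed
  have "h \<in> iso (free_Abelian_group S) G"
    unfolding iso_kernel_image[OF h.G.is_group is_group]
  proof (intro conjI h(1))
    have "c = 0" if c: "Poly_Mapping.keys c \<subseteq> S" and hc: "h c = \<one>" for c
    proof (rule poly_mapping_eqI)
      fix s
      have "\<forall>s\<in>S. poly_mapping.lookup c s = 0" 
        by (rule indep[OF HOL.trans[OF val[OF c, symmetric] hc]])
      then show "poly_mapping.lookup c s = poly_mapping.lookup 0 s"
        using c by (cases "s \<in> S") (auto simp: in_keys_iff)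
    qed
    then show "kernel (free_Abelian_group S) G h = {\<one>\<^bsub>free_Abelian_group S\<^esub>}"
      using h.hom_one by (auto simp: kernel_def)
    have "generate G (e ` S) \<subseteq> h ` carrier (free_Abelian_group S)"
    proof (rule generate_subgroup_incl[OF _ h.img_is_subgroup])
      show "e ` S \<subseteq> h ` carrier (free_Abelian_group S)"
        using h(2) by (force intro!: image_eqI[of _ h "frag_of _"])
    qed
    then show "h ` carrier (free_Abelian_group S) = carrier G"
      using gen h.hom_closed by blast
  qed
  then show ?thesis by (auto simp: is_iso_def)
qed

text \<open>The Magnus expansion. Taking the constant term is multiplicative, so its value 1 on the
  basis extends to all of \<open>F\<close>.\<close>

lemma free_basis_magnus:
  assumes "free_basis F {..<n} x"
  obtains \<mu> where "\<mu> \<in> hom F series_units" "\<And>i. i < n \<Longrightarrow> \<mu> (x i) = 1 + series_var i"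
    "\<And>g. g \<in> carrier F \<Longrightarrow> coeff (\<mu> g) [] = 1"
proof -
  interpret F: group F by (rule free_basisD(1)[OF assms])
  obtain \<mu> where \<mu>: "\<mu> \<in> hom F series_units" "\<And>i. i \<in> {..<n} \<Longrightarrow> \<mu> (x i) = 1 + series_var i"
    using free_basis_hom_ex[OF assms group_series_units, of "\<lambda>i. 1 + series_var i"] one_plus_var_unit by blast
  interpret \<mu>: group_hom F series_units \<mu>
    using \<mu>(1) group_series_units F.is_group by (simp add: group_hom_def group_hom_axioms_def)
  have xF: "x ` {..<n} \<subseteq> carrier F" using free_basisD(2)[OF assms] by auto
  have "coeff (\<mu> g) [] = 1" if "g \<in> generate F (x ` {..<n})" for g
    using that
  proof (induction rule: generate.induct)
    case one
    then show ?case using \<mu>.hom_one by simp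
  next
    case (incl h)
    then show ?case using \<mu>(2) by (auto simp: series_var_def)
  next
    case (inv h)
    then have "h \<in> carrier F" using xF by blast
    moreover have "coeff (\<mu> h) [] = 1" using inv \<mu>(2) by (auto simp: series_var_def)
    moreover have "coeff (\<mu> h * inv\<^bsub>series_units\<^esub> \<mu> h) [] = 1"
      using series_units_inv(1)[OF \<mu>.hom_closed] calculation(1) by simp
    ultimately show ?case by (simp add: coeff_mult)
  next
    case (eng h1 h2)
    then have "h1 \<in> carrier F" "h2 \<in> carrier F" using F.generate_in_carrier[OF xF] by auto
    then show ?case using eng \<mu>.hom_mult[of h1 h2] by (simp add: coeff_mult)
  qed
  then have "coeff (\<mu> g) [] = 1" if "g \<in> carrier F" for g
    using that free_basis_generated[OF assms] by blast
  with \<mu> show thesis by (intro that[of \<mu>]) simp_all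
qed

text \<open>Independence: in a relation among the generators, the Magnus coefficient at the foliage of a
  tree \<open>t\<close> that is minimal (first by length, then lexicographically) among those occurring equals
  the exponent of \<open>t\<close>.\<close>

lemma free_group_central_section_free:
  assumes basis: "free_basis F {..<n} x" and kl: "0 < k" "k \<le> l" "l \<le> 2 * k"
  shows "free_Abelian_group (\<Union>d\<in>{k..<l}. lyndon_trees n d) \<cong> central_section F k l"
proof -
  interpret F: group F by (rule free_basisD(1)[OF basis])
  let ?M = "central_section F k l" and ?T = "\<Union>d\<in>{k..<l}. lyndon_trees n d"
  let ?b = "tree_commutator F x" and ?\<pi> = "\<lambda>u. lower_central F l #>\<^bsub>F\<^esub> u"
  let ?K = "F\<lparr>carrier := lower_central F k\<rparr>"
  interpret M: comm_group ?M by (rule F.comm_group_central_section[OF kl])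
  interpret \<pi>: group_hom ?K ?M ?\<pi> by (rule F.central_section_hom[OF kl(2)])
  have x: "x \<in> {..<n} \<rightarrow> carrier F" using free_basisD(2)[OF basis] .
  have bd: "?b t \<in> lower_central F d" if "t \<in> lyndon_trees n d" for t d
    using F.tree_span_generators[OF x] that by blast
  have bk: "?b t \<in> lower_central F k" if "t \<in> ?T" for t
  proof -
    obtain d where "d \<in> {k..<l}" "t \<in> lyndon_trees n d" using \<open>t \<in> ?T\<close> by (elim UN_E)
    then show ?thesis using bd F.lower_central_antimono[of k d] by auto
  qed
  obtain \<mu> where \<mu>: "\<mu> \<in> hom F series_units" "\<And>i. i < n \<Longrightarrow> \<mu> (x i) = 1 + series_var i"
    "\<And>g. g \<in> carrier F \<Longrightarrow> coeff (\<mu> g) [] = 1"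
    using free_basis_magnus[OF basis] by blast
  interpret \<mu>: group_hom F series_units \<mu>
    using \<mu>(1) group_series_units F.is_group by (simp add: group_hom_def group_hom_axioms_def)
  have vanish: "vanishes_below d (\<mu> g - 1)" if "g \<in> lower_central F d" "0 < d" for g d
    by (rule F.series_hom_lower_central[OF \<mu>(1) _ that]) (rule \<mu>(3))
  have lead: "vanishes_below (length (foliage t)) (\<mu> (?b t) - 1) \<and>
      (\<forall>w. length w = length (foliage t) \<longrightarrow> w \<le> foliage t \<longrightarrow>
        coeff (\<mu> (?b t) - 1) w = (if w = foliage t then 1 else 0))"
    if "lyndon t" "set (foliage t) \<subseteq> {..<n}" for t
    by (rule F.tree_commutator_leading[OF \<mu>(1) x _ that]) (rule \<mu>(2))
  have sub: "subgroup (lower_central F k) F" by (rule F.lower_central_subgroup)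
  have finite: "finite ?T" using finite_lyndon_trees by blast
  show ?thesis
  proof (rule M.iso_free_Abelian_groupI[OF finite, of "\<lambda>t. ?\<pi> (?b t)"])
    show "(\<lambda>t. ?\<pi> (?b t)) \<in> ?T \<rightarrow> carrier ?M"
      using bk by (simp add: F.carrier_central_section Pi_iff)
    show "carrier ?M \<subseteq> generate ?M ((\<lambda>t. ?\<pi> (?b t)) ` ?T)"
    proof
      fix C assume "C \<in> carrier ?M"
      then obtain u where u: "u \<in> lower_central F k" "C = ?\<pi> u" by (auto simp: F.carrier_central_section)
      let ?g = "generate ?M ((\<lambda>t. ?\<pi> (?b t)) ` ?T)"
      have g: "subgroup ?g ?M"
        by (rule M.generate_is_subgroup) (use bk in \<open>auto simp: F.carrier_central_section\<close>)
      have S: "?b ` ?T \<union> lower_central F l \<subseteq> lower_central F k"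
        using bk F.lower_central_antimono[OF kl(2)] by auto
      have "u \<in> generate F (?b ` ?T \<union> lower_central F l)"
        using F.lower_central_generated_between[OF x free_basis_generated[OF basis] kl(1,2)] u by blast
      \<comment> \<open>The generation statement is moved from \<open>F\<close> into the subgroup
        \<Gamma>^k, where the projection to the section is a homomorphism.\<close>
      then have "u \<in> generate ?K (?b ` ?T \<union> lower_central F l)"
        using F.generate_consistent[OF S sub] by simp
      then have "?\<pi> u \<in> generate ?M (?\<pi> ` (?b ` ?T \<union> lower_central F l))"
        using \<pi>.generate_img[of "?b ` ?T \<union> lower_central F l"] S by auto
      moreover have "?\<pi> ` (?b ` ?T \<union> lower_central F l) \<subseteq> ?g"
      proof -
        have "?\<pi> v = \<one>\<^bsub>?M\<^esub>" if "v \<in> lower_central F l" for v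
          using F.rcos_eq_self_iff[OF F.lower_central_normal] that F.lower_central_closed
          by (simp add: F.one_central_section)
        then show ?thesis using generate.one[of ?M] by (auto intro: generate.incl)
      qed
      ultimately show "C \<in> ?g" using M.generate_subgroup_incl[OF _ g] u(2) by blast
    qed
    fix c :: "lie_tree \<Rightarrow> int"
    assume rel: "finprod ?M (\<lambda>t. ?\<pi> (?b t) [^]\<^bsub>?M\<^esub> c t) ?T = \<one>\<^bsub>?M\<^esub>"
    show "\<forall>t\<in>?T. c t = 0"
    proof (rule ccontr)
      assume "\<not> (\<forall>t\<in>?T. c t = 0)"
      then have ne: "{t\<in>?T. c t \<noteq> 0} \<noteq> {}" by blast
      define d where "d = Min ((\<lambda>t. length (foliage t)) ` {t\<in>?T. c t \<noteq> 0})"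
      have dmin: "d \<le> length (foliage t)" if "t \<in> ?T" "c t \<noteq> 0" for t
        unfolding d_def using finite that by (intro Min_le) auto
      have "d \<in> (\<lambda>t. length (foliage t)) ` {t\<in>?T. c t \<noteq> 0}"
        unfolding d_def using finite ne by (intro Min_in) auto
      then have ne2: "{t\<in>?T. c t \<noteq> 0 \<and> length (foliage t) = d} \<noteq> {}" by blast
      define w where "w = Min (foliage ` {t\<in>?T. c t \<noteq> 0 \<and> length (foliage t) = d})"
      have wmin: "w \<le> foliage t" if "t \<in> ?T" "c t \<noteq> 0" "length (foliage t) = d" for t
        unfolding w_def using finite that by (intro Min_le) auto
      have "w \<in> foliage ` {t\<in>?T. c t \<noteq> 0 \<and> length (foliage t) = d}"
        unfolding w_def using finite ne2 by (intro Min_in) auto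
      then obtain t0 where t0: "t0 \<in> ?T" "c t0 \<noteq> 0" "length (foliage t0) = d" "w = foliage t0" by blast
      have len: "length w = d" using t0 by simp
      have d: "0 < d" "d < l"
        using t0 kl(1) by (auto simp: lyndon_trees_def)
      \<comment> \<open>Trees longer than \<open>d\<close> contribute nothing in degree
        \<open>d\<close>; among those of length \<open>d\<close> the word \<open>w\<close> is at
        most every foliage, so only \<open>t0\<close> has a nonzero coefficient at
        \<open>w\<close>.\<close>
      have coeff_b: "vanishes_below d (\<mu> (?b t) - 1) \<and> coeff (\<mu> (?b t) - 1) w = (if t = t0 then 1 else 0)"
        if t: "t \<in> ?T" "c t \<noteq> 0" for t
      proof -
        have lt: "lyndon t" "set (foliage t) \<subseteq> {..<n}" and lt0: "lyndon t0"
          using t(1) t0(1) by (auto simp: lyndon_trees_def)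
        have v: "vanishes_below (length (foliage t)) (\<mu> (?b t) - 1)" using lead[OF lt] by blast
        show ?thesis
        proof (cases "length (foliage t) = d")
          case True
          then have "coeff (\<mu> (?b t) - 1) w = (if w = foliage t then 1 else 0)"
            using lead[OF lt] wmin[OF t True] len by blast
          moreover have "w = foliage t \<longleftrightarrow> t = t0"
            unfolding t0(4) using lyndon_foliage_inj[OF lt(1) lt0] by metis
          ultimately have "coeff (\<mu> (?b t) - 1) w = (if t = t0 then 1 else 0)" by (simp only:)
          then show ?thesis using v unfolding True by blast
        next
          case False
          then have "d < length (foliage t)" using dmin[OF t] by simp
          then show ?thesis
            using v len t0(3) vanishes_below_mono[OF v, of d] by (auto simp: vanishes_below_def)
        qed
      qed
      have powM: "?\<pi> (?b t) [^]\<^bsub>?M\<^esub> c t \<in> carrier ?M" if "t \<in> ?T" for t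
        by (rule M.int_pow_closed) (use bk[OF that] in \<open>auto simp: F.carrier_central_section\<close>)
      \<comment> \<open>The expansion \<mu> is not defined on the section, so the product is lifted
        factor by factor to an element of \<Gamma>^k while its coefficients are tracked.\<close>
      have "\<exists>g\<in>lower_central F k. ?\<pi> g = finprod ?M (\<lambda>t. ?\<pi> (?b t) [^]\<^bsub>?M\<^esub> c t) S \<and>
          vanishes_below d (\<mu> g - 1) \<and> coeff (\<mu> g - 1) w = (if t0 \<in> S then c t0 else 0)"
        if "S \<subseteq> ?T" for S
        using finite_subset[OF that finite] that
      proof (induction S rule: finite_induct)
        case empty
        have "?\<pi> \<one>\<^bsub>F\<^esub> = \<one>\<^bsub>?M\<^esub>" using \<pi>.hom_one by simp
        moreover have "vanishes_below d (\<mu> \<one>\<^bsub>F\<^esub> - 1)" "coeff (\<mu> \<one>\<^bsub>F\<^esub> - 1) w = 0"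
          using \<mu>.hom_one by (simp_all add: vanishes_below_def)
        ultimately show ?case
          using subgroup.one_closed[OF sub] by (intro bexI[of _ "\<one>\<^bsub>F\<^esub>"]) simp_all
      next
        case (insert t S)
        then obtain g where g: "g \<in> lower_central F k" "?\<pi> g = finprod ?M (\<lambda>t. ?\<pi> (?b t) [^]\<^bsub>?M\<^esub> c t) S"
          "vanishes_below d (\<mu> g - 1)" "coeff (\<mu> g - 1) w = (if t0 \<in> S then c t0 else 0)" by auto
        have t: "t \<in> ?T" using insert by simp
        have S: "S \<subseteq> ?T" using insert by simp
        let ?p = "?b t [^]\<^bsub>F\<^esub> c t"
        have bF: "?b t \<in> carrier F" "g \<in> carrier F" "?p \<in> carrier F"
          using bk[OF t] g(1) F.lower_central_closed by simp_all
        have pk: "?p \<in> lower_central F k" by (rule F.subgroup_int_pow_closed[OF sub bk[OF t]])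
        have \<pi>p: "?\<pi> ?p = ?\<pi> (?b t) [^]\<^bsub>?M\<^esub> c t"
          using \<pi>.hom_int_pow[of "?b t" "c t"] bk[OF t] F.int_pow_consistent[OF sub bk[OF t], of "c t"] by simp
        have \<mu>p: "\<mu> ?p = \<mu> (?b t) [^]\<^bsub>series_units\<^esub> c t"
          by (rule \<mu>.hom_int_pow[OF bF(1)])
        have p: "vanishes_below d (\<mu> ?p - 1) \<and> coeff (\<mu> ?p - 1) w = (if t = t0 then c t0 else 0)"
        \<comment> \<open>A tree with exponent 0 may be shorter than \<open>d\<close>, where
          \<open>coeff_b\<close> says nothing; its power is trivial anyway.\<close>
        proof (cases "c t = 0")
          case True
          have "\<mu> ?p = 1" using \<mu>.hom_one True by simp
          then show ?thesis using True by (auto simp: vanishes_below_def)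
        next
          case False
          have v: "vanishes_below d (\<mu> (?b t) - 1)" and cf: "coeff (\<mu> (?b t) - 1) w = (if t = t0 then 1 else 0)"
            using coeff_b[OF t False] by blast+
          show ?thesis
            unfolding \<mu>p using series_units_pow_leading(1)[OF \<mu>.hom_closed[OF bF(1)] v d(1)]
              series_units_pow_leading(2)[OF \<mu>.hom_closed[OF bF(1)] v d(1) len, of "c t"] cf
            by (metis mult.right_neutral mult_zero_right)
        qed
        have "?\<pi> (?p \<otimes>\<^bsub>F\<^esub> g) = ?\<pi> ?p \<otimes>\<^bsub>?M\<^esub> ?\<pi> g"
          using F.mult_central_section[OF pk g(1)] by simp
        also have "\<dots> = finprod ?M (\<lambda>t. ?\<pi> (?b t) [^]\<^bsub>?M\<^esub> c t) (insert t S)"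
          unfolding \<pi>p g(2)
          by (rule M.finprod_insert[symmetric, OF insert.hyps])
            (use powM S t in blast)+
        finally have 1: "?\<pi> (?p \<otimes>\<^bsub>F\<^esub> g) = finprod ?M (\<lambda>t. ?\<pi> (?b t) [^]\<^bsub>?M\<^esub> c t) (insert t S)" .
        have 2: "\<mu> (?p \<otimes>\<^bsub>F\<^esub> g) = \<mu> ?p * \<mu> g" using \<mu>.hom_mult[OF bF(3,2)] by simp
        have 3: "vanishes_below d (\<mu> ?p * \<mu> g - 1)"
          by (rule unit_mult_leading(1)[OF _ g(3) d(1)]) (use p in blast)
        have 4: "coeff (\<mu> ?p * \<mu> g - 1) w = coeff (\<mu> ?p - 1) w + coeff (\<mu> g - 1) w"
          by (rule unit_mult_leading(2)[OF _ g(3) d(1) len]) (use p in blast)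
        have "coeff (\<mu> ?p * \<mu> g - 1) w = (if t0 \<in> insert t S then c t0 else 0)"
          unfolding 4 g(4) using p insert.hyps(2) by auto
        then show ?case
          using 1 2 3 subgroup.m_closed[OF sub pk g(1)] by (intro bexI[of _ "?p \<otimes>\<^bsub>F\<^esub> g"]) simp_all
      qed
      from this[OF order.refl] obtain g where g: "g \<in> lower_central F k"
        "?\<pi> g = \<one>\<^bsub>?M\<^esub>" "coeff (\<mu> g - 1) w = c t0"
        using t0(1) rel by auto
      \<comment> \<open>The relation puts \<open>g\<close> into \<Gamma>^l, so its expansion
        vanishes in all positive degrees below \<open>l\<close>, including degree \<open>d\<close>,
        against the coefficient \<open>c t0\<close>.\<close>
      have "g \<in> lower_central F l"
        using F.rcos_eq_self_iff[OF F.lower_central_normal F.lower_central_closed[OF g(1)]] g(2)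
        by (simp add: F.one_central_section)
      then have "vanishes_below l (\<mu> g - 1)" using vanish kl by auto
      then show False using g(3) t0(2) len d(2) by (simp add: vanishes_below_def)
    qed
  qed
qed

subsection \<open>Homomorphisms from the abelianization of a free group\<close>

lemma to_H1_hom:
  assumes "group F" shows "to_H1 F \<in> hom F (H1 F)"
proof -
  have "to_H1 F = (\<lambda>g. derived F (carrier F) #>\<^bsub>F\<^esub> g)" by (simp add: fun_eq_iff to_H1_def)
  then show ?thesis
    using normal.r_coset_hom_Mod[OF group.derived_self_is_normal[OF assms]] by (simp add: H1_def)
qed

lemma carrier_H1: "carrier (H1 F) = to_H1 F ` carrier F"
  by (auto simp: H1_def carrier_FactGroup to_H1_def)

lemma group_H1: "group F \<Longrightarrow> group (H1 F)"
  unfolding H1_def by (rule group.derived_quot_is_group)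

lemma hom_group_simps [simp]:
  "carrier (hom_group G M) = hom G M \<inter> extensional (carrier G)"
  "\<one>\<^bsub>hom_group G M\<^esub> = (\<lambda>x\<in>carrier G. \<one>\<^bsub>M\<^esub>)"
  "f \<otimes>\<^bsub>hom_group G M\<^esub> g = (\<lambda>x\<in>carrier G. f x \<otimes>\<^bsub>M\<^esub> g x)"
  by (simp_all add: hom_group_def)

lemma (in comm_group) group_hom_group:
  assumes H: "group H"
  shows "group (hom_group H G)"
proof -
  interpret H: group H by (rule H)
  have rest: "restrict f (carrier H) \<in> hom H G" if "f \<in> hom H G" for f
    using that by (auto simp: hom_def Pi_iff)
  show ?thesis
  proof (rule groupI)
    fix f g assume "f \<in> carrier (hom_group H G)" "g \<in> carrier (hom_group H G)"
    then show "f \<otimes>\<^bsub>hom_group H G\<^esub> g \<in> carrier (hom_group H G)"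
      using rest[OF hom_group_mult[of f H g]] by simp
  next
    show "\<one>\<^bsub>hom_group H G\<^esub> \<in> carrier (hom_group H G)"
      using rest[of "\<lambda>_. \<one>"] by (simp add: hom_def)
  next
    fix f g h assume "f \<in> carrier (hom_group H G)" "g \<in> carrier (hom_group H G)" "h \<in> carrier (hom_group H G)"
    then show "f \<otimes>\<^bsub>hom_group H G\<^esub> g \<otimes>\<^bsub>hom_group H G\<^esub> h = f \<otimes>\<^bsub>hom_group H G\<^esub> (g \<otimes>\<^bsub>hom_group H G\<^esub> h)"
      by (auto intro!: restrict_ext simp: m_assoc hom_in_carrier)
  next
    fix f assume f: "f \<in> carrier (hom_group H G)"
    then show "\<one>\<^bsub>hom_group H G\<^esub> \<otimes>\<^bsub>hom_group H G\<^esub> f = f"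
      by (auto simp: fun_eq_iff extensional_def hom_in_carrier restrict_def)
    have "(\<lambda>x. inv f x) \<in> hom H G"
      using f by (auto simp: hom_def Pi_iff inv_mult)
    then have "restrict (\<lambda>x. inv f x) (carrier H) \<in> carrier (hom_group H G)" using rest by simp
    moreover have "restrict (\<lambda>x. inv f x) (carrier H) \<otimes>\<^bsub>hom_group H G\<^esub> f = \<one>\<^bsub>hom_group H G\<^esub>"
      using f by (auto intro!: restrict_ext simp: hom_in_carrier)
    ultimately show "\<exists>g\<in>carrier (hom_group H G). g \<otimes>\<^bsub>hom_group H G\<^esub> f = \<one>\<^bsub>hom_group H G\<^esub>" by blast
  qed
qed

lemma hom_H1_eq:
  assumes basis: "free_basis F S x" and M: "group M"
    and h: "h \<in> carrier (hom_group (H1 F) M)" "h' \<in> carrier (hom_group (H1 F) M)"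
    and eq: "\<And>i. i \<in> S \<Longrightarrow> h (to_H1 F (x i)) = h' (to_H1 F (x i))"
  shows "h = h'"
proof (rule extensionalityI[of _ "carrier (H1 F)"])
  note F = free_basisD(1)[OF basis]
  fix C assume "C \<in> carrier (H1 F)"
  then obtain g where g: "g \<in> carrier F" "C = to_H1 F g" by (auto simp: carrier_H1)
  have "(h \<circ> to_H1 F) g = (h' \<circ> to_H1 F) g"
    by (rule free_basis_hom_eq[OF basis M Group.hom_compose[OF to_H1_hom[OF F]]
        Group.hom_compose[OF to_H1_hom[OF F]] _ g(1)]) (use h eq in auto)
  then show "h C = h' C" using g by simp
qed (use h in auto)

text \<open>A homomorphism from \<open>F\<close> to an abelian group sends the derived subgroup into
  a trivial one and so descends to the abelianization.\<close>

lemma hom_H1_ex: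
  assumes basis: "free_basis F S x" and M: "comm_group M" and m: "m \<in> S \<rightarrow> carrier M"
  obtains h where "h \<in> carrier (hom_group (H1 F) M)" "\<And>i. i \<in> S \<Longrightarrow> h (to_H1 F (x i)) = m i"
proof -
  interpret F: group F by (rule free_basisD(1)[OF basis])
  interpret M: comm_group M by (rule M)
  obtain f where f: "f \<in> hom F M" "\<And>i. i \<in> S \<Longrightarrow> f (x i) = m i"
    using free_basis_hom_ex[OF basis M.is_group m] by blast
  interpret f: group_hom F M f using f(1) by unfold_locales
  have "\<exists>h. h \<in> hom (H1 F) M \<and> (\<forall>g\<in>carrier F. h (to_H1 F g) = f g)"
    unfolding H1_def to_H1_def
  proof (rule FactGroup_universal[OF f(1) F.derived_self_is_normal])
    fix u v assume uv: "u \<in> carrier F" "v \<in> carrier F" "derived F (carrier F) #>\<^bsub>F\<^esub> u = derived F (carrier F) #>\<^bsub>F\<^esub> v"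
    then have "u \<otimes>\<^bsub>F\<^esub> inv\<^bsub>F\<^esub> v \<in> lower_central F 2"
      using F.rcos_eq_iff[OF F.derived_self_is_normal] by (simp add: F.lower_central_2)
    then have "f (u \<otimes>\<^bsub>F\<^esub> inv\<^bsub>F\<^esub> v) \<in> derived M (carrier M)"
      using f.lower_central_hom M.lower_central_2 by blast
    then have "f u \<otimes>\<^bsub>M\<^esub> inv\<^bsub>M\<^esub> f v = \<one>\<^bsub>M\<^esub>"
      using uv by (simp add: M.derived_eq_singleton)
    then show "f u = f v"
      using uv by (metis M.inv_equality M.inv_inv f.hom_closed M.inv_closed)
  qed blast
  then obtain h where h: "h \<in> hom (H1 F) M" "\<forall>g\<in>carrier F. h (to_H1 F g) = f g" by blast
  let ?h = "restrict h (carrier (H1 F))"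
  have H: "group (H1 F)" by (rule group_H1[OF F.is_group])
  have "?h \<in> carrier (hom_group (H1 F) M)"
    using h(1) monoid.m_closed[OF group.is_monoid[OF H]] by (auto simp: hom_def Pi_iff)
  moreover have "?h (to_H1 F (x i)) = m i" if "i \<in> S" for i
  proof -
    have "x i \<in> carrier F" using that free_basisD(2)[OF basis] by auto
    then show ?thesis using that h(2) f(2) by (simp add: carrier_H1)
  qed
  ultimately show thesis using that by blast
qed

lemma hom_group_H1_iso_product:
  assumes basis: "free_basis F S x" and M: "comm_group M"
  shows "hom_group (H1 F) M \<cong> product_group S (\<lambda>_. M)"
proof -
  interpret M: comm_group M by (rule M)
  let ?e = "\<lambda>h. \<lambda>i\<in>S. h (to_H1 F (x i))"
  have x: "to_H1 F (x i) \<in> carrier (H1 F)" if "i \<in> S" for i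
    using that free_basisD(2)[OF basis] by (auto simp: carrier_H1)
  have "?e \<in> hom (hom_group (H1 F) M) (product_group S (\<lambda>_. M))"
    by (rule homI) (auto intro!: restrict_ext simp: x hom_in_carrier)
  moreover have "bij_betw ?e (carrier (hom_group (H1 F) M)) (carrier (product_group S (\<lambda>_. M)))"
  proof (rule bij_betw_imageI)
    show "inj_on ?e (carrier (hom_group (H1 F) M))"
    proof (rule inj_onI)
      fix h h' assume h: "h \<in> carrier (hom_group (H1 F) M)" "h' \<in> carrier (hom_group (H1 F) M)" "?e h = ?e h'"
      show "h = h'"
        by (rule hom_H1_eq[OF basis M.is_group h(1,2)]) (use h(3) in \<open>metis restrict_apply'\<close>)
    qed
    show "?e ` carrier (hom_group (H1 F) M) = carrier (product_group S (\<lambda>_. M))"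
    proof (intro equalityI subsetI)
      fix m assume m: "m \<in> carrier (product_group S (\<lambda>_. M))"
      then have "m \<in> S \<rightarrow> carrier M" by auto
      then obtain h where h: "h \<in> carrier (hom_group (H1 F) M)" "\<And>i. i \<in> S \<Longrightarrow> h (to_H1 F (x i)) = m i"
        using hom_H1_ex[OF basis M] by blast
      have "?e h = m" using h(2) m by (auto simp: fun_eq_iff PiE_iff extensional_def)
      then show "m \<in> ?e ` carrier (hom_group (H1 F) M)" using h(1) by blast
    qed (auto simp: x hom_in_carrier)
  qed
  ultimately show ?thesis by (auto simp: is_iso_def iso_def)
qed

text \<open>Evaluation at the basis turns the group into \<open>n\<close> copies of
  \<open>M\<close>, each free on \<open>T\<close>. The copies of \<open>T\<close> are tagged as
  \<open>{i} \<times> T\<close> to make them disjoint, and over a finite index set the direct sum is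
  the product.\<close>

lemma fg_free_abelian_hom_group_H1:
  fixes n :: nat
  assumes basis: "free_basis F {..<n} x" and M: "comm_group M"
    and T: "finite (T :: 't set)" "free_Abelian_group T \<cong> M"
  shows "fg_free_abelian (hom_group (H1 F) M)"
proof -
  interpret M: comm_group M by (rule M)
  interpret P: group "product_group {..<n} (\<lambda>_. M)" by simp
  have HG: "group (hom_group (H1 F) M)"
    by (rule M.group_hom_group[OF group_H1[OF free_basisD(1)[OF basis]]])
  let ?X = "\<lambda>i. {i :: nat} \<times> T"
  have X: "free_Abelian_group (?X i) \<cong> M" for i
  proof -
    have "?X i \<approx> T"
      unfolding eqpoll_def by (rule exI[of _ snd]) (auto simp: bij_betw_def inj_on_def image_iff)
    then show ?thesis using T(2) isomorphic_free_Abelian_groups iso_trans by blast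
  qed
  have sum_eq: "sum_group {..<n} (\<lambda>i. M) = product_group {..<n} (\<lambda>_. M)"
  proof -
    have "finite {i \<in> {..<n}. f i \<noteq> \<one>\<^bsub>M\<^esub>}" for f :: "nat \<Rightarrow> _" by (rule finite_subset[of _ "{..<n}"]) auto
    then have "carrier (sum_group {..<n} (\<lambda>i. M)) = carrier (product_group {..<n} (\<lambda>_. M))"
      by (subst carrier_sum_group) auto
    moreover have "monoid.mult (sum_group {..<n} (\<lambda>i. M)) = monoid.mult (product_group {..<n} (\<lambda>_. M))" by simp
    moreover have "\<one>\<^bsub>sum_group {..<n} (\<lambda>i. M)\<^esub> = \<one>\<^bsub>product_group {..<n} (\<lambda>_. M)\<^esub>" by simp
    ultimately show ?thesis by (intro monoid.equality) auto
  qed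
  have "free_Abelian_group (\<Union>(?X ` {..<n})) \<cong> sum_group {..<n} (\<lambda>i. free_Abelian_group (?X i))"
  proof (rule group.iso_sym)
    show "sum_group {..<n} (\<lambda>i. free_Abelian_group (?X i)) \<cong> free_Abelian_group (\<Union>(?X ` {..<n}))"
      unfolding is_iso_def
      using iso_free_Abelian_group_sum[of ?X "{..<n}"] by (auto simp: pairwise_def disjnt_def)
  qed simp
  also have "\<dots> \<cong> sum_group {..<n} (\<lambda>i. M)"
    by (rule iso_sum_groupI) (auto simp: X)
  also have "\<dots> \<cong> hom_group (H1 F) M"
    unfolding sum_eq by (rule group.iso_sym[OF HG hom_group_H1_iso_product[OF basis M]])
  finally have iso: "free_Abelian_group (\<Union>(?X ` {..<n})) \<cong> hom_group (H1 F) M" .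
  have "finite (\<Union>(?X ` {..<n}))" using T(1) by auto
  then obtain r where "{..<r::nat} \<approx> \<Union>(?X ` {..<n})"
    using eqpoll_sym eqpoll_iff_card finite_lessThan card_lessThan by metis
  then have "free_Abelian_group {..<r} \<cong> hom_group (H1 F) M"
    using iso isomorphic_free_Abelian_groups iso_trans by blast
  then show ?thesis using HG by (auto simp: fg_free_abelian_def)
qed

subsection \<open>The refined Johnson homomorphism\<close>

lemma coset_map_rcos:
  assumes f: "group_hom G H f" and N: "N \<lhd> G" and M: "M \<lhd> H" and fN: "f ` N \<subseteq> M" and g: "g \<in> carrier G"
  shows "coset_map H M f (N #>\<^bsub>G\<^esub> g) = M #>\<^bsub>H\<^esub> f g"
proof -
  interpret f: group_hom G H f by (rule f)
  have sub: "subgroup N G" using N by (rule normal_imp_subgroup)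
  have "M #>\<^bsub>H\<^esub> f g' = M #>\<^bsub>H\<^esub> f g" if g': "g' \<in> N #>\<^bsub>G\<^esub> g" for g'
  proof -
    obtain u where u: "u \<in> N" "g' = u \<otimes>\<^bsub>G\<^esub> g" using g' by (auto simp: r_coset_def)
    have uG: "u \<in> carrier G" using subgroup.mem_carrier[OF sub u(1)] .
    have "f g' \<otimes>\<^bsub>H\<^esub> inv\<^bsub>H\<^esub> f g = f u" using u uG g by (simp add: f.H.m_assoc)
    then show ?thesis
      using f.H.rcos_eq_iff[OF M, of "f g'" "f g"] u uG g fN by auto
  qed
  moreover have "g \<in> N #>\<^bsub>G\<^esub> g" by (rule f.G.rcos_self[OF g sub])
  ultimately show ?thesis unfolding coset_map_def by blast
qed

context free_acyclic_closure
begin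

lemma \<iota>_rcos_eq_iff:
  assumes "0 < k" "g \<in> carrier F" "g' \<in> carrier F"
  shows "lower_central A k #>\<^bsub>A\<^esub> \<iota> g = lower_central A k #>\<^bsub>A\<^esub> \<iota> g' \<longleftrightarrow>
    lower_central F k #>\<^bsub>F\<^esub> g = lower_central F k #>\<^bsub>F\<^esub> g'"
  using assms \<iota>_lower_central_iff[OF assms(1), of "g \<otimes>\<^bsub>F\<^esub> inv\<^bsub>F\<^esub> g'"]
  by (simp add: A.rcos_eq_iff[OF A.lower_central_normal] F.rcos_eq_iff[OF F.lower_central_normal])

text \<open>The inverse hidden in \<open>nil_action\<close> never has to be computed: since the map
  induced by \<iota> is injective, exhibiting one \<open>g'\<close> with the right image determines
  the value.\<close>

lemma nil_action_eq:
  assumes k: "0 < k" and \<phi>: "\<phi> \<in> hom A A" and g: "g \<in> carrier F" "g' \<in> carrier F"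
    and eq: "lower_central A k #>\<^bsub>A\<^esub> \<phi> (\<iota> g) = lower_central A k #>\<^bsub>A\<^esub> \<iota> g'"
  shows "nil_action F A \<iota> k \<phi> (lower_central F k #>\<^bsub>F\<^esub> g) = lower_central F k #>\<^bsub>F\<^esub> g'"
proof -
  interpret \<phi>: group_hom A A \<phi> using \<phi> by unfold_locales
  define \<theta> where "\<theta> = coset_map A (lower_central A k) \<iota>"
  have \<theta>: "\<theta> (lower_central F k #>\<^bsub>F\<^esub> u) = lower_central A k #>\<^bsub>A\<^esub> \<iota> u" if "u \<in> carrier F" for u
    unfolding \<theta>_def
    by (rule coset_map_rcos[OF \<iota>.group_hom_axioms F.lower_central_normal A.lower_central_normal _ that])
      (use \<iota>.lower_central_hom in blast)
  have inj: "inj_on \<theta> (carrier (nil_quot F k))"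
    using \<theta> \<iota>_rcos_eq_iff[OF k] by (auto simp: inj_on_def nil_quot_def carrier_FactGroup)
  have mem: "lower_central F k #>\<^bsub>F\<^esub> u \<in> carrier (nil_quot F k)" if "u \<in> carrier F" for u
    using that by (auto simp: nil_quot_def carrier_FactGroup)
  have "coset_map A (lower_central A k) \<phi> (\<theta> (lower_central F k #>\<^bsub>F\<^esub> g)) = lower_central A k #>\<^bsub>A\<^esub> \<phi> (\<iota> g)"
    unfolding \<theta>[OF g(1)]
    by (rule coset_map_rcos[OF \<phi>.group_hom_axioms A.lower_central_normal A.lower_central_normal])
      (use \<phi>.lower_central_hom g in auto)
  also have "\<dots> = \<theta> (lower_central F k #>\<^bsub>F\<^esub> g')" using eq \<theta>[OF g(2)] by simp
  finally show ?thesis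
    unfolding nil_action_def Let_def \<theta>_def[symmetric]
    using the_inv_into_f_f[OF inj mem[OF g(2)]] mem[OF g(1)] by simp
qed

lemma auto_hom: "\<phi> \<in> auto A \<Longrightarrow> \<phi> \<in> hom A A"
  by (simp add: auto_def)

text \<open>This removes the transport to \<open>F\<close>: membership becomes a congruence in
  \<open>A\<close>. Surjectivity of \<iota> modulo \<Gamma>^k supplies the representative needed to
  evaluate the action.\<close>

lemma aut_filtration_iff:
  assumes k: "0 < k"
  shows "\<phi> \<in> aut_filtration F A \<iota> k \<longleftrightarrow>
    \<phi> \<in> auto A \<and> (\<forall>g\<in>carrier F. lower_central A k #>\<^bsub>A\<^esub> \<phi> (\<iota> g) = lower_central A k #>\<^bsub>A\<^esub> \<iota> g)"
proof -
  have "nil_action F A \<iota> k \<phi> = (\<lambda>C\<in>carrier (nil_quot F k). C) \<longleftrightarrow>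
      (\<forall>g\<in>carrier F. lower_central A k #>\<^bsub>A\<^esub> \<phi> (\<iota> g) = lower_central A k #>\<^bsub>A\<^esub> \<iota> g)"
    if \<phi>: "\<phi> \<in> auto A"
  proof
    assume id: "nil_action F A \<iota> k \<phi> = (\<lambda>C\<in>carrier (nil_quot F k). C)"
    show "\<forall>g\<in>carrier F. lower_central A k #>\<^bsub>A\<^esub> \<phi> (\<iota> g) = lower_central A k #>\<^bsub>A\<^esub> \<iota> g"
    proof
      fix g assume g: "g \<in> carrier F"
      have "\<phi> (\<iota> g) \<in> carrier A" using hom_in_carrier[OF auto_hom[OF \<phi>]] g by simp
      then obtain g' where g': "g' \<in> carrier F" "lower_central A k #>\<^bsub>A\<^esub> \<phi> (\<iota> g) = lower_central A k #>\<^bsub>A\<^esub> \<iota> g'"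
        using \<iota>_surj_mod[OF k] by blast
      have "lower_central F k #>\<^bsub>F\<^esub> g = lower_central F k #>\<^bsub>F\<^esub> g'"
        using nil_action_eq[OF k auto_hom[OF \<phi>] g g'] id g by (simp add: nil_quot_def carrier_FactGroup)
      then show "lower_central A k #>\<^bsub>A\<^esub> \<phi> (\<iota> g) = lower_central A k #>\<^bsub>A\<^esub> \<iota> g"
        using \<iota>_rcos_eq_iff[OF k g g'(1)] g'(2) by simp
    qed
  next
    assume eq: "\<forall>g\<in>carrier F. lower_central A k #>\<^bsub>A\<^esub> \<phi> (\<iota> g) = lower_central A k #>\<^bsub>A\<^esub> \<iota> g"
    show "nil_action F A \<iota> k \<phi> = (\<lambda>C\<in>carrier (nil_quot F k). C)"
    proof (rule extensionalityI[of _ "carrier (nil_quot F k)"])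
      fix C assume "C \<in> carrier (nil_quot F k)"
      then obtain g where g: "g \<in> carrier F" "C = lower_central F k #>\<^bsub>F\<^esub> g"
        by (auto simp: nil_quot_def carrier_FactGroup)
      then show "nil_action F A \<iota> k \<phi> C = (\<lambda>C\<in>carrier (nil_quot F k). C) C"
        using nil_action_eq[OF k auto_hom[OF \<phi>] g(1) g(1)] eq by (simp add: nil_quot_def carrier_FactGroup)
    qed (simp_all add: nil_action_def Let_def)
  qed
  then show ?thesis
    by (auto simp: aut_filtration_def kernel_def AutoGroup_def BijGroup_def)
qed

lemma aut_filtrationI:
  assumes k: "0 < k" and \<phi>: "\<phi> \<in> auto A"
    and eq: "\<And>i. i < n \<Longrightarrow> lower_central A k #>\<^bsub>A\<^esub> \<phi> (\<iota> (x i)) = lower_central A k #>\<^bsub>A\<^esub> \<iota> (x i)"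
  shows "\<phi> \<in> aut_filtration F A \<iota> k"
  unfolding aut_filtration_iff[OF k]
proof (intro conjI ballI \<phi>)
  fix g assume g: "g \<in> carrier F"
  have Q: "group (A Mod lower_central A k)" by (rule normal.factorgroup_is_group[OF A.lower_central_normal])
  have p: "(\<lambda>a. lower_central A k #>\<^bsub>A\<^esub> a) \<in> hom A (A Mod lower_central A k)"
    by (rule normal.r_coset_hom_Mod[OF A.lower_central_normal])
  have "((\<lambda>a. lower_central A k #>\<^bsub>A\<^esub> a) \<circ> (\<phi> \<circ> \<iota>)) g = ((\<lambda>a. lower_central A k #>\<^bsub>A\<^esub> a) \<circ> \<iota>) g"
    by (rule free_basis_hom_eq[OF basis Q Group.hom_compose[OF Group.hom_compose[OF \<iota>.homh auto_hom[OF \<phi>]] p]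
        Group.hom_compose[OF \<iota>.homh p] _ g]) (simp add: eq)
  then show "lower_central A k #>\<^bsub>A\<^esub> \<phi> (\<iota> g) = lower_central A k #>\<^bsub>A\<^esub> \<iota> g" by simp
qed

text \<open>Every \<open>a\<close> is congruent to some \<open>\<iota> g\<close>, and \<phi>
  respects \<Gamma>^k, so triviality spreads from the image of \<open>F\<close> to all of
  \<open>A\<close>. This is the hypothesis under which \<phi> shifts the lower central
  series.\<close>

lemma aut_filtration_displacement:
  assumes k: "0 < k" and \<phi>: "\<phi> \<in> aut_filtration F A \<iota> k" and a: "a \<in> carrier A"
  shows "\<phi> a \<otimes>\<^bsub>A\<^esub> inv\<^bsub>A\<^esub> a \<in> lower_central A k"
proof -
  have \<phi>A: "\<phi> \<in> auto A" and eq: "\<And>g. g \<in> carrier F \<Longrightarrow> lower_central A k #>\<^bsub>A\<^esub> \<phi> (\<iota> g) = lower_central A k #>\<^bsub>A\<^esub> \<iota> g"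
    using \<phi> by (simp_all add: aut_filtration_iff[OF k])
  interpret \<phi>: group_hom A A \<phi> using auto_hom[OF \<phi>A] by unfold_locales
  obtain g where g: "g \<in> carrier F" "lower_central A k #>\<^bsub>A\<^esub> a = lower_central A k #>\<^bsub>A\<^esub> \<iota> g"
    using \<iota>_surj_mod[OF k a] by blast
  have "a \<otimes>\<^bsub>A\<^esub> inv\<^bsub>A\<^esub> \<iota> g \<in> lower_central A k"
    using A.rcos_eq_iff[OF A.lower_central_normal a] g by simp
  then have "\<phi> (a \<otimes>\<^bsub>A\<^esub> inv\<^bsub>A\<^esub> \<iota> g) \<in> lower_central A k" by (rule \<phi>.lower_central_hom)
  then have "lower_central A k #>\<^bsub>A\<^esub> \<phi> a = lower_central A k #>\<^bsub>A\<^esub> \<phi> (\<iota> g)"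
    using A.rcos_eq_iff[OF A.lower_central_normal, of "\<phi> a" "\<phi> (\<iota> g)" k] a g by simp
  then show ?thesis
    using eq[OF g(1)] g(2) A.rcos_eq_iff[OF A.lower_central_normal, of "\<phi> a" a k] a by simp
qed

text \<open>A relation rather than a function, because \<open>u\<close> is determined only modulo
  \<Gamma>^l. The representative is sought in \<open>F\<close>, where the target of the homomorphism
  lives, although \<phi> acts on \<open>A\<close>.\<close>

definition displaces :: "nat \<Rightarrow> nat \<Rightarrow> ('a \<Rightarrow> 'a) \<Rightarrow> nat \<Rightarrow> 'f \<Rightarrow> bool" where
  "displaces k l \<phi> i u \<longleftrightarrow> u \<in> lower_central F k \<and>
     lower_central A l #>\<^bsub>A\<^esub> \<phi> (\<iota> (x i)) = lower_central A l #>\<^bsub>A\<^esub> \<iota> (u \<otimes>\<^bsub>F\<^esub> x i)"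

text \<open>A representative \<open>g\<close> of \<open>\<phi> (\<iota> (x i))\<close> modulo
  \<Gamma>^l gives the candidate g x_i^(-1). It lies in \<Gamma>^k because \<phi> is trivial modulo
  \<Gamma>^k and k \<le> l, and \<iota> reflects the filtration.\<close>

lemma displaces_ex:
  assumes kl: "0 < k" "k \<le> l" and \<phi>: "\<phi> \<in> aut_filtration F A \<iota> k" and i: "i < n"
  obtains u where "displaces k l \<phi> i u"
proof -
  have "\<phi> \<in> auto A" using \<phi> by (simp add: aut_filtration_iff[OF kl(1)])
  then have c: "\<phi> (\<iota> (x i)) \<in> carrier A" using hom_in_carrier[OF auto_hom] i by simp
  obtain g where g: "g \<in> carrier F" "lower_central A l #>\<^bsub>A\<^esub> \<phi> (\<iota> (x i)) = lower_central A l #>\<^bsub>A\<^esub> \<iota> g"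
    using \<iota>_surj_mod[OF _ c, of l] kl by auto
  let ?u = "g \<otimes>\<^bsub>F\<^esub> inv\<^bsub>F\<^esub> x i"
  have "\<iota> g \<otimes>\<^bsub>A\<^esub> inv\<^bsub>A\<^esub> \<phi> (\<iota> (x i)) \<in> lower_central A k"
    using A.rcos_eq_iff[OF A.lower_central_normal, of "\<iota> g" "\<phi> (\<iota> (x i))" l] g c
      A.lower_central_antimono[OF kl(2)] by auto
  moreover have "\<phi> (\<iota> (x i)) \<otimes>\<^bsub>A\<^esub> inv\<^bsub>A\<^esub> \<iota> (x i) \<in> lower_central A k"
    using aut_filtration_displacement[OF kl(1) \<phi>] i by simp
  ultimately have "(\<iota> g \<otimes>\<^bsub>A\<^esub> inv\<^bsub>A\<^esub> \<phi> (\<iota> (x i))) \<otimes>\<^bsub>A\<^esub> (\<phi> (\<iota> (x i)) \<otimes>\<^bsub>A\<^esub> inv\<^bsub>A\<^esub> \<iota> (x i)) \<in> lower_central A k"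
    by (rule subgroup.m_closed[OF A.lower_central_subgroup])
  then have "\<iota> ?u \<in> lower_central A k" using g(1) c i by (simp add: A.m_assoc)
  moreover have "?u \<in> carrier F" using g(1) i by simp
  ultimately have "?u \<in> lower_central F k" using \<iota>_lower_central_iff[OF kl(1)] by metis
  moreover have "?u \<otimes>\<^bsub>F\<^esub> x i = g" using g(1) i by (simp add: F.m_assoc)
  ultimately have "displaces k l \<phi> i ?u" using g(2) by (simp only: displaces_def)
  then show thesis by (rule that)
qed

lemma displaces_rcos_eq:
  assumes kl: "0 < k" "k \<le> l" and i: "i < n" and u: "displaces k l \<phi> i u"
    and v: "v \<in> carrier F" "lower_central A l #>\<^bsub>A\<^esub> \<phi> (\<iota> (x i)) = lower_central A l #>\<^bsub>A\<^esub> \<iota> (v \<otimes>\<^bsub>F\<^esub> x i)"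
  shows "lower_central F l #>\<^bsub>F\<^esub> v = lower_central F l #>\<^bsub>F\<^esub> u"
proof -
  have uF: "u \<in> carrier F" using u F.lower_central_closed by (auto simp: displaces_def)
  have "lower_central F l #>\<^bsub>F\<^esub> (v \<otimes>\<^bsub>F\<^esub> x i) = lower_central F l #>\<^bsub>F\<^esub> (u \<otimes>\<^bsub>F\<^esub> x i)"
    using \<iota>_rcos_eq_iff[of l "v \<otimes>\<^bsub>F\<^esub> x i" "u \<otimes>\<^bsub>F\<^esub> x i"] u v kl i uF by (simp add: displaces_def)
  then have "(v \<otimes>\<^bsub>F\<^esub> x i) \<otimes>\<^bsub>F\<^esub> inv\<^bsub>F\<^esub> (u \<otimes>\<^bsub>F\<^esub> x i) \<in> lower_central F l"
    using F.rcos_eq_iff[OF F.lower_central_normal] v uF i by simp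
  then show ?thesis
    using F.rcos_eq_iff[OF F.lower_central_normal v(1) uF] v uF i by (simp add: F.m_assoc F.inv_mult_group)
qed

lemma displaces_mono:
  assumes "displaces k l \<phi> i u" "l' \<le> l" "\<phi> \<in> hom A A" "i < n"
  shows "displaces k l' \<phi> i u"
proof -
  have "\<phi> (\<iota> (x i)) \<in> carrier A" using hom_in_carrier[OF assms(3)] assms(4) by simp
  moreover have "u \<in> carrier F" using assms(1) F.lower_central_closed by (auto simp: displaces_def)
  ultimately show ?thesis
    using assms A.lower_central_antimono[OF assms(2)]
      A.rcos_eq_iff[OF A.lower_central_normal, of "\<phi> (\<iota> (x i))" "\<iota> (u \<otimes>\<^bsub>F\<^esub> x i)"]
    by (auto simp: displaces_def)
qed

text \<open>Modulo \<Gamma>^l, \<phi>(\<psi>(x_i)) = \<phi>(v) \<phi>(x_i) = v u x_i. Replacing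
  \<phi>(v) by v is the one place where the shift by k - 1 enters, and it forces l \<le> 2k - 1. The
  order v, u appears because \<psi> acts first.\<close>

lemma displaces_compose:
  assumes k: "0 < k" and l: "l < 2 * k" and \<phi>: "\<phi> \<in> aut_filtration F A \<iota> k" and \<psi>: "\<psi> \<in> aut_filtration F A \<iota> k"
    and i: "i < n" and u: "displaces k l \<phi> i u" and v: "displaces k l \<psi> i v"
  shows "displaces k l (compose (carrier A) \<phi> \<psi>) i (v \<otimes>\<^bsub>F\<^esub> u)"
proof -
  have h: "\<phi> \<in> hom A A" "\<psi> \<in> hom A A"
    using \<phi> \<psi> by (simp_all add: aut_filtration_iff[OF k] auto_hom)
  interpret \<phi>: group_hom A A \<phi> using h(1) by unfold_locales
  interpret \<psi>: group_hom A A \<psi> using h(2) by unfold_locales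
  let ?L = "lower_central A l"
  have uv: "u \<in> lower_central F k" "v \<in> lower_central F k"
    and eqs: "?L #>\<^bsub>A\<^esub> \<phi> (\<iota> (x i)) = ?L #>\<^bsub>A\<^esub> \<iota> (u \<otimes>\<^bsub>F\<^esub> x i)" "?L #>\<^bsub>A\<^esub> \<psi> (\<iota> (x i)) = ?L #>\<^bsub>A\<^esub> \<iota> (v \<otimes>\<^bsub>F\<^esub> x i)"
    using u v by (auto simp: displaces_def)
  have c [simp]: "u \<in> carrier F" "v \<in> carrier F" using uv F.lower_central_closed by blast+
  note [simp] = x_closed[OF i]
  have "\<psi> (\<iota> (x i)) \<otimes>\<^bsub>A\<^esub> inv\<^bsub>A\<^esub> \<iota> (v \<otimes>\<^bsub>F\<^esub> x i) \<in> ?L"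
    using eqs(2) A.rcos_eq_iff[OF A.lower_central_normal, of "\<psi> (\<iota> (x i))" "\<iota> (v \<otimes>\<^bsub>F\<^esub> x i)" l] by simp
  from \<phi>.lower_central_hom[OF this]
  have 1: "?L #>\<^bsub>A\<^esub> \<phi> (\<psi> (\<iota> (x i))) = ?L #>\<^bsub>A\<^esub> \<phi> (\<iota> (v \<otimes>\<^bsub>F\<^esub> x i))"
    using A.rcos_eq_iff[OF A.lower_central_normal, of "\<phi> (\<psi> (\<iota> (x i)))" "\<phi> (\<iota> (v \<otimes>\<^bsub>F\<^esub> x i))" l] by simp
  have "\<phi> (\<iota> v) \<otimes>\<^bsub>A\<^esub> inv\<^bsub>A\<^esub> \<iota> v \<in> lower_central A (k + k - 1)"
    by (rule A.endo_shifts_lower_central[OF h(1) aut_filtration_displacement[OF k \<phi>] \<iota>.lower_central_hom[OF uv(2)] k k])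
  moreover have "l \<le> k + k - 1" using l by linarith
  ultimately have "\<phi> (\<iota> v) \<otimes>\<^bsub>A\<^esub> inv\<^bsub>A\<^esub> \<iota> v \<in> ?L"
    using A.lower_central_antimono by blast
  then have 2: "?L #>\<^bsub>A\<^esub> \<phi> (\<iota> v) = ?L #>\<^bsub>A\<^esub> \<iota> v"
    using A.rcos_eq_iff[OF A.lower_central_normal, of "\<phi> (\<iota> v)" "\<iota> v" l] by simp
  have "?L #>\<^bsub>A\<^esub> (\<phi> (\<iota> v) \<otimes>\<^bsub>A\<^esub> \<phi> (\<iota> (x i))) = ?L #>\<^bsub>A\<^esub> (\<iota> v \<otimes>\<^bsub>A\<^esub> \<iota> (u \<otimes>\<^bsub>F\<^esub> x i))"
    by (rule A.rcos_mult_cong[OF A.lower_central_normal _ _ _ _ 2 eqs(1)]) simp_all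
  then have "?L #>\<^bsub>A\<^esub> \<phi> (\<psi> (\<iota> (x i))) = ?L #>\<^bsub>A\<^esub> \<iota> (v \<otimes>\<^bsub>F\<^esub> u \<otimes>\<^bsub>F\<^esub> x i)"
    unfolding 1 by (simp add: A.m_assoc)
  moreover have "v \<otimes>\<^bsub>F\<^esub> u \<in> lower_central F k"
    using uv subgroup.m_closed[OF F.lower_central_subgroup] by blast
  ultimately show ?thesis by (simp add: displaces_def compose_eq)
qed

lemma displaces_one_iff:
  assumes k: "0 < k" "k \<le> l" and i: "i < n" and u: "displaces k l \<phi> i u"
  shows "lower_central F l #>\<^bsub>F\<^esub> u = lower_central F l \<longleftrightarrow>
    lower_central A l #>\<^bsub>A\<^esub> \<phi> (\<iota> (x i)) = lower_central A l #>\<^bsub>A\<^esub> \<iota> (x i)"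
proof -
  have uF [simp]: "u \<in> carrier F" using u F.lower_central_closed by (auto simp: displaces_def)
  note [simp] = x_closed[OF i]
  have "lower_central F l #>\<^bsub>F\<^esub> u = lower_central F l \<longleftrightarrow> u \<in> lower_central F l"
    by (rule F.rcos_eq_self_iff[OF F.lower_central_normal uF])
  also have "\<dots> \<longleftrightarrow> lower_central F l #>\<^bsub>F\<^esub> (u \<otimes>\<^bsub>F\<^esub> x i) = lower_central F l #>\<^bsub>F\<^esub> x i"
    using F.rcos_eq_iff[OF F.lower_central_normal, of "u \<otimes>\<^bsub>F\<^esub> x i" "x i" l] by (simp add: F.m_assoc)
  also have "\<dots> \<longleftrightarrow> lower_central A l #>\<^bsub>A\<^esub> \<iota> (u \<otimes>\<^bsub>F\<^esub> x i) = lower_central A l #>\<^bsub>A\<^esub> \<iota> (x i)"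
    by (rule \<iota>_rcos_eq_iff[symmetric]) (use k in simp_all)
  finally show ?thesis using u by (simp add: displaces_def)
qed

text \<open>The choice is harmless at the levels considered below: the class of \<open>u\<close>
  modulo \<Gamma>^l does not depend on \<open>u\<close>, and a homomorphism is fixed by its values
  on the basis.\<close>

definition refined_johnson :: "nat \<Rightarrow> nat \<Rightarrow> ('a \<Rightarrow> 'a) \<Rightarrow> 'f set \<Rightarrow> 'f set" where
  "refined_johnson k l \<phi> = (SOME h. h \<in> carrier (hom_group (H1 F) (central_section F k l)) \<and>
     (\<forall>i<n. \<forall>u. displaces k l \<phi> i u \<longrightarrow> h (to_H1 F (x i)) = lower_central F l #>\<^bsub>F\<^esub> u))"

section \<open>The refined homomorphism at a level l with k < l < 2k\<close>

context
  fixes k l :: nat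
  assumes k: "2 \<le> k" and l: "k < l" "l < 2 * k"
begin

lemma comm_group_target: "comm_group (central_section F k l)"
  using F.comm_group_central_section[of k l] k l by simp

text \<open>Displacements chosen for the basis prescribe a homomorphism into the abelian section; by
  \<open>displaces_rcos_eq\<close> any other displacement gives the same class, so the defining
  condition can be met.\<close>

lemma refined_johnson:
  assumes \<phi>: "\<phi> \<in> aut_filtration F A \<iota> k"
  shows refined_johnson_closed: "refined_johnson k l \<phi> \<in> carrier (hom_group (H1 F) (central_section F k l))"
    and refined_johnson_gen: "i < n \<Longrightarrow> displaces k l \<phi> i u \<Longrightarrow>
      refined_johnson k l \<phi> (to_H1 F (x i)) = lower_central F l #>\<^bsub>F\<^esub> u"
proof -
  have "\<forall>i. \<exists>u. i < n \<longrightarrow> displaces k l \<phi> i u"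
    using displaces_ex[OF _ _ \<phi>, of l] k l by (metis less_imp_le not_numeral_le_zero gr0I)
  then obtain us where us: "\<And>i. i < n \<Longrightarrow> displaces k l \<phi> i (us i)" by metis
  have "(\<lambda>i. lower_central F l #>\<^bsub>F\<^esub> us i) \<in> {..<n} \<rightarrow> carrier (central_section F k l)"
    using us by (auto simp: F.carrier_central_section displaces_def)
  then obtain h where h: "h \<in> carrier (hom_group (H1 F) (central_section F k l))"
    "\<And>i. i \<in> {..<n} \<Longrightarrow> h (to_H1 F (x i)) = lower_central F l #>\<^bsub>F\<^esub> us i"
    using hom_H1_ex[OF basis comm_group_target] by blast
  have "h (to_H1 F (x i)) = lower_central F l #>\<^bsub>F\<^esub> v" if "i < n" "displaces k l \<phi> i v" for i v
  proof -
    have "lower_central F l #>\<^bsub>F\<^esub> v = lower_central F l #>\<^bsub>F\<^esub> us i"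
      by (rule displaces_rcos_eq[OF _ _ that(1) us[OF that(1)]])
        (use that(2) k l F.lower_central_closed in \<open>auto simp: displaces_def\<close>)
    then show ?thesis using h(2) that(1) by simp
  qed
  with h(1) have "\<exists>h. h \<in> carrier (hom_group (H1 F) (central_section F k l)) \<and>
     (\<forall>i<n. \<forall>u. displaces k l \<phi> i u \<longrightarrow> h (to_H1 F (x i)) = lower_central F l #>\<^bsub>F\<^esub> u)" by blast
  from someI_ex[OF this]
  have *: "refined_johnson k l \<phi> \<in> carrier (hom_group (H1 F) (central_section F k l)) \<and>
     (\<forall>i<n. \<forall>u. displaces k l \<phi> i u \<longrightarrow> refined_johnson k l \<phi> (to_H1 F (x i)) = lower_central F l #>\<^bsub>F\<^esub> u)"
    unfolding refined_johnson_def .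
  then show "refined_johnson k l \<phi> \<in> carrier (hom_group (H1 F) (central_section F k l))" by blast
  show "refined_johnson k l \<phi> (to_H1 F (x i)) = lower_central F l #>\<^bsub>F\<^esub> u" if "i < n" "displaces k l \<phi> i u"
    using * that by blast
qed

lemma aut_filtration_mult:
  assumes "\<phi> \<in> aut_filtration F A \<iota> k" "\<psi> \<in> aut_filtration F A \<iota> k"
  shows "\<phi> \<otimes>\<^bsub>aut_filtration_group F A \<iota> k\<^esub> \<psi> = compose (carrier A) \<phi> \<psi>"
    "compose (carrier A) \<phi> \<psi> \<in> aut_filtration F A \<iota> k"
proof -
  have k0: "0 < k" using k by simp
  have au: "\<phi> \<in> auto A" "\<psi> \<in> auto A"
    and eq: "\<And>g. g \<in> carrier F \<Longrightarrow> lower_central A k #>\<^bsub>A\<^esub> \<psi> (\<iota> g) = lower_central A k #>\<^bsub>A\<^esub> \<iota> g"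
    using assms by (simp_all add: aut_filtration_iff[OF k0])
  have B: "\<phi> \<in> Bij (carrier A)" "\<psi> \<in> Bij (carrier A)" using au by (simp_all add: auto_def)
  show m: "\<phi> \<otimes>\<^bsub>aut_filtration_group F A \<iota> k\<^esub> \<psi> = compose (carrier A) \<phi> \<psi>"
    using B by (simp add: aut_filtration_group_def AutoGroup_def BijGroup_def)
  have "\<phi> \<otimes>\<^bsub>AutoGroup A\<^esub> \<psi> \<in> carrier (AutoGroup A)"
    using monoid.m_closed[OF group.is_monoid[OF A.AutoGroup]] au by (simp add: AutoGroup_def)
  then have au2: "compose (carrier A) \<phi> \<psi> \<in> auto A"
    using B by (simp add: AutoGroup_def BijGroup_def)
  have \<psi>c: "\<psi> a \<in> carrier A" if "a \<in> carrier A" for a using hom_in_carrier[OF auto_hom[OF au(2)] that] .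
  have \<phi>c: "\<phi> a \<in> carrier A" if "a \<in> carrier A" for a using hom_in_carrier[OF auto_hom[OF au(1)] that] .
  show "compose (carrier A) \<phi> \<psi> \<in> aut_filtration F A \<iota> k"
    unfolding aut_filtration_iff[OF k0]
  proof (intro conjI ballI au2)
    fix g assume g: "g \<in> carrier F"
    have "lower_central A k #>\<^bsub>A\<^esub> \<phi> (\<psi> (\<iota> g)) = lower_central A k #>\<^bsub>A\<^esub> \<psi> (\<iota> g)"
      using aut_filtration_displacement[OF k0 assms(1) \<psi>c[OF \<iota>.hom_closed[OF g]]]
        A.rcos_eq_iff[OF A.lower_central_normal, of "\<phi> (\<psi> (\<iota> g))" "\<psi> (\<iota> g)" k] \<psi>c \<phi>c g by simp
    then show "lower_central A k #>\<^bsub>A\<^esub> compose (carrier A) \<phi> \<psi> (\<iota> g) = lower_central A k #>\<^bsub>A\<^esub> \<iota> g"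
      using eq[OF g] g by (simp add: compose_eq)
  qed
qed

lemma refined_johnson_hom:
  "refined_johnson k l \<in> hom (aut_filtration_group F A \<iota> k) (hom_group (H1 F) (central_section F k l))"
proof (rule homI)
  fix \<phi> assume "\<phi> \<in> carrier (aut_filtration_group F A \<iota> k)"
  then show "refined_johnson k l \<phi> \<in> carrier (hom_group (H1 F) (central_section F k l))"
    by (intro refined_johnson_closed) (simp add: aut_filtration_group_def)
next
  interpret M: comm_group "central_section F k l" by (rule comm_group_target)
  interpret HG: group "hom_group (H1 F) (central_section F k l)"
    by (rule M.group_hom_group[OF group_H1[OF F.is_group]])
  fix \<phi> \<psi> assume "\<phi> \<in> carrier (aut_filtration_group F A \<iota> k)" "\<psi> \<in> carrier (aut_filtration_group F A \<iota> k)"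
  then have \<phi>: "\<phi> \<in> aut_filtration F A \<iota> k" and \<psi>: "\<psi> \<in> aut_filtration F A \<iota> k"
    by (simp_all add: aut_filtration_group_def)
  note J = refined_johnson_closed[OF \<phi>] refined_johnson_closed[OF \<psi>]
  note comp = aut_filtration_mult[OF \<phi> \<psi>]
  show "refined_johnson k l (\<phi> \<otimes>\<^bsub>aut_filtration_group F A \<iota> k\<^esub> \<psi>)
    = refined_johnson k l \<phi> \<otimes>\<^bsub>hom_group (H1 F) (central_section F k l)\<^esub> refined_johnson k l \<psi>"
    unfolding comp(1)
  proof (rule hom_H1_eq[OF basis M.is_group refined_johnson_closed[OF comp(2)] HG.m_closed[OF J]])
    fix i assume "i \<in> {..<n}"
    then have i: "i < n" by simp
    obtain u where u: "displaces k l \<phi> i u" using displaces_ex[OF _ _ \<phi> i, of l] k l by auto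
    obtain v where v: "displaces k l \<psi> i v" using displaces_ex[OF _ _ \<psi> i, of l] k l by auto
    have vu: "displaces k l (compose (carrier A) \<phi> \<psi>) i (v \<otimes>\<^bsub>F\<^esub> u)"
      using displaces_compose[OF _ l(2) \<phi> \<psi> i u v] k by simp
    have uv: "u \<in> lower_central F k" "v \<in> lower_central F k" using u v by (simp_all add: displaces_def)
    let ?c = "\<lambda>u. lower_central F l #>\<^bsub>F\<^esub> u"
    have "?c (v \<otimes>\<^bsub>F\<^esub> u) = ?c v \<otimes>\<^bsub>central_section F k l\<^esub> ?c u"
      using F.mult_central_section[OF uv(2,1)] by simp
    \<comment> \<open>Composition yields the displacements in reverse order; commutativity of the
      target restores the order of the factors.\<close>
    also have "\<dots> = ?c u \<otimes>\<^bsub>central_section F k l\<^esub> ?c v"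
      by (rule M.m_comm) (use uv in \<open>auto simp: F.carrier_central_section\<close>)
    finally show "refined_johnson k l (compose (carrier A) \<phi> \<psi>) (to_H1 F (x i)) =
      (refined_johnson k l \<phi> \<otimes>\<^bsub>hom_group (H1 F) (central_section F k l)\<^esub> refined_johnson k l \<psi>) (to_H1 F (x i))"
      using refined_johnson_gen[OF comp(2) i vu] refined_johnson_gen[OF \<phi> i u] refined_johnson_gen[OF \<psi> i v] i
      by (simp add: carrier_H1)
  qed
qed

text \<open>Representatives \<open>u i\<close> of the prescribed values lie in \<Gamma>^k, hence in
  \<Gamma>^2 since k \<ge> 2, so x_i \<mapsto> u_i x_i extends to an automorphism of
  \<open>A\<close>.\<close>

lemma refined_johnson_surj:
  assumes h: "h \<in> carrier (hom_group (H1 F) (central_section F k l))"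
  obtains \<phi> where "\<phi> \<in> aut_filtration F A \<iota> k" "refined_johnson k l \<phi> = h"
proof -
  interpret M: comm_group "central_section F k l" by (rule comm_group_target)
  have "\<forall>i. \<exists>u. i < n \<longrightarrow> u \<in> lower_central F k \<and> h (to_H1 F (x i)) = lower_central F l #>\<^bsub>F\<^esub> u"
  proof
    fix i
    have "h (to_H1 F (x i)) \<in> carrier (central_section F k l)" if "i < n"
      using h that by (auto simp: carrier_H1 intro!: hom_in_carrier[of h "H1 F"])
    then show "\<exists>u. i < n \<longrightarrow> u \<in> lower_central F k \<and> h (to_H1 F (x i)) = lower_central F l #>\<^bsub>F\<^esub> u"
      by (auto simp: F.carrier_central_section)
  qed
  then obtain u where u: "\<And>i. i < n \<Longrightarrow> u i \<in> lower_central F k" "\<And>i. i < n \<Longrightarrow> h (to_H1 F (x i)) = lower_central F l #>\<^bsub>F\<^esub> u i"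
    by metis
  have "u i \<in> lower_central F 2" if "i < n" for i
    using u(1)[OF that] F.lower_central_antimono[OF k] by blast
  then obtain \<phi> where \<phi>: "\<phi> \<in> auto A" "\<And>i. i < n \<Longrightarrow> \<phi> (\<iota> (x i)) = \<iota> (u i \<otimes>\<^bsub>F\<^esub> x i)"
    by (rule automorphism_ex) blast+
  have d: "displaces k l \<phi> i (u i)" if "i < n" for i
    using u(1) \<phi>(2) that by (simp add: displaces_def)
  have \<phi>k: "\<phi> \<in> aut_filtration F A \<iota> k"
  proof (rule aut_filtrationI[OF _ \<phi>(1)])
    fix i assume i: "i < n"
    then have uF: "u i \<in> carrier F" using u(1) F.lower_central_closed by blast
    have "lower_central F k #>\<^bsub>F\<^esub> u i = lower_central F k"
      using F.rcos_eq_self_iff[OF F.lower_central_normal uF] u(1)[OF i] by simp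
    moreover have "displaces k k \<phi> i (u i)"
      using displaces_mono[OF d[OF i] _ auto_hom[OF \<phi>(1)] i] l by simp
    ultimately show "lower_central A k #>\<^bsub>A\<^esub> \<phi> (\<iota> (x i)) = lower_central A k #>\<^bsub>A\<^esub> \<iota> (x i)"
      using displaces_one_iff[of k k i \<phi> "u i"] k i by simp
  qed (use k in simp)
  moreover have "refined_johnson k l \<phi> = h"
    by (rule hom_H1_eq[OF basis M.is_group refined_johnson_closed[OF \<phi>k] h])
      (simp add: refined_johnson_gen[OF \<phi>k _ d] u(2))
  ultimately show thesis using that by blast
qed

text \<open>A trivial value at the class of \<open>x i\<close> means that the displacement lies in
  \<Gamma>^l, that is, \<phi> fixes \<open>\<iota> (x i)\<close> modulo \<Gamma>^l; on both sides
  the basis decides.\<close>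

lemma refined_johnson_kernel:
  "kernel (aut_filtration_group F A \<iota> k) (hom_group (H1 F) (central_section F k l)) (refined_johnson k l)
    = aut_filtration F A \<iota> l"
proof -
  interpret M: comm_group "central_section F k l" by (rule comm_group_target)
  interpret HG: group "hom_group (H1 F) (central_section F k l)"
    by (rule M.group_hom_group[OF group_H1[OF F.is_group]])
  have k0: "0 < k" and l0: "0 < l" using k l by simp_all
  \<comment> \<open>The kernel is formed inside level k, so equality of the sets also requires that
    level l is contained in it.\<close>
  have sub: "\<phi> \<in> aut_filtration F A \<iota> k" if \<phi>: "\<phi> \<in> aut_filtration F A \<iota> l" for \<phi>
  proof (rule aut_filtrationI[OF k0])
    show a: "\<phi> \<in> auto A" using \<phi> by (simp add: aut_filtration_iff[OF l0])
    fix i assume i: "i < n"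
    have "\<phi> (\<iota> (x i)) \<otimes>\<^bsub>A\<^esub> inv\<^bsub>A\<^esub> \<iota> (x i) \<in> lower_central A k"
      using aut_filtration_displacement[OF l0 \<phi>, of "\<iota> (x i)"] A.lower_central_antimono[of k l] l i by auto
    then show "lower_central A k #>\<^bsub>A\<^esub> \<phi> (\<iota> (x i)) = lower_central A k #>\<^bsub>A\<^esub> \<iota> (x i)"
      using A.rcos_eq_iff[OF A.lower_central_normal, of "\<phi> (\<iota> (x i))" "\<iota> (x i)" k]
        hom_in_carrier[OF auto_hom[OF a]] i by simp
  qed
  have "refined_johnson k l \<phi> = \<one>\<^bsub>hom_group (H1 F) (central_section F k l)\<^esub> \<longleftrightarrow> \<phi> \<in> aut_filtration F A \<iota> l"
    if \<phi>: "\<phi> \<in> aut_filtration F A \<iota> k" for \<phi>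
  proof -
    have a: "\<phi> \<in> auto A" using \<phi> by (simp add: aut_filtration_iff[OF k0])
    have iff: "refined_johnson k l \<phi> (to_H1 F (x i)) = lower_central F l \<longleftrightarrow>
        lower_central A l #>\<^bsub>A\<^esub> \<phi> (\<iota> (x i)) = lower_central A l #>\<^bsub>A\<^esub> \<iota> (x i)" if i: "i < n" for i
    proof -
      obtain u where u: "displaces k l \<phi> i u" using displaces_ex[OF _ _ \<phi> i, of l] k l by auto
      show ?thesis
        using refined_johnson_gen[OF \<phi> i u] displaces_one_iff[OF k0 _ i u] l by simp
    qed
    have one: "\<one>\<^bsub>hom_group (H1 F) (central_section F k l)\<^esub> (to_H1 F (x i)) = lower_central F l" if "i < n" for i
      using that by (simp add: carrier_H1 F.one_central_section)
    show ?thesis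
    proof
      assume "refined_johnson k l \<phi> = \<one>\<^bsub>hom_group (H1 F) (central_section F k l)\<^esub>"
      then show "\<phi> \<in> aut_filtration F A \<iota> l"
        using iff one by (intro aut_filtrationI[OF l0 a]) simp
    next
      assume "\<phi> \<in> aut_filtration F A \<iota> l"
      then have "lower_central A l #>\<^bsub>A\<^esub> \<phi> (\<iota> (x i)) = lower_central A l #>\<^bsub>A\<^esub> \<iota> (x i)" if "i < n" for i
        using that by (simp add: aut_filtration_iff[OF l0])
      then show "refined_johnson k l \<phi> = \<one>\<^bsub>hom_group (H1 F) (central_section F k l)\<^esub>"
        using iff one by (intro hom_H1_eq[OF basis M.is_group refined_johnson_closed[OF \<phi>] HG.one_closed]) simp
    qed
  qed
  then show ?thesis using sub by (auto simp: kernel_def aut_filtration_group_def)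
qed

text \<open>A displacement modulo \<Gamma>^l is also one modulo \<Gamma>^(k+1), and the value of
  \<open>kernel_iso\<close> at \<open>x i\<close> is its class there. Both sides are homomorphisms
  on the abelianization, so the basis suffices.\<close>

lemma refined_johnson_projection:
  assumes \<phi>: "\<phi> \<in> aut_filtration F A \<iota> k"
  shows "(\<lambda>c \<in> carrier (H1 F). central_projection F (k + 1) (refined_johnson k l \<phi> c)) = johnson F {..<n} x A \<iota> k \<phi>"
proof -
  have k0: "0 < k" using k by simp
  have a: "\<phi> \<in> auto A" using \<phi> by (simp add: aut_filtration_iff[OF k0])
  interpret M: group "central_section F k l" using comm_group_target by (simp add: comm_group_def)
  interpret M1: comm_group "central_section F k (k + 1)"
    using F.comm_group_central_section[of k "k + 1"] k by simp
  let ?L = "lower_central F l" and ?N = "lower_central F (k + 1)"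
  let ?p = "central_projection F (k + 1)"
  have LN: "?L \<subseteq> ?N" using F.lower_central_antimono[of "k + 1" l] l by simp
  have idh: "group_hom F F (\<lambda>g. g)" by unfold_locales (simp add: hom_def)
  have p: "?p (?L #>\<^bsub>F\<^esub> u) = ?N #>\<^bsub>F\<^esub> u" if "u \<in> carrier F" for u
    unfolding central_projection_def
    by (rule coset_map_rcos[OF idh F.lower_central_normal F.lower_central_normal _ that]) (use LN in simp)
  have ph: "?p \<in> hom (central_section F k l) (central_section F k (k + 1))"
  proof (rule homI)
    fix C assume "C \<in> carrier (central_section F k l)"
    then show "?p C \<in> carrier (central_section F k (k + 1))"
      using p F.lower_central_closed by (auto simp: F.carrier_central_section)
  next
    fix C D assume "C \<in> carrier (central_section F k l)" "D \<in> carrier (central_section F k l)"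
    then obtain u v where uv: "u \<in> lower_central F k" "C = ?L #>\<^bsub>F\<^esub> u" "v \<in> lower_central F k" "D = ?L #>\<^bsub>F\<^esub> v"
      by (auto simp: F.carrier_central_section)
    have c: "u \<in> carrier F" "v \<in> carrier F" using uv F.lower_central_closed by blast+
    show "?p (C \<otimes>\<^bsub>central_section F k l\<^esub> D) = ?p C \<otimes>\<^bsub>central_section F k (k + 1)\<^esub> ?p D"
      unfolding uv(2,4) F.mult_central_section[OF uv(1,3)] p[OF c(1)] p[OF c(2)] p[OF F.m_closed[OF c]] ..
  qed
  define h0 where "h0 = (\<lambda>c \<in> carrier (H1 F). ?p (refined_johnson k l \<phi> c))"
  have "?p \<circ> refined_johnson k l \<phi> \<in> hom (H1 F) (central_section F k (k + 1))"
    using refined_johnson_closed[OF \<phi>] ph by (intro Group.hom_compose[of _ _ "central_section F k l"]) auto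
  then have h0: "h0 \<in> carrier (hom_group (H1 F) (central_section F k (k + 1)))"
    using monoid.m_closed[OF group.is_monoid[OF group_H1[OF F.is_group]]]
    by (auto simp: h0_def hom_def Pi_iff)
  have "\<forall>i. \<exists>u. i < n \<longrightarrow> displaces k l \<phi> i u"
    using displaces_ex[OF _ _ \<phi>, of l] k l by (metis less_imp_le not_numeral_le_zero gr0I)
  then obtain u where u: "\<And>i. i < n \<Longrightarrow> displaces k l \<phi> i (u i)" by metis
  have uF: "u i \<in> carrier F" if "i < n" for i
    using u[OF that] F.lower_central_closed by (auto simp: displaces_def)
  have u1: "displaces k (k + 1) \<phi> i (u i)" if "i < n" for i
    using displaces_mono[OF u[OF that] _ auto_hom[OF a] that] l by simp
  have h0x: "h0 (to_H1 F (x i)) = ?N #>\<^bsub>F\<^esub> u i" if "i < n" for i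
    using refined_johnson_gen[OF \<phi> that u[OF that]] p[OF uF[OF that]] that by (simp add: h0_def carrier_H1)
  let ?f = "nil_action F A \<iota> (k + 1) \<phi>"
  have f: "?f (?N #>\<^bsub>F\<^esub> g) = ?N #>\<^bsub>F\<^esub> g'"
    if "g \<in> carrier F" "g' \<in> carrier F" "lower_central A (k + 1) #>\<^bsub>A\<^esub> \<phi> (\<iota> g) = lower_central A (k + 1) #>\<^bsub>A\<^esub> \<iota> g'" for g g'
    by (rule nil_action_eq[OF _ auto_hom[OF a] that]) simp
  have fx: "?f (?N #>\<^bsub>F\<^esub> x i) = ?N #>\<^bsub>F\<^esub> (u i \<otimes>\<^bsub>F\<^esub> x i)" if "i < n" for i
    using f[of "x i" "u i \<otimes>\<^bsub>F\<^esub> x i"] u1[OF that] uF[OF that] that by (simp add: displaces_def)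
  \<comment> \<open>Any lift sends \<open>x i\<close> to u_i x_i modulo \<Gamma>^(k+1), so the class
    used by \<open>kernel_iso\<close> is independent of the lift.\<close>
  have lift: "?N #>\<^bsub>F\<^esub> (\<psi> (x i) \<otimes>\<^bsub>F\<^esub> inv\<^bsub>F\<^esub> x i) = ?N #>\<^bsub>F\<^esub> u i"
    if \<psi>: "is_lift F (k + 1) ?f \<psi>" and i: "i < n" for \<psi> i
  proof -
    have h: "\<psi> \<in> hom F F" and "?N #>\<^bsub>F\<^esub> \<psi> (x i) = ?N #>\<^bsub>F\<^esub> (u i \<otimes>\<^bsub>F\<^esub> x i)"
      using \<psi> fx[OF i] i by (auto simp: is_lift_def)
    moreover have c: "\<psi> (x i) \<in> carrier F" using hom_in_carrier[OF h] i by simp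
    ultimately have "\<psi> (x i) \<otimes>\<^bsub>F\<^esub> inv\<^bsub>F\<^esub> (u i \<otimes>\<^bsub>F\<^esub> x i) \<in> ?N"
      using F.rcos_eq_iff[OF F.lower_central_normal c, of "u i \<otimes>\<^bsub>F\<^esub> x i" "k + 1"] uF[OF i] i by simp
    then show ?thesis
      using F.rcos_eq_iff[OF F.lower_central_normal, of "\<psi> (x i) \<otimes>\<^bsub>F\<^esub> inv\<^bsub>F\<^esub> x i" "u i" "k + 1"] c uF[OF i] i
      by (simp add: F.m_assoc F.inv_mult_group)
  qed
  \<comment> \<open>The description in \<open>kernel_iso\<close> quantifies over all lifts; one must
    exist, or its condition on the basis would be vacuous and would not single out a
    homomorphism.\<close>
  have lift_ex: "\<exists>\<psi>. is_lift F (k + 1) ?f \<psi>"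
  proof -
    have "(\<lambda>i. u i \<otimes>\<^bsub>F\<^esub> x i) \<in> {..<n} \<rightarrow> carrier F" using uF by simp
    then obtain \<psi> where \<psi>: "\<psi> \<in> hom F F" "\<And>i. i \<in> {..<n} \<Longrightarrow> \<psi> (x i) = u i \<otimes>\<^bsub>F\<^esub> x i"
      using free_basis_hom_ex[OF basis F.is_group, of "\<lambda>i. u i \<otimes>\<^bsub>F\<^esub> x i"] by blast
    let ?q = "\<lambda>a. lower_central A (k + 1) #>\<^bsub>A\<^esub> a"
    have Q: "group (A Mod lower_central A (k + 1))" by (rule normal.factorgroup_is_group[OF A.lower_central_normal])
    have q: "?q \<in> hom A (A Mod lower_central A (k + 1))"
      by (rule normal.r_coset_hom_Mod[OF A.lower_central_normal])
    have "?N #>\<^bsub>F\<^esub> \<psi> g = ?f (?N #>\<^bsub>F\<^esub> g)" if g: "g \<in> carrier F" for g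
    proof (rule f[symmetric, OF g hom_in_carrier[OF \<psi>(1) g]])
      have "(?q \<circ> (\<phi> \<circ> \<iota>)) g = (?q \<circ> (\<iota> \<circ> \<psi>)) g"
      proof (rule free_basis_hom_eq[OF basis Q Group.hom_compose[OF Group.hom_compose[OF \<iota>.homh auto_hom[OF a]] q]
        Group.hom_compose[OF Group.hom_compose[OF \<psi>(1) \<iota>.homh] q] _ g])
        fix i assume "i \<in> {..<n}"
        then show "(?q \<circ> (\<phi> \<circ> \<iota>)) (x i) = (?q \<circ> (\<iota> \<circ> \<psi>)) (x i)"
          using u1[of i] \<psi>(2)[of i] by (simp add: displaces_def)
      qed
      then show "?q (\<phi> (\<iota> g)) = ?q (\<iota> (\<psi> g))" by simp
    qed
    then show ?thesis using \<psi>(1) by (auto simp: is_lift_def)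
  qed
  have "kernel_iso F {..<n} x k ?f = h0"
    unfolding kernel_iso_def
  proof (rule the_equality)
    show "h0 \<in> carrier (hom_group (H1 F) (central_section F k (k + 1))) \<and>
        (\<forall>\<psi>. is_lift F (k + 1) ?f \<psi> \<longrightarrow> (\<forall>i\<in>{..<n}. h0 (to_H1 F (x i)) = ?N #>\<^bsub>F\<^esub> (\<psi> (x i) \<otimes>\<^bsub>F\<^esub> inv\<^bsub>F\<^esub> x i)))"
      using h0 h0x lift by (metis lessThan_iff)
    fix h assume h: "h \<in> carrier (hom_group (H1 F) (central_section F k (k + 1))) \<and>
        (\<forall>\<psi>. is_lift F (k + 1) ?f \<psi> \<longrightarrow> (\<forall>i\<in>{..<n}. h (to_H1 F (x i)) = ?N #>\<^bsub>F\<^esub> (\<psi> (x i) \<otimes>\<^bsub>F\<^esub> inv\<^bsub>F\<^esub> x i)))"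
    obtain \<psi> where \<psi>: "is_lift F (k + 1) ?f \<psi>" using lift_ex by blast
    show "h = h0"
    proof (rule hom_H1_eq[OF basis M1.is_group _ h0])
      show "h \<in> carrier (hom_group (H1 F) (central_section F k (k + 1)))" using h by blast
      fix i assume i: "i \<in> {..<n}"
      then show "h (to_H1 F (x i)) = h0 (to_H1 F (x i))"
        using h \<psi> lift[OF \<psi>, of i] h0x[of i] by simp
    qed
  qed
  then show ?thesis by (simp add: johnson_def h0_def)
qed

end

end

theorem theorem5p5:
  fixes n k :: nat and F :: "'f monoid" and x :: "nat \<Rightarrow> 'f"
    and A :: "'a monoid" and \<iota> :: "'f \<Rightarrow> 'a"
  assumes "free_basis F {..<n} x"
    and "acyclic_closure F A \<iota>"
    and "2 \<le> k"
  shows "fg_free_abelian (hom_group (H1 F) (central_section F k (2 * k - 1))) \<and>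
    (\<exists>J. J \<in> hom (aut_filtration_group F A \<iota> k)
                  (hom_group (H1 F) (central_section F k (2 * k - 1))) \<and>
       (\<forall>\<phi> \<in> aut_filtration F A \<iota> k.
          (\<lambda>c \<in> carrier (H1 F). central_projection F (k + 1) (J \<phi> c)) =
          johnson F {..<n} x A \<iota> k \<phi>) \<and>
       J ` aut_filtration F A \<iota> k =
         carrier (hom_group (H1 F) (central_section F k (2 * k - 1))) \<and>
       kernel (aut_filtration_group F A \<iota> k)
              (hom_group (H1 F) (central_section F k (2 * k - 1))) J =
         aut_filtration F A \<iota> (2 * k - 1))"
proof -
  interpret free_acyclic_closure n F x A \<iota>
    using assms(1,2) by unfold_locales
  have kl: "2 \<le> k" "k < 2 * k - 1" "2 * k - 1 < 2 * k" using assms(3) by auto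
  let ?l = "2 * k - 1" and ?J = "refined_johnson k (2 * k - 1)"
  \<comment> \<open>The Lyndon trees of degrees k to 2k - 2 index the basis of the section.\<close>
  let ?T = "\<Union>d\<in>{k..<?l}. lyndon_trees n d"
  have fg: "fg_free_abelian (hom_group (H1 F) (central_section F k ?l))"
  proof (rule fg_free_abelian_hom_group_H1[OF basis comm_group_target[OF kl]])
    show "finite ?T" using finite_lyndon_trees by blast
    show "free_Abelian_group ?T \<cong> central_section F k ?l"
      by (rule free_group_central_section_free[OF basis]) (use kl in simp_all)
  qed
  have hom: "?J \<in> hom (aut_filtration_group F A \<iota> k) (hom_group (H1 F) (central_section F k ?l))"
    by (rule refined_johnson_hom[OF kl])
  have proj: "(\<lambda>c \<in> carrier (H1 F). central_projection F (k + 1) (?J \<phi> c)) = johnson F {..<n} x A \<iota> k \<phi>"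
    if "\<phi> \<in> aut_filtration F A \<iota> k" for \<phi>
    by (rule refined_johnson_projection[OF kl that])
  have surj: "?J ` aut_filtration F A \<iota> k = carrier (hom_group (H1 F) (central_section F k ?l))"
  proof (intro equalityI subsetI)
    fix h assume "h \<in> carrier (hom_group (H1 F) (central_section F k ?l))"
    then obtain \<phi> where "\<phi> \<in> aut_filtration F A \<iota> k" "?J \<phi> = h"
      by (rule refined_johnson_surj[OF kl])
    then show "h \<in> ?J ` aut_filtration F A \<iota> k" by blast
  next
    fix h assume "h \<in> ?J ` aut_filtration F A \<iota> k"
    then show "h \<in> carrier (hom_group (H1 F) (central_section F k ?l))"
      using refined_johnson_closed[OF kl] by blast
  qed
  have ker: "kernel (aut_filtration_group F A \<iota> k) (hom_group (H1 F) (central_section F k ?l)) ?J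
      = aut_filtration F A \<iota> ?l"
    by (rule refined_johnson_kernel[OF kl])
  show ?thesis
    by (intro conjI exI[of _ ?J] ballI fg hom proj surj ker)
qed

end
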